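(* Let $x\in\mathcal X$ and $\sigma\ge0$. Suppose the solution map $T(\cdot,\cdot)$ is locally Lipschitz continuous at all points of a neighborhood of $(x,\sigma)$. If there exists at least one $y^*\in T(x,\sigma)$ such that LICQ and strict complementarity hold at $y^*$ (with multipliers $\lambda^*_{\mathcal I},\nu^*$, $\mathcal I=\mathcal I(y^* )$) and $\nabla^2\mathcal L_{\mathcal I}(\cdot,\cdot,\cdot|x,\sigma)$ is continuous at $(\lambda^*_{\mathcal I},\nu^*,y^* )$, then $\frac{\partial^2}{\partial x\partial\sigma}l(x,\sigma)$ exists and is given by $$\frac{\partial^2}{\partial\sigma\partial x}l(x,\sigma)=\frac{\partial^2}{\partial x\partial\sigma}l(x,\sigma)=\nabla_xf(x,y^* )-\begin{bmatrix}0&\nabla^2_{xy}h_\sigma(x,y^* )\end{bmatrix}\big(\nabla^2\mathcal L_{\mathcal I}(\lambda^*_{\mathcal I},\nu^*,y^*|x,\sigma)\big)^{\dagger}\begin{bmatrix}0\\ \nabla_yf(x,y^* )\end{bmatrix}.$$ If this equality holds at $\sigma=0^+$, then $\psi$ is differentiable at $x$ and $\lim_{\sigma\to0}\nabla\psi_\sigma(x)=\nabla\psi(x)$.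
   Context: Setting. $\mathcal X\subseteq\mathbb R^{d_x}$ and $\mathcal Y\subseteq\mathbb R^{d_y}$ are closed convex sets; $f,g:\mathcal X\times\mathcal Y\to\mathbb R$ are twice continuously differentiable with $\|\nabla^2 f\|\le l_{f,1}$, $\|\nabla^2 g\|\le l_{g,1}$ on $\mathcal X\times\mathcal Y$; for each $x$, $f(x,\cdot),g(x,\cdot)$ are bounded below and coercive; $\|\nabla_y f\|\le l_{f,0}$; $\mathcal Y$ is bounded; $\max_{\mathcal X\times\mathcal Y}|f|<\infty$. Moreover $\mathcal Y=\{y: g_i(y)\le 0,\ i\in[m_1];\ h_i(y)=0,\ i\in[m_2]\}$ with $g_i$ convex and twice continuously differentiable and $h_i$ linear. Notation. $h_\sigma(x,y):=\sigma f(x,y)+g(x,y)$, $T(x,\sigma):=\arg\min_{y\in\mathcal Y}h_\sigma(x,y)$, $l(x,\sigma):=\min_{y\in\mathcal Y}h_\sigma(x,y)$, $\psi(x):=\min_{y\in T(x,0)}f(x,y)$, and for $\sigma>0$, $\psi_\sigma(x):=\frac{l(x,\sigma)-l(x,0)}{\sigma}$. $\frac{\partial^2}{\partial\sigma\partial x}l=\frac{\partial}{\partial\sigma}(\nabla_xl)$ and $\frac{\partial^2}{\partial x\partial\sigma}l=\nabla_x(\frac{\partial}{\partial\sigma}l)$; at $\sigma=0^+$ derivatives in $\sigma$ are one-sided (from the right). Local Lipschitz continuity of a solution map $S(w)$ at $w$: there are $r>0$ and $L_S<\infty$ such that $\mathrm{dist}(S(w),S(w'))\le L_S\|w-w'\|$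 for all admissible $w'$ in the ball of radius $r$ around $w$, where $\mathrm{dist}$ between sets is the Hausdorff distance; here $w=(x,\sigma)$. Constraint notions. $\mathcal I(y):=\{i\in[m_1]:g_i(y)=0\}$. LICQ at $y$: the vectors $\nabla h_i(y)$, $i\in[m_2]$, and $\nabla g_i(y)$, $i\in\mathcal I(y)$, are linearly independent. Under LICQ at $y^*\in T(x,\sigma)$ there are unique $\lambda_i^*\ge0$ ($i\in\mathcal I(y^* )$), $\nu_i^*\in\mathbb R$ ($i\in[m_2]$) with $\nabla_y h_\sigma(x,y^* )+\sum_{i\in\mathcal I(y^* )}\lambda_i^*\nabla g_i(y^* )+\sum_{i\in[m_2]}\nu_i^*\nabla h_i(y^* )=0$; strict complementarity: $\lambda_i^*>0$ for all $i\in\mathcal I(y^* )$. For $\mathcal I\subseteq[m_1]$, $\mathcal L_{\mathcal I}(\lambda_{\mathcal I},\nu,y|x,\sigma):=\sigma f(x,y)+g(x,y)+\sum_{i\in\mathcal I}\lambda_ig_i(y)+\sum_{i\in[m_2]}\nu_ih_i(y)$ and $\nabla^2\mathcal L_{\mathcal I}$ is its matrix of second derivatives in all variables $(\lambda_{\mathcal I},\nu,y)$. Pseudo-inverse. For symmetric $M$, $M^\dagger:=U(U^\top MU)^{-1}U^\top$, where the columns of $U$ are (orthonormal) eigenvectors for all nonzero eigenvalues of $M$. In the block vectors/matrices, the $0$ blocks correspond to the $(\lambda_{\mathcal I},\nu)$ coordinates and the other block to $y$. *)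

theory Defs
  imports "HOL-Analysis.Analysis"
begin

section \<open>Gradients and second derivatives\<close>

definition grad :: "('a::euclidean_space \<Rightarrow> real) \<Rightarrow> 'a \<Rightarrow> 'a" where
  "grad F z = (\<Sum>b\<in>Basis. frechet_derivative F (at z) b *\<^sub>R b)"

text \<open>The second derivative as a linear operator; its matrix is the Hessian matrix.\<close>

definition hess :: "('a::euclidean_space \<Rightarrow> real) \<Rightarrow> 'a \<Rightarrow> 'a \<Rightarrow> 'a" where
  "hess F z = frechet_derivative (grad F) (at z)"

text \<open>On a set that need not be open, twice continuous differentiability refers to some open
  neighbourhood of the set, as usual.\<close>

definition C2_on :: "('a::euclidean_space \<Rightarrow> real) \<Rightarrow> 'a set \<Rightarrow> bool" where
  "C2_on F S \<longleftrightarrow> (\<exists>V. open V \<and> S \<subseteq> V \<and>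
     (\<forall>z\<in>V. F differentiable (at z)) \<and>
     (\<forall>z\<in>V. grad F differentiable (at z)) \<and>
     (\<forall>v. continuous_on V (\<lambda>z. hess F z v)))"

definition grad_x :: "((real^'nx) \<times> (real^'ny) \<Rightarrow> real) \<Rightarrow> real^'nx \<Rightarrow> real^'ny \<Rightarrow> real^'nx" where
  "grad_x F x y = grad (\<lambda>u. F (u, y)) x"

definition grad_y :: "((real^'nx) \<times> (real^'ny) \<Rightarrow> real) \<Rightarrow> real^'nx \<Rightarrow> real^'ny \<Rightarrow> real^'ny" where
  "grad_y F x y = grad (\<lambda>w. F (x, w)) y"

text \<open>The $d_x \times d_y$ matrix of the derivatives $\partial^2 F / \partial x_i \partial y_j$.\<close>

definition hess_xy :: "((real^'nx) \<times> (real^'ny) \<Rightarrow> real) \<Rightarrow> real^'nx \<Rightarrow> real^'ny \<Rightarrow> real^'ny^'nx" where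
  "hess_xy F x y = matrix (frechet_derivative (\<lambda>w. grad_x F x w) (at y))"

text \<open>The functions $l$, $\psi$, $\psi_\sigma$ live on the closed set $X$ only, so they are
  differentiated relative to $X$ (an ordinary derivative at interior points, cf. \<^const>\<open>gderiv\<close>).
  For convex $X$ the gradient is unique as soon as $X$ has nonempty
  interior; otherwise it is determined up to vectors orthogonal to the affine hull of $X$.\<close>

definition has_gradient_within ::
  "('a::euclidean_space \<Rightarrow> real) \<Rightarrow> 'a \<Rightarrow> 'a \<Rightarrow> 'a set \<Rightarrow> bool" where
  "has_gradient_within F v z S \<longleftrightarrow> (F has_derivative (\<lambda>d. d \<bullet> v)) (at z within S)"

section \<open>The parametric lower-level problem\<close>

definition h_pen :: "('a \<times> 'b \<Rightarrow> real) \<Rightarrow> ('a \<times> 'b \<Rightarrow> real) \<Rightarrow> real \<Rightarrow> 'a \<times> 'b \<Rightarrow> real" where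
  "h_pen f g \<sigma> z = \<sigma> * f z + g z"

definition T_sol :: "('a \<times> 'b \<Rightarrow> real) \<Rightarrow> ('a \<times> 'b \<Rightarrow> real) \<Rightarrow> 'b set \<Rightarrow> 'a \<Rightarrow> real \<Rightarrow> 'b set" where
  "T_sol f g Y x \<sigma> = {y. is_arg_min (\<lambda>y. h_pen f g \<sigma> (x, y)) (\<lambda>y. y \<in> Y) y}"

definition l_val :: "('a \<times> 'b \<Rightarrow> real) \<Rightarrow> ('a \<times> 'b \<Rightarrow> real) \<Rightarrow> 'b set \<Rightarrow> 'a \<Rightarrow> real \<Rightarrow> real" where
  "l_val f g Y x \<sigma> = (INF y\<in>Y. h_pen f g \<sigma> (x, y))"

definition psi :: "('a \<times> 'b \<Rightarrow> real) \<Rightarrow> ('a \<times> 'b \<Rightarrow> real) \<Rightarrow> 'b set \<Rightarrow> 'a \<Rightarrow> real" where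
  "psi f g Y x = (INF y\<in>T_sol f g Y x 0. f (x, y))"

definition psi_pen :: "('a \<times> 'b \<Rightarrow> real) \<Rightarrow> ('a \<times> 'b \<Rightarrow> real) \<Rightarrow> 'b set \<Rightarrow> real \<Rightarrow> 'a \<Rightarrow> real" where
  "psi_pen f g Y \<sigma> x = (l_val f g Y x \<sigma> - l_val f g Y x 0) / \<sigma>"

section \<open>Mixed second derivatives\<close>

text \<open>For a function of $x \in X$ and $\sigma \ge 0$. Derivatives in $\sigma$ are taken within
  $[0,\infty)$: two-sided for $\sigma > 0$ and from the right for $\sigma = 0$.\<close>

definition has_dsigma_dx ::
  "('a::euclidean_space \<Rightarrow> real \<Rightarrow> real) \<Rightarrow> 'a \<Rightarrow> 'a set \<Rightarrow> 'a \<Rightarrow> real \<Rightarrow> bool" where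
  "has_dsigma_dx L v X x \<sigma> \<longleftrightarrow> (\<exists>G \<epsilon>. \<epsilon> > 0 \<and>
     (\<forall>s\<ge>0. \<bar>s - \<sigma>\<bar> < \<epsilon> \<longrightarrow> has_gradient_within (\<lambda>u. L u s) (G s) x X) \<and>
     (G has_vector_derivative v) (at \<sigma> within {0..}))"

definition has_dx_dsigma ::
  "('a::euclidean_space \<Rightarrow> real \<Rightarrow> real) \<Rightarrow> 'a \<Rightarrow> 'a set \<Rightarrow> 'a \<Rightarrow> real \<Rightarrow> bool" where
  "has_dx_dsigma L v X x \<sigma> \<longleftrightarrow> (\<exists>D \<epsilon>. \<epsilon> > 0 \<and>
     (\<forall>u\<in>X \<inter> ball x \<epsilon>. ((\<lambda>s. L u s) has_real_derivative D u) (at \<sigma> within {0..})) \<and>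
     has_gradient_within D v x X)"

section \<open>Local Lipschitz continuity of set-valued maps\<close>

text \<open>Meaningful for nonempty bounded sets, which is the only case used.\<close>

definition hausdorff_distance :: "'a::metric_space set \<Rightarrow> 'a set \<Rightarrow> real" where
  "hausdorff_distance A B = max (SUP a\<in>A. infdist a B) (SUP b\<in>B. infdist b A)"

definition locally_lipschitz_at ::
  "('w::metric_space \<Rightarrow> 'a::metric_space set) \<Rightarrow> 'w set \<Rightarrow> 'w \<Rightarrow> bool" where
  "locally_lipschitz_at S W w \<longleftrightarrow>
     (\<exists>r>0. \<exists>K. \<forall>w'\<in>W \<inter> ball w r. hausdorff_distance (S w) (S w') \<le> K * dist w w')"

section \<open>Constraints\<close>

text \<open>Inequality constraints \<open>gc i\<close>, \<open>i \<in> P\<close>, and equality constraints \<open>hc j\<close>, \<open>j \<in> Q\<close>, where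
  \<open>P\<close> and \<open>Q\<close> are arbitrary (possibly empty) sets of indices from finite types.\<close>

definition active_set :: "'p set \<Rightarrow> ('p \<Rightarrow> 'b \<Rightarrow> real) \<Rightarrow> 'b \<Rightarrow> 'p set" where
  "active_set P gc y = {i\<in>P. gc i y = 0}"

definition LICQ :: "'p::finite set \<Rightarrow> ('p \<Rightarrow> 'b::euclidean_space \<Rightarrow> real) \<Rightarrow>
    'q::finite set \<Rightarrow> ('q \<Rightarrow> 'b \<Rightarrow> real) \<Rightarrow> 'b \<Rightarrow> bool" where
  "LICQ P gc Q hc y \<longleftrightarrow> (\<forall>a b.
     (\<Sum>i\<in>active_set P gc y. a i *\<^sub>R grad (gc i) y) + (\<Sum>j\<in>Q. b j *\<^sub>R grad (hc j) y) = 0 \<longrightarrow>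
     (\<forall>i\<in>active_set P gc y. a i = 0) \<and> (\<forall>j\<in>Q. b j = 0))"

text \<open>Multipliers are indexed by the full types; only their entries at the active indices, respectively
  at \<open>Q\<close>, play a role.\<close>

definition KKT_multipliers :: "((real^'nx) \<times> (real^'ny) \<Rightarrow> real) \<Rightarrow> 'p::finite set \<Rightarrow>
    ('p \<Rightarrow> real^'ny \<Rightarrow> real) \<Rightarrow> 'q::finite set \<Rightarrow> ('q \<Rightarrow> real^'ny \<Rightarrow> real) \<Rightarrow>
    real^'nx \<Rightarrow> real^'ny \<Rightarrow> real^'p \<Rightarrow> real^'q \<Rightarrow> bool" where
  "KKT_multipliers h P gc Q hc x y lam nu \<longleftrightarrow>
     (\<forall>i\<in>active_set P gc y. lam $ i \<ge> 0) \<and>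
     grad_y h x y + (\<Sum>i\<in>active_set P gc y. lam $ i *\<^sub>R grad (gc i) y)
       + (\<Sum>j\<in>Q. nu $ j *\<^sub>R grad (hc j) y) = 0"

definition strict_complementarity ::
  "'p::finite set \<Rightarrow> ('p \<Rightarrow> real^'ny \<Rightarrow> real) \<Rightarrow> real^'ny \<Rightarrow> real^'p \<Rightarrow> bool" where
  "strict_complementarity P gc y lam \<longleftrightarrow> (\<forall>i\<in>active_set P gc y. lam $ i > 0)"

section \<open>Lagrangian and block vectors\<close>

text \<open>The stacked vector $(\lambda,\nu,y)$.\<close>

definition stack :: "real^'p \<Rightarrow> real^'q \<Rightarrow> real^'n \<Rightarrow> real^('p + ('q + 'n))" where
  "stack lam nu y =
     (\<chi> k. case k of Inl i \<Rightarrow> lam $ i | Inr (Inl j) \<Rightarrow> nu $ j | Inr (Inr c) \<Rightarrow> y $ c)"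

definition y_part :: "real^('p::finite + ('q::finite + 'n::finite)) \<Rightarrow> real^'n" where
  "y_part z = (\<chi> c. z $ Inr (Inr c))"

text \<open>The Lagrangian as a function of $z = (\lambda,\nu,y)$. It does not depend on the entries of $z$
  at inequality indices outside \<open>I\<close> or equality indices outside \<open>Q\<close>, so its Hessian is the
  Hessian in $(\lambda_I,\nu_Q,y)$ bordered by zero rows and columns. The pseudo-inverse of a
  matrix bordered by zeros is the pseudo-inverse of that matrix bordered by zeros.\<close>

definition lagrangian :: "((real^'nx) \<times> (real^'ny) \<Rightarrow> real) \<Rightarrow> 'p::finite set \<Rightarrow>
    ('p \<Rightarrow> real^'ny \<Rightarrow> real) \<Rightarrow> 'q::finite set \<Rightarrow> ('q \<Rightarrow> real^'ny \<Rightarrow> real) \<Rightarrow>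
    real^'nx \<Rightarrow> real^('p + ('q + 'ny)) \<Rightarrow> real" where
  "lagrangian h I gc Q hc x z = h (x, y_part z)
     + (\<Sum>i\<in>I. z $ Inl i * gc i (y_part z)) + (\<Sum>j\<in>Q. z $ Inr (Inl j) * hc j (y_part z))"

definition hess_lagrangian :: "((real^'nx) \<times> (real^'ny) \<Rightarrow> real) \<Rightarrow> 'p::finite set \<Rightarrow>
    ('p \<Rightarrow> real^'ny \<Rightarrow> real) \<Rightarrow> 'q::finite set \<Rightarrow> ('q \<Rightarrow> real^'ny \<Rightarrow> real) \<Rightarrow>
    real^'nx \<Rightarrow> real^('p + ('q + 'ny)) \<Rightarrow> real^('p + ('q + 'ny))^('p + ('q + 'ny))" where
  "hess_lagrangian h I gc Q hc x z = matrix (hess (lagrangian h I gc Q hc x) z)"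

text \<open>The block row matrix $[0 \quad A]$.\<close>

definition zero_block_row :: "real^'ny^'nx \<Rightarrow> real^('p::finite + ('q::finite + 'ny))^'nx" where
  "zero_block_row A = (\<chi> a. stack 0 0 (A $ a))"

section \<open>Pseudo-inverse of a symmetric matrix\<close>

text \<open>$P = U (U^\top M U)^{-1} U^\top$, where $U$ has the $r$ columns \<open>u 0, \<dots>, u (r - 1)\<close>,
  which are orthonormal eigenvectors for nonzero eigenvalues and span all such eigenvectors,
  and where $B$ is the inverse of the $r \times r$ matrix $U^\top M U$.\<close>

definition is_pseudo_inverse :: "real^'n^'n \<Rightarrow> real^'n^'n \<Rightarrow> bool" where
  "is_pseudo_inverse M P \<longleftrightarrow> (\<exists>(r::nat) (u :: nat \<Rightarrow> real^'n) (B :: nat \<Rightarrow> nat \<Rightarrow> real).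
     (\<forall>j<r. \<forall>k<r. u j \<bullet> u k = (if j = k then 1 else 0)) \<and>
     (\<forall>j<r. \<exists>\<mu>. \<mu> \<noteq> 0 \<and> M *v u j = \<mu> *\<^sub>R u j) \<and>
     (\<forall>\<mu> v. \<mu> \<noteq> 0 \<and> M *v v = \<mu> *\<^sub>R v \<longrightarrow> v \<in> span (u ` {..<r})) \<and>
     (\<forall>j<r. \<forall>k<r. (\<Sum>i<r. (u j \<bullet> (M *v u i)) * B i k) = (if j = k then 1 else 0)) \<and>
     P = (\<chi> a b. \<Sum>j<r. \<Sum>k<r. u j $ a * B j k * u k $ b))"

text \<open>For symmetric \<open>M\<close> there is exactly one such \<open>P\<close>: it does not depend on the choice of \<open>u\<close>.\<close>

definition pseudo_inverse :: "real^'n^'n \<Rightarrow> real^'n^'n" where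
  "pseudo_inverse M = (THE P. is_pseudo_inverse M P)"

end

theory Submission
  imports Defs
begin

text \<open>
  Lipschitz continuity of the solution map lets every $y \in T(x,\sigma)$ be followed by solutions at
  nearby parameters at distance $O(\|w - w_0\|)$. This makes the value function jointly differentiable
  in $(x,\sigma)$, with $\partial_\sigma l = f(x,y)$ and $\nabla_x l = \nabla_x h_\sigma(x,y)$ for any
  choice of $y \in T(x,\sigma)$. Near $y^*$, LICQ and strict complementarity freeze the active set and
  carry the Lipschitz bound over to the multipliers, so that the stacked points $z(w)$ solve the KKT
  system $\nabla_z \mathcal L_{\mathcal I}(z(w) \mid w) = 0$ and linearising gives
  $M (z(w) - z^*) + N (w - w_0) = o(\|w - w_0\|)$ with $M = \nabla^2 \mathcal L_{\mathcal I}$ and $N$ the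
  derivative of the system in the parameters.
  Although $M$ may be singular, this forces $N d$ into the range of $M$ for every feasible direction
  $d$. Both mixed derivatives only involve functionals $c \cdot z(w)$ with $c$ in the range of $M$, and
  for those $M M^\dagger M = M$ turns the linearised system into
  $c \cdot (z(w) - z^*) = - c \cdot M^\dagger N (w - w_0) + o(\|w - w_0\|)$.
  The claim on $\psi$ holds because the right derivative of $l(u,\cdot)$ at $0$ is $\psi(u)$ and
  $\nabla \psi_\sigma$ is a difference quotient of $\nabla_x l$.
\<close>

section \<open>Self-adjoint operators and the pseudo-inverse\<close>

text \<open>No second-order condition is available, so \<open>T(x,\<sigma>)\<close> may be a
  continuum, \<open>M\<close> may be singular and the implicit function theorem is out of reach. The
  point followed at each parameter is an arbitrary choice, and its components along the kernel of
  \<open>M\<close> need not be differentiable. That the relevant vectors lie in the range of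
  \<open>M\<close> comes from the mere existence of the path: \<open>N d\<close> is a limit of
  \<open>M\<close> applied to difference quotients, and the range is closed. The direction
  \<open>(0, 1)\<close> yields the block vector of \<open>grad_y f\<close>, through which
  \<open>f\<close> depends on the path to first order; directions along segments of the convex set
  \<open>X\<close> yield the vectors through which the gradient of \<open>l\<close> in
  \<open>x\<close> does. So the forcing term of one mixed derivative is the functional of the other,
  and symmetry of the pseudo-inverse makes the two agree. A second obstacle is that gradients
  relative to \<open>X\<close> are fixed only modulo the orthogonal complement of the span of
  \<open>X - x\<close>, and only for \<open>d\<close> in that span is \<open>N (d, 0)\<close> known
  to lie in the range. Hence the gradient of \<open>l\<close> is differentiated in
  \<open>\<sigma>\<close> one component at a time, and its remaining part is prescribed.\<close>

lemma linear_term_zero: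
  fixes a c :: real
  assumes "\<And>t. 2 * t * a + t\<^sup>2 * c \<le> 0"
  shows "a = 0"
proof (rule ccontr)
  assume a: "a \<noteq> 0"
  \<comment> \<open>With this \<open>k\<close>, the choice \<open>t = a / k\<close> leaves at least
    \<open>2 a^2 / k - a^2 / k > 0\<close>, whatever the sign of \<open>c\<close>.\<close>
  define k where "k = \<bar>c\<bar> + 1"
  have k: "k > 0" "c \<ge> - k" unfolding k_def by auto
  have "2 * (a / k) * a + (a / k)\<^sup>2 * c \<le> 0" by (rule assms)
  moreover have "(a / k)\<^sup>2 * c \<ge> (a / k)\<^sup>2 * (- k)"
    using k by (intro mult_left_mono) auto
  moreover have "2 * (a / k) * a + (a / k)\<^sup>2 * (- k) = a\<^sup>2 / k"
    using k by (simp add: power2_eq_square field_simps)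
  moreover have "a\<^sup>2 / k > 0" using a k by simp
  ultimately show False by linarith
qed

text \<open>A maximiser of the Rayleigh quotient over the unit sphere of an invariant subspace is an
  eigenvector; compactness provides it.\<close>

lemma selfadjoint_eigenvector:
  fixes M :: "'a::euclidean_space \<Rightarrow> 'a"
  assumes M: "linear M" and sa: "\<And>x y. M x \<bullet> y = x \<bullet> M y"
    and S: "subspace S" and inv: "M ` S \<subseteq> S" and nz: "S \<noteq> {0}"
  obtains v \<mu> where "v \<in> S" "norm v = 1" "M v = \<mu> *\<^sub>R v"
proof -
  let ?C = "S \<inter> sphere 0 1"
  have comp: "compact ?C"
    using closed_Int_compact[OF closed_subspace[OF S] compact_sphere] .
  obtain s where s: "s \<in> S" "s \<noteq> 0" using nz subspace_0[OF S] by blast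
  have "(1 / norm s) *\<^sub>R s \<in> ?C" using s S by (auto simp: subspace_scale)
  then have ne: "?C \<noteq> {}" by blast
  have "continuous_on ?C (\<lambda>x. x \<bullet> M x)"
    by (intro continuous_intros linear_continuous_on) (use M in \<open>simp add: linear_conv_bounded_linear\<close>)
  from continuous_attains_sup[OF comp ne this]
  obtain v where v: "v \<in> ?C" and max: "\<And>x. x \<in> ?C \<Longrightarrow> x \<bullet> M x \<le> v \<bullet> M v" by blast
  define \<mu> where "\<mu> = v \<bullet> M v"
  have vS: "v \<in> S" and nv: "norm v = 1" using v by auto
  have vv: "v \<bullet> v = 1" using nv by (simp add: dot_square_norm)
  have bound: "x \<bullet> M x \<le> \<mu> * (x \<bullet> x)" if x: "x \<in> S" for x
  proof (cases "x = 0")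
    case True
    then show ?thesis by simp
  next
    case False
    have "(1 / norm x) *\<^sub>R x \<in> ?C" using x False S by (auto simp: subspace_scale)
    from max[OF this] have "(x \<bullet> M x) / (norm x)\<^sup>2 \<le> \<mu>"
      by (simp add: linear_scale[OF M] \<mu>_def power2_eq_square)
    then show ?thesis using False by (simp add: field_simps power2_norm_eq_inner)
  qed
  \<comment> \<open>The eigenvector defect serves as its own test direction: moving \<open>v\<close>
    by \<open>t w\<close> cannot beat the maximum, and the linear coefficient of that inequality in
    \<open>t\<close> is \<open>w \<bullet> w\<close>.\<close>
  define w where "w = M v - \<mu> *\<^sub>R v"
  have wS: "w \<in> S" unfolding w_def using vS inv S by (auto intro!: subspace_diff subspace_scale)
  have "2 * t * (w \<bullet> w) + t\<^sup>2 * (w \<bullet> M w - \<mu> * (w \<bullet> w)) \<le> 0" for t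
  proof -
    have "v + t *\<^sub>R w \<in> S" using vS wS S by (auto intro!: subspace_add subspace_scale)
    from bound[OF this]
    have "v \<bullet> M v + t * (v \<bullet> M w) + t * (w \<bullet> M v) + t\<^sup>2 * (w \<bullet> M w)
        \<le> \<mu> * (v \<bullet> v + 2 * t * (v \<bullet> w) + t\<^sup>2 * (w \<bullet> w))"
      by (simp add: linear_add[OF M] linear_scale[OF M] inner_add_left inner_add_right
          power2_eq_square algebra_simps inner_commute)
    moreover have "v \<bullet> M w = w \<bullet> M v" using sa[of v w] by (simp add: inner_commute)
    moreover have "w \<bullet> M v = w \<bullet> w + \<mu> * (v \<bullet> w)"
      unfolding w_def by (simp add: inner_diff_left inner_diff_right inner_commute algebra_simps)
    ultimately show ?thesis using vv by (simp add: \<mu>_def[symmetric] algebra_simps)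
  qed
  then have "w \<bullet> w = 0" by (rule linear_term_zero)
  then have "M v = \<mu> *\<^sub>R v" unfolding w_def by simp
  with vS nv show ?thesis by (rule that)
qed

text \<open>Induction on the dimension: inside \<open>S\<close> the orthogonal complement of an
  eigenvector is again invariant, because \<open>M\<close> is self-adjoint. The version for a
  subspace \<open>S\<close> is what allows diagonalising on the range of \<open>M\<close>
  alone.\<close>

lemma selfadjoint_orthonormal_eigenbasis:
  fixes M :: "'a::euclidean_space \<Rightarrow> 'a"
  assumes M: "linear M" and sa: "\<And>x y. M x \<bullet> y = x \<bullet> M y"
    and S: "subspace S" and inv: "M ` S \<subseteq> S"
  shows "\<exists>B. finite B \<and> pairwise orthogonal B \<and> (\<forall>v\<in>B. norm v = 1) \<and>
    (\<forall>v\<in>B. \<exists>\<mu>. M v = \<mu> *\<^sub>R v) \<and> span B = S"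
  using S inv
proof (induction "dim S" arbitrary: S rule: less_induct)
  case less
  show ?case
  proof (cases "S = {0}")
    case True
    then show ?thesis by (intro exI[of _ "{}"]) auto
  next
    case False
    from selfadjoint_eigenvector[OF M sa less.prems False]
    obtain v \<mu> where v: "v \<in> S" "norm v = 1" "M v = \<mu> *\<^sub>R v" by metis
    have vv: "v \<bullet> v = 1" using v by (simp add: dot_square_norm)
    define S' where "S' = {x\<in>S. v \<bullet> x = 0}"
    have S': "subspace S'" using less.prems(1)
      unfolding S'_def subspace_def by (auto simp: inner_add_right)
    have "v \<notin> S'" unfolding S'_def using vv by simp
    then have "S' \<subset> S" using v(1) unfolding S'_def by blast
    then have "dim S' < dim S"
      by (intro dim_psubset) (simp add: span_eq_iff[THEN iffD2] S' less.prems(1))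
    moreover have "M ` S' \<subseteq> S'"
    proof
      fix y assume "y \<in> M ` S'"
      then obtain x where x: "x \<in> S" "v \<bullet> x = 0" "y = M x" unfolding S'_def by auto
      have "v \<bullet> M x = M v \<bullet> x" by (simp add: sa)
      also have "\<dots> = 0" using x v by simp
      finally show "y \<in> S'" using x less.prems(2) unfolding S'_def by auto
    qed
    ultimately obtain B where B: "finite B" "pairwise orthogonal B" "\<forall>v\<in>B. norm v = 1"
      "\<forall>v\<in>B. \<exists>\<mu>. M v = \<mu> *\<^sub>R v" "span B = S'"
      using less.hyps[of S'] S' by blast
    have BS': "B \<subseteq> S'" using B(5) span_superset by blast
    have "span (insert v B) = S"
    proof
      have "insert v B \<subseteq> S" using BS' v unfolding S'_def by auto
      then show "span (insert v B) \<subseteq> S" using less.prems(1) by (rule span_minimal)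
      show "S \<subseteq> span (insert v B)"
      proof
        fix x assume x: "x \<in> S"
        have "x - (v \<bullet> x) *\<^sub>R v \<in> S'" unfolding S'_def
          using x v vv less.prems(1)
          by (auto simp: inner_diff_right intro!: subspace_diff subspace_scale)
        then have "x - (v \<bullet> x) *\<^sub>R v \<in> span B" using B(5) by simp
        then show "x \<in> span (insert v B)" by (auto simp: span_breakdown_eq)
      qed
    qed
    moreover have "pairwise orthogonal (insert v B)"
      using B(2) BS' unfolding pairwise_insert S'_def
      by (auto simp: orthogonal_def inner_commute)
    ultimately show ?thesis using B v by (intro exI[of _ "insert v B"]) auto
  qed
qed

text \<open>In an orthonormal eigenbasis the inner matrix is diagonal, so its inverse
  \<open>B\<close> is forced to carry the reciprocals \<open>1 / \<mu> j\<close>. This trades the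
  matrix formula for a spectral sum.\<close>

lemma is_pseudo_inverse_expansion:
  fixes M P :: "real^'n^'n"
  assumes "is_pseudo_inverse M P"
  shows "\<exists>(r::nat) u \<mu>. (\<forall>j k. j < r \<longrightarrow> k < r \<longrightarrow> u j \<bullet> u k = (if j = k then 1 else 0)) \<and>
    (\<forall>j. j < r \<longrightarrow> \<mu> j \<noteq> 0) \<and> (\<forall>j. j < r \<longrightarrow> M *v u j = \<mu> j *\<^sub>R u j) \<and>
    (\<forall>m v. m \<noteq> 0 \<longrightarrow> M *v v = m *\<^sub>R v \<longrightarrow> v \<in> span (u ` {..<r})) \<and>
    (\<forall>z. P *v z = (\<Sum>j<r. ((u j \<bullet> z) / \<mu> j) *\<^sub>R u j))"
proof -
  from assms obtain r :: nat and u :: "nat \<Rightarrow> real^'n" and B :: "nat \<Rightarrow> nat \<Rightarrow> real" where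
    on: "\<And>j k. j < r \<Longrightarrow> k < r \<Longrightarrow> u j \<bullet> u k = (if j = k then 1 else 0)"
    and ev: "\<forall>j<r. \<exists>\<mu>. \<mu> \<noteq> 0 \<and> M *v u j = \<mu> *\<^sub>R u j"
    and sp: "\<And>\<mu> v. \<mu> \<noteq> 0 \<Longrightarrow> M *v v = \<mu> *\<^sub>R v \<Longrightarrow> v \<in> span (u ` {..<r})"
    and B: "\<And>j k. j < r \<Longrightarrow> k < r \<Longrightarrow>
      (\<Sum>i<r. (u j \<bullet> (M *v u i)) * B i k) = (if j = k then 1 else 0)"
    and P: "P = (\<chi> a b. \<Sum>j<r. \<Sum>k<r. u j $ a * B j k * u k $ b)"
    unfolding is_pseudo_inverse_def by blast
  from ev obtain \<mu> where \<mu>: "\<And>j. j < r \<Longrightarrow> \<mu> j \<noteq> 0" "\<And>j. j < r \<Longrightarrow> M *v u j = \<mu> j *\<^sub>R u j"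
    by metis
  have Bjk: "B j k = (if j = k then 1 / \<mu> j else 0)" if jk: "j < r" "k < r" for j k
  proof -
    have "(\<Sum>i<r. (u j \<bullet> (M *v u i)) * B i k) = (\<Sum>i<r. if i = j then \<mu> j * B j k else 0)"
      by (intro sum.cong) (auto simp: \<mu> on jk)
    also have "\<dots> = \<mu> j * B j k" using jk by (simp add: sum.delta)
    finally have "\<mu> j * B j k = (if j = k then 1 else 0)" using B[OF jk] by simp
    then show ?thesis using \<mu>(1)[OF jk(1)] by (auto simp: field_simps split: if_splits)
  qed
  have Pz: "P *v z = (\<Sum>j<r. ((u j \<bullet> z) / \<mu> j) *\<^sub>R u j)" for z
  proof (rule vec_eq_iff[THEN iffD2], rule allI)
    fix a
    have "(P *v z) $ a = (\<Sum>b\<in>UNIV. \<Sum>j<r. \<Sum>k<r. u j $ a * B j k * u k $ b * z $ b)"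
      by (simp add: P matrix_vector_mult_def sum_distrib_right)
    also have "\<dots> = (\<Sum>b\<in>UNIV. \<Sum>j<r. \<Sum>k<r. if k = j then u j $ a * (1 / \<mu> j) * u j $ b * z $ b else 0)"
      by (intro sum.cong refl) (auto simp: Bjk)
    also have "\<dots> = (\<Sum>b\<in>UNIV. \<Sum>j<r. u j $ a * (1 / \<mu> j) * u j $ b * z $ b)"
      by (intro sum.cong refl) (auto simp: sum.delta)
    also have "\<dots> = (\<Sum>j<r. \<Sum>b\<in>UNIV. u j $ a * (1 / \<mu> j) * u j $ b * z $ b)"
      by (rule sum.swap)
    also have "\<dots> = (\<Sum>j<r. ((u j \<bullet> z) / \<mu> j) *\<^sub>R u j) $ a"
      by (simp add: inner_vec_def sum_distrib_left sum_distrib_right sum_divide_distrib mult_ac)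
    finally show "(P *v z) $ a = (\<Sum>j<r. ((u j \<bullet> z) / \<mu> j) *\<^sub>R u j) $ a" .
  qed
  show ?thesis using on \<mu> sp Pz by blast
qed

text \<open>Any pseudo-inverse divides each eigenvector for a nonzero eigenvalue by that eigenvalue
  and annihilates everything orthogonal to these eigenvectors, and this does not mention the chosen
  basis.\<close>

lemma is_pseudo_inverse_unique:
  fixes M P P' :: "real^'n^'n"
  assumes P: "is_pseudo_inverse M P" and P': "is_pseudo_inverse M P'"
  shows "P = P'"
proof -
  from is_pseudo_inverse_expansion[OF P] obtain r :: nat and u \<mu> where
    *: "\<forall>j k. j < r \<longrightarrow> k < r \<longrightarrow> u j \<bullet> u k = (if j = k then 1 else 0)"
    "\<forall>j. j < r \<longrightarrow> \<mu> j \<noteq> 0" "\<forall>j. j < r \<longrightarrow> M *v u j = \<mu> j *\<^sub>R u j"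
    "\<forall>m v. m \<noteq> 0 \<longrightarrow> M *v v = m *\<^sub>R v \<longrightarrow> v \<in> span (u ` {..<r})"
    and Pz: "\<And>z. P *v z = (\<Sum>j<r. ((u j \<bullet> z) / \<mu> j) *\<^sub>R u j)" by blast
  note on = *(1)[rule_format] and \<mu> = *(2,3)[rule_format] and sp = *(4)[rule_format]
  from is_pseudo_inverse_expansion[OF P'] obtain r' :: nat and u' \<mu>' where
    *: "\<forall>j k. j < r' \<longrightarrow> k < r' \<longrightarrow> u' j \<bullet> u' k = (if j = k then 1 else 0)"
    "\<forall>j. j < r' \<longrightarrow> \<mu>' j \<noteq> 0" "\<forall>j. j < r' \<longrightarrow> M *v u' j = \<mu>' j *\<^sub>R u' j"
    "\<forall>m v. m \<noteq> 0 \<longrightarrow> M *v v = m *\<^sub>R v \<longrightarrow> v \<in> span (u' ` {..<r'})"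
    and Pz': "\<And>z. P' *v z = (\<Sum>j<r'. ((u' j \<bullet> z) / \<mu>' j) *\<^sub>R u' j)" by blast
  note on' = *(1)[rule_format] and \<mu>' = *(2,3)[rule_format] and sp' = *(4)[rule_format]
  \<comment> \<open>Applied below to the vectors \<open>u k\<close>, which lie in this span because
    the primed family also spans all eigenvectors for nonzero eigenvalues.\<close>
  have P'M: "P' *v (M *v c) = c" if "c \<in> span (u' ` {..<r'})" for c
    using that
  proof (induction rule: span_induct_alt)
    case base
    then show ?case by simp
  next
    case (step a x y)
    then obtain k where k: "k < r'" "x = u' k" by auto
    have "P' *v (M *v x) = (\<Sum>j<r'. if j = k then u' k else 0)"
      unfolding Pz' by (intro sum.cong refl) (auto simp: k \<mu>' on')
    also have "\<dots> = x" using k by (simp add: sum.delta)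
    finally show ?case using step
      by (simp add: matrix_vector_right_distrib scalar_mult_eq_scaleR[symmetric]
          vector_scalar_commute)
  qed
  have eq: "P *v p = P' *v p" if "p \<in> span (u ` {..<r})" for p
    using that
  proof (induction rule: span_induct_alt)
    case base
    then show ?case by simp
  next
    case (step a x y)
    then obtain k where k: "k < r" "x = u k" by auto
    have "P *v x = (\<Sum>j<r. if j = k then (1 / \<mu> k) *\<^sub>R u k else 0)"
      unfolding Pz by (intro sum.cong refl) (auto simp: k on)
    also have "\<dots> = (1 / \<mu> k) *\<^sub>R x" using k by (simp add: sum.delta)
    finally have 1: "P *v x = (1 / \<mu> k) *\<^sub>R x" .
    have "P' *v (M *v x) = x"
      by (rule P'M) (use sp'[OF \<mu>(1) \<mu>(2)] k in auto)
    then have "\<mu> k *\<^sub>R (P' *v x) = x" using \<mu>(2)[OF k(1)] k(2)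
      by (simp add: scalar_mult_eq_scaleR[symmetric] vector_scalar_commute)
    then have "(1 / \<mu> k) *\<^sub>R (\<mu> k *\<^sub>R (P' *v x)) = (1 / \<mu> k) *\<^sub>R x" by simp
    then have "P' *v x = (1 / \<mu> k) *\<^sub>R x" using \<mu>(1)[OF k(1)] by simp
    with 1 step show ?case
      by (simp add: matrix_vector_right_distrib scalar_mult_eq_scaleR[symmetric]
          vector_scalar_commute)
  qed
  have "P *v z = P' *v z" for z
  proof -
    obtain p q where p: "p \<in> span (u ` {..<r})"
      and q: "\<And>w. w \<in> span (u ` {..<r}) \<Longrightarrow> orthogonal q w" and z: "z = p + q"
      using orthogonal_subspace_decomp_exists by blast
    have "u j \<bullet> q = 0" if "j < r" for j
      using q[OF span_base, of "u j"] that by (auto simp: orthogonal_def inner_commute)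
    then have 1: "P *v q = 0" unfolding Pz by (intro sum.neutral) auto
    \<comment> \<open>\<open>u' j\<close> is itself an eigenvector for a nonzero eigenvalue, hence
      in the span of the \<open>u j\<close>, to which \<open>q\<close> is orthogonal.\<close>
    have "u' j \<bullet> q = 0" if "j < r'" for j
      using q[OF sp[OF \<mu>'[OF that]]] by (auto simp: orthogonal_def inner_commute)
    then have 2: "P' *v q = 0" unfolding Pz' by (intro sum.neutral) auto
    show ?thesis using eq[OF p] 1 2 by (simp add: z matrix_vector_right_distrib)
  qed
  then show ?thesis by (simp add: matrix_eq)
qed

text \<open>Diagonalising on the range of \<open>M\<close> selects exactly the nonzero eigenvalues.
  On that range \<open>P\<close> inverts \<open>M\<close>, which is the second claim.\<close>

lemma is_pseudo_inverse_exists: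
  fixes M :: "real^'n^'n"
  assumes sa: "\<And>x y. (M *v x) \<bullet> y = x \<bullet> (M *v y)"
  shows "\<exists>P. is_pseudo_inverse M P \<and> (\<forall>x. M *v (P *v (M *v x)) = M *v x)"
proof -
  let ?M = "(*v) M"
  have lin: "linear ?M" by simp
  have S: "subspace (range ?M)" using lin by (intro linear_subspace_image) auto
  from selfadjoint_orthonormal_eigenbasis[OF lin sa S]
  obtain B where B: "finite B" "pairwise orthogonal B" "\<forall>v\<in>B. norm v = 1"
      "\<forall>v\<in>B. \<exists>\<mu>. M *v v = \<mu> *\<^sub>R v" "span B = range ?M" by auto
  from ex_bij_betw_nat_finite[OF B(1)] obtain u where u: "bij_betw u {..<card B} B"
    by (auto simp: atLeast0LessThan)
  define r where "r = card B"
  have uB: "u j \<in> B" if "j < r" for j using u that by (auto simp: bij_betw_def r_def)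
  have uim: "u ` {..<r} = B" using u by (auto simp: bij_betw_def r_def)
  have on: "u j \<bullet> u k = (if j = k then 1 else 0)" if jk: "j < r" "k < r" for j k
  proof (cases "j = k")
    case True
    then show ?thesis using uB[OF jk(1)] B(3) by (simp add: dot_square_norm)
  next
    case False
    then have "u j \<noteq> u k" using u jk unfolding bij_betw_def inj_on_def r_def by auto
    then show ?thesis using uB jk B(2) False unfolding pairwise_def orthogonal_def by auto
  qed
  from B(4) uB have "\<forall>j. j < r \<longrightarrow> (\<exists>\<mu>. M *v u j = \<mu> *\<^sub>R u j)" by blast
  then obtain \<mu> where \<mu>: "\<And>j. j < r \<Longrightarrow> M *v u j = \<mu> j *\<^sub>R u j" by metis
  \<comment> \<open>An eigenvector for 0 that lies in the range would be orthogonal to itself, since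
    \<open>M\<close> is self-adjoint.\<close>
  have \<mu>0: "\<mu> j \<noteq> 0" if j: "j < r" for j
  proof
    assume 0: "\<mu> j = 0"
    have "u j \<in> range ?M" using uB[OF j] B(5) span_base by metis
    then obtain x where x: "u j = M *v x" by auto
    have "u j \<bullet> u j = (M *v x) \<bullet> u j" using x by simp
    also have "\<dots> = x \<bullet> (M *v u j)" by (rule sa)
    also have "\<dots> = 0" using \<mu>[OF j] 0 by simp
    finally show False using on[OF j j] by simp
  qed
  define C where "C i k = (if i = k then 1 / \<mu> i else (0::real))" for i k :: nat
  define P :: "real^'n^'n" where "P = (\<chi> a b. \<Sum>j<r. \<Sum>k<r. u j $ a * C j k * u k $ b)"
  have "(\<Sum>i<r. (u j \<bullet> (M *v u i)) * C i k) = (if j = k then 1 else 0)" if jk: "j < r" "k < r" for j k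
  proof -
    have "(\<Sum>i<r. (u j \<bullet> (M *v u i)) * C i k) = (\<Sum>i<r. if i = j then \<mu> j * C j k else 0)"
      by (intro sum.cong) (auto simp: \<mu> on jk)
    also have "\<dots> = \<mu> j * C j k" using jk by (simp add: sum.delta)
    finally show ?thesis using \<mu>0[OF jk(1)] \<mu>0[OF jk(2)] by (simp add: C_def)
  qed
  moreover have "v \<in> span (u ` {..<r})" if "m \<noteq> 0 \<and> M *v v = m *\<^sub>R v" for m v
  proof -
    have "v = M *v ((1 / m) *\<^sub>R v)"
      using that by (simp add: scalar_mult_eq_scaleR[symmetric] vector_scalar_commute)
    then show ?thesis unfolding uim B(5) by blast
  qed
  moreover have "\<forall>j<r. \<exists>\<mu>. \<mu> \<noteq> 0 \<and> M *v u j = \<mu> *\<^sub>R u j" using \<mu> \<mu>0 by blast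
  ultimately have isP: "is_pseudo_inverse M P"
    unfolding is_pseudo_inverse_def P_def using on
    by (intro exI[of _ r] exI[of _ u] exI[of _ C] conjI allI impI) auto
  have "M *v (P *v c) = c" if "c \<in> span B" for c
    using that
  proof (induction rule: span_induct_alt)
    case base
    then show ?case by simp
  next
    case (step a x y)
    then obtain k where k: "k < r" "x = u k" unfolding uim[symmetric] by auto
    have "P *v x = (1 / \<mu> k) *\<^sub>R x"
    proof (rule vec_eq_iff[THEN iffD2], rule allI)
      fix a
      have "(P *v x) $ a = (\<Sum>b\<in>UNIV. \<Sum>j<r. \<Sum>i<r. u j $ a * C j i * (u i $ b * x $ b))"
        by (simp add: P_def matrix_vector_mult_def sum_distrib_right mult.assoc)
      also have "\<dots> = (\<Sum>j<r. \<Sum>i<r. \<Sum>b\<in>UNIV. u j $ a * C j i * (u i $ b * x $ b))"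
        by (subst sum.swap, intro sum.cong refl, rule sum.swap)
      also have "\<dots> = (\<Sum>j<r. \<Sum>i<r. u j $ a * C j i * (u i \<bullet> x))"
        by (simp add: inner_vec_def sum_distrib_left)
      also have "\<dots> = (\<Sum>j<r. \<Sum>i<r. if i = k then (if j = k then u k $ a / \<mu> k else 0) else 0)"
        by (intro sum.cong refl) (auto simp: k on C_def)
      also have "\<dots> = ((1 / \<mu> k) *\<^sub>R x) $ a" using k by (simp add: sum.delta)
      finally show "(P *v x) $ a = ((1 / \<mu> k) *\<^sub>R x) $ a" .
    qed
    then have "M *v (P *v x) = x" using \<mu>[OF k(1)] \<mu>0[OF k(1)] k(2)
      by (simp add: scalar_mult_eq_scaleR[symmetric] vector_scalar_commute)
    with step show ?case
      by (simp add: matrix_vector_right_distrib scalar_mult_eq_scaleR[symmetric]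
          vector_scalar_commute)
  qed
  then show ?thesis using isP B(5) by blast
qed

text \<open>The two properties that enter the sensitivity argument: the first solves the linearised
  system for functionals in the range of \<open>M\<close>, the second makes the two mixed
  derivatives coincide.\<close>

lemma pseudo_inverse_selfadjoint:
  fixes M :: "real^'n^'n"
  assumes sa: "\<And>x y. (M *v x) \<bullet> y = x \<bullet> (M *v y)"
  shows "M *v (pseudo_inverse M *v (M *v x)) = M *v x"
    and "(pseudo_inverse M *v x) \<bullet> y = x \<bullet> (pseudo_inverse M *v y)"
proof -
  from is_pseudo_inverse_exists[OF sa] obtain P where
    P: "is_pseudo_inverse M P" "\<And>x. M *v (P *v (M *v x)) = M *v x" by blast
  have eq: "pseudo_inverse M = P" unfolding pseudo_inverse_def
    using P(1) is_pseudo_inverse_unique by blast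
  show "M *v (pseudo_inverse M *v (M *v x)) = M *v x" using P eq by simp
  from is_pseudo_inverse_expansion[OF P(1)] obtain r :: nat and u \<mu> where
    Pz: "\<And>z. P *v z = (\<Sum>j<r. ((u j \<bullet> z) / \<mu> j) *\<^sub>R u j)" by blast
  show "(pseudo_inverse M *v x) \<bullet> y = x \<bullet> (pseudo_inverse M *v y)"
    unfolding eq Pz by (simp add: inner_sum_left inner_sum_right inner_commute mult.commute)
qed

section \<open>Gradients and Hessians\<close>

lemma has_derivative_grad:
  assumes "F differentiable (at z)"
  shows "(F has_derivative (\<lambda>d. d \<bullet> grad F z)) (at z)"
proof -
  let ?D = "frechet_derivative F (at z)"
  have D: "(F has_derivative ?D) (at z)" using assms frechet_derivative_works by blast
  have "?D d = d \<bullet> grad F z" for d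
  proof -
    have "?D d = ?D (\<Sum>b\<in>Basis. (d \<bullet> b) *\<^sub>R b)" by (simp add: euclidean_representation)
    also have "\<dots> = (\<Sum>b\<in>Basis. (d \<bullet> b) * ?D b)"
      using has_derivative_linear[OF D] by (simp add: linear_sum linear_scale)
    also have "\<dots> = d \<bullet> grad F z"
      by (simp add: grad_def inner_sum_right mult.commute)
    finally show ?thesis .
  qed
  then show ?thesis using D by (metis (no_types, lifting) ext)
qed

lemma grad_eqI:
  assumes "(F has_derivative (\<lambda>d. d \<bullet> v)) (at z)"
  shows "grad F z = v"
proof -
  have "frechet_derivative F (at z) = (\<lambda>d. d \<bullet> v)"
    using frechet_derivative_at[OF assms] by simp
  then have "grad F z = (\<Sum>b\<in>Basis. (v \<bullet> b) *\<^sub>R b)"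
    by (simp add: grad_def inner_commute)
  then show ?thesis by (simp add: euclidean_representation)
qed

lemma has_derivative_hess:
  assumes "grad F differentiable (at z)"
  shows "(grad F has_derivative hess F z) (at z)"
  using assms unfolding hess_def frechet_derivative_works .

text \<open>The mean value theorem along \<open>d\<close> turns the second difference into a
  difference of two gradients. Both are compared with the linear approximation at \<open>z\<close>,
  and only the increment \<open>t H e\<close> survives.\<close>

lemma second_difference_bound:
  fixes F :: "'a::euclidean_space \<Rightarrow> real"
  assumes dF: "\<And>w. dist w z < \<delta> \<Longrightarrow> F differentiable (at w)"
    and H: "linear H"
    and approx: "\<And>w. dist w z < \<delta> \<Longrightarrow> norm (grad F w - grad F z - H (w - z)) \<le> \<epsilon> * norm (w - z)"
    and t: "t > 0" and tN: "t * N < \<delta>" and N: "norm d + norm e \<le> N" and \<epsilon>: "\<epsilon> \<ge> 0"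
  shows "\<bar>F (z + t *\<^sub>R d + t *\<^sub>R e) - F (z + t *\<^sub>R d) - F (z + t *\<^sub>R e) + F z - t\<^sup>2 * (d \<bullet> H e)\<bar>
    \<le> 2 * t\<^sup>2 * \<epsilon> * N\<^sup>2"
proof -
  \<comment> \<open>The increment in direction \<open>t e\<close>, viewed as a function of the
    displacement along \<open>d\<close>; the second difference is \<open>p t - p 0\<close>.\<close>
  define p where "p s = F (z + s *\<^sub>R d + t *\<^sub>R e) - F (z + s *\<^sub>R d)" for s
  have le1: "norm (s *\<^sub>R d + t *\<^sub>R e) \<le> t * N" "norm (s *\<^sub>R d) \<le> t * N" if s: "0 \<le> s" "s \<le> t" for s
  proof -
    have 1: "s * norm d \<le> t * norm d" using s by (intro mult_right_mono) auto
    have 2: "t * (norm d + norm e) \<le> t * N" using N t by (intro mult_left_mono) auto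
    have 3: "0 \<le> t * norm e" using t by simp
    have "norm (s *\<^sub>R d + t *\<^sub>R e) \<le> s * norm d + t * norm e"
      using norm_triangle_ineq[of "s *\<^sub>R d" "t *\<^sub>R e"] s t by simp
    then show "norm (s *\<^sub>R d + t *\<^sub>R e) \<le> t * N" using 1 2 by (simp add: distrib_left)
    have "norm (s *\<^sub>R d) = s * norm d" using s by (simp only: norm_scaleR abs_of_nonneg)
    then show "norm (s *\<^sub>R d) \<le> t * N" using 1 2 3 unfolding distrib_left by linarith
  qed
  have close: "dist (z + s *\<^sub>R d + t *\<^sub>R e) z < \<delta>" "dist (z + s *\<^sub>R d) z < \<delta>" if "0 \<le> s" "s \<le> t" for s
    using le1[OF that] tN by (auto simp: dist_norm add.assoc)
  define p' where "p' s = d \<bullet> grad F (z + s *\<^sub>R d + t *\<^sub>R e) - d \<bullet> grad F (z + s *\<^sub>R d)" for s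
  have der: "(p has_real_derivative p' s) (at s)" if s: "0 \<le> s" "s \<le> t" for s
  proof -
    have "((\<lambda>s. F (z + s *\<^sub>R d + t *\<^sub>R e)) has_derivative
        (\<lambda>h. (h *\<^sub>R d) \<bullet> grad F (z + s *\<^sub>R d + t *\<^sub>R e))) (at s)"
      by (rule has_derivative_compose[where g = F and f = "\<lambda>s. z + s *\<^sub>R d + t *\<^sub>R e",
          OF _ has_derivative_grad[OF dF[OF close(1)[OF s]]]])
        (auto intro!: derivative_eq_intros)
    moreover have "((\<lambda>s. F (z + s *\<^sub>R d)) has_derivative
        (\<lambda>h. (h *\<^sub>R d) \<bullet> grad F (z + s *\<^sub>R d))) (at s)"
      by (rule has_derivative_compose[where g = F and f = "\<lambda>s. z + s *\<^sub>R d",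
          OF _ has_derivative_grad[OF dF[OF close(2)[OF s]]]])
        (auto intro!: derivative_eq_intros)
    ultimately have "(p has_derivative (\<lambda>h. (h *\<^sub>R d) \<bullet> grad F (z + s *\<^sub>R d + t *\<^sub>R e) -
        (h *\<^sub>R d) \<bullet> grad F (z + s *\<^sub>R d))) (at s)"
      unfolding p_def by (rule has_derivative_diff)
    then show ?thesis unfolding has_field_derivative_def p'_def
      by (rule has_derivative_eq_rhs) (auto simp: fun_eq_iff algebra_simps)
  qed
  from MVT2[of 0 t p p'] t der obtain \<xi> where \<xi>: "0 < \<xi>" "\<xi> < t" "p t - p 0 = t * p' \<xi>"
    by (metis diff_zero)
  let ?a = "\<xi> *\<^sub>R d + t *\<^sub>R e" and ?b = "\<xi> *\<^sub>R d"
  have i: "0 \<le> \<xi>" "\<xi> \<le> t" using \<xi> by auto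
  \<comment> \<open>Both remainders are taken about \<open>z\<close>, the point where the gradient
    is approximated linearly; in \<open>r1 - r2\<close> the common term \<open>\<xi> H d\<close>
    cancels.\<close>
  define r1 where "r1 = grad F (z + \<xi> *\<^sub>R d + t *\<^sub>R e) - grad F z - H ?a"
  define r2 where "r2 = grad F (z + \<xi> *\<^sub>R d) - grad F z - H ?b"
  have "norm r1 \<le> \<epsilon> * norm ?a"
    using approx[OF close(1)[OF i]] unfolding r1_def by (simp add: add.assoc)
  also have "\<dots> \<le> \<epsilon> * (t * N)" using le1(1)[OF i] \<epsilon> by (intro mult_left_mono)
  finally have r1: "norm r1 \<le> \<epsilon> * (t * N)" .
  have "norm r2 \<le> \<epsilon> * norm ?b" using approx[OF close(2)[OF i]] unfolding r2_def by simp
  also have "\<dots> \<le> \<epsilon> * (t * N)" using le1(2)[OF i] \<epsilon> by (intro mult_left_mono)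
  finally have r2: "norm r2 \<le> \<epsilon> * (t * N)" .
  have "p' \<xi> = d \<bullet> (t *\<^sub>R H e + (r1 - r2))"
    unfolding p'_def r1_def r2_def
    by (simp add: linear_add[OF H] linear_scale[OF H] inner_add_right inner_diff_right)
  then have "p' \<xi> - t * (d \<bullet> H e) = d \<bullet> (r1 - r2)" by (simp add: inner_add_right)
  then have "\<bar>p' \<xi> - t * (d \<bullet> H e)\<bar> \<le> norm d * norm (r1 - r2)"
    using Cauchy_Schwarz_ineq2[of d "r1 - r2"] by simp
  also have "\<dots> \<le> N * (2 * (\<epsilon> * (t * N)))"
  proof (rule mult_mono)
    show "norm d \<le> N" using N norm_ge_zero[of e] by linarith
    then show "0 \<le> N" using norm_ge_zero[of d] by linarith
    show "norm (r1 - r2) \<le> 2 * (\<epsilon> * (t * N))"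
      using norm_triangle_ineq4[of r1 r2] r1 r2 by linarith
  qed simp
  finally have "t * \<bar>p' \<xi> - t * (d \<bullet> H e)\<bar> \<le> t * (N * (2 * (\<epsilon> * (t * N))))"
    using t by (intro mult_left_mono) auto
  moreover have "t * \<bar>p' \<xi> - t * (d \<bullet> H e)\<bar> = \<bar>t * p' \<xi> - t\<^sup>2 * (d \<bullet> H e)\<bar>"
    using t by (simp add: abs_mult_pos' right_diff_distrib power2_eq_square mult.assoc)
  moreover have "t * p' \<xi> =
      F (z + t *\<^sub>R d + t *\<^sub>R e) - F (z + t *\<^sub>R d) - F (z + t *\<^sub>R e) + F z"
    using \<xi>(3) unfolding p_def by simp
  ultimately show ?thesis by (simp add: power2_eq_square mult_ac)
qed

text \<open>The second difference is symmetric in \<open>d\<close> and \<open>e\<close>, while after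
  division by \<open>t^2\<close> it approximates both \<open>d \<bullet> H e\<close> and
  \<open>e \<bullet> H d\<close>.\<close>

lemma hess_selfadjoint:
  fixes F :: "'a::euclidean_space \<Rightarrow> real"
  assumes dF: "\<forall>\<^sub>F w in nhds z. F differentiable (at w)"
    and dg: "grad F differentiable (at z)"
  shows "hess F z d \<bullet> e = d \<bullet> hess F z e"
proof -
  let ?H = "hess F z"
  have H: "linear ?H" using has_derivative_hess[OF dg] has_derivative_linear by blast
  \<comment> \<open>The summand 1 keeps \<open>N\<close> positive when both directions vanish, since
    \<open>N\<close> is divided by below.\<close>
  define N where "N = norm d + norm e + 1"
  have N: "N > 0" "norm d + norm e \<le> N" unfolding N_def
    by (auto intro: add_nonneg_pos)
  obtain \<delta>0 where \<delta>0: "\<delta>0 > 0" "\<And>w. dist w z < \<delta>0 \<Longrightarrow> F differentiable (at w)"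
    using dF unfolding eventually_nhds_metric by blast
  have "\<bar>d \<bullet> ?H e - e \<bullet> ?H d\<bar> \<le> 0 + \<eta>" if \<eta>: "\<eta> > 0" for \<eta>
  proof -
    \<comment> \<open>The two second-difference errors of \<open>2 t^2 \<epsilon> N^2\<close> then
      add up to \<open>t^2 \<eta>\<close>.\<close>
    define \<epsilon> where "\<epsilon> = \<eta> / (4 * N\<^sup>2)"
    have \<epsilon>: "\<epsilon> > 0" using \<eta> N by (simp add: \<epsilon>_def)
    from has_derivative_hess[OF dg] \<epsilon> obtain \<delta>1 where \<delta>1: "\<delta>1 > 0"
      "\<And>w. norm (w - z) < \<delta>1 \<Longrightarrow> norm (grad F w - grad F z - ?H (w - z)) \<le> \<epsilon> * norm (w - z)"
      unfolding has_derivative_at_alt by blast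
    define \<delta> where "\<delta> = min \<delta>0 \<delta>1"
    define t where "t = \<delta> / (2 * N)"
    have t: "t > 0" "t * N < \<delta>" using \<delta>0 \<delta>1 N by (auto simp: t_def \<delta>_def)
    let ?D = "F (z + t *\<^sub>R d + t *\<^sub>R e) - F (z + t *\<^sub>R d) - F (z + t *\<^sub>R e) + F z"
    have 1: "\<bar>?D - t\<^sup>2 * (d \<bullet> ?H e)\<bar> \<le> 2 * t\<^sup>2 * \<epsilon> * N\<^sup>2"
      by (rule second_difference_bound[where \<delta> = \<delta>])
        (use \<delta>0 \<delta>1 H t N \<epsilon> in \<open>auto simp: \<delta>_def dist_norm\<close>)
    have "\<bar>F (z + t *\<^sub>R e + t *\<^sub>R d) - F (z + t *\<^sub>R e) - F (z + t *\<^sub>R d) + F z - t\<^sup>2 * (e \<bullet> ?H d)\<bar>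
        \<le> 2 * t\<^sup>2 * \<epsilon> * N\<^sup>2"
      by (rule second_difference_bound[where \<delta> = \<delta>])
        (use \<delta>0 \<delta>1 H t N \<epsilon> in \<open>auto simp: \<delta>_def dist_norm\<close>)
    then have 2: "\<bar>?D - t\<^sup>2 * (e \<bullet> ?H d)\<bar> \<le> 2 * t\<^sup>2 * \<epsilon> * N\<^sup>2"
      by (simp add: algebra_simps)
    have "t\<^sup>2 * \<bar>d \<bullet> ?H e - e \<bullet> ?H d\<bar> = \<bar>t\<^sup>2 * (d \<bullet> ?H e) - t\<^sup>2 * (e \<bullet> ?H d)\<bar>"
      by (simp add: abs_mult right_diff_distrib[symmetric])
    also have "\<dots> \<le> t\<^sup>2 * (4 * \<epsilon> * N\<^sup>2)" using 1 2 by linarith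
    finally have "\<bar>d \<bullet> ?H e - e \<bullet> ?H d\<bar> \<le> 4 * \<epsilon> * N\<^sup>2" using t by simp
    also have "\<dots> = \<eta>" using N by (simp add: \<epsilon>_def)
    finally show ?thesis by simp
  qed
  then have "\<bar>d \<bullet> ?H e - e \<bullet> ?H d\<bar> \<le> 0" by (rule field_le_epsilon)
  then show ?thesis by (simp add: inner_commute)
qed

section \<open>Envelopes and linearised sensitivity\<close>

text \<open>A sandwich: keeping \<open>y\<close> at \<open>w'\<close> bounds \<open>L w'\<close>
  from above, and using \<open>y'\<close> at \<open>w\<close> bounds the increment from below by
  \<open>H (w', y') - H (w, y')\<close>. In the lower bound the contributions of
  \<open>y' - y\<close> to the derivative cancel, and the Lipschitz estimate makes the remainders
  \<open>o(dist w w')\<close>.\<close>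

lemma envelope_has_derivative:
  fixes H :: "'w::real_normed_vector \<times> 'b::real_normed_vector \<Rightarrow> real"
  assumes H: "(H has_derivative H') (at (w, y))"
    and Lw: "L w = H (w, y)" and r: "r > 0"
    and sel: "\<And>w'. w' \<in> S \<Longrightarrow> dist w w' < r \<Longrightarrow> \<exists>y'. dist y y' \<le> K * dist w w' \<and>
        L w' = H (w', y') \<and> L w' \<le> H (w', y) \<and> L w \<le> H (w, y')"
  shows "(L has_derivative (\<lambda>d. H' (d, 0))) (at w within S)"
proof -
  have bl: "bounded_linear H'" using H by (rule has_derivative_bounded_linear)
  then have lin: "linear H'" by (rule bounded_linear.linear)
  have "bounded_linear (\<lambda>d. H' (d, 0))"
    by (rule bounded_linear_compose[OF bl]) (intro bounded_linear_Pair bounded_linear_ident bounded_linear_zero)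
  moreover have "\<exists>\<delta>>0. \<forall>w'\<in>S. norm (w' - w) < \<delta> \<longrightarrow>
      norm (L w' - L w - H' (w' - w, 0)) \<le> \<eta> * norm (w' - w)" if \<eta>: "\<eta> > 0" for \<eta>
  proof -
    define k where "k = \<bar>K\<bar>"
    \<comment> \<open>The lower bound uses two remainders, of sizes
      \<open>\<epsilon> (n + k n)\<close> and \<open>\<epsilon> k n\<close>, whose sum is
      \<open>\<eta> n\<close> for this choice.\<close>
    define \<epsilon> where "\<epsilon> = \<eta> / (1 + 2 * k)"
    have k: "k \<ge> 0" by (simp add: k_def)
    have \<epsilon>: "\<epsilon> > 0" using \<eta> k by (simp add: \<epsilon>_def)
    from H \<epsilon> obtain \<delta> where \<delta>: "\<delta> > 0"
      "\<And>q. norm (q - (w, y)) < \<delta> \<Longrightarrow> norm (H q - H (w, y) - H' (q - (w, y))) \<le> \<epsilon> * norm (q - (w, y))"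
      unfolding has_derivative_at_alt by blast
    define \<delta>' where "\<delta>' = min r (\<delta> / (1 + k))"
    have "\<delta>' > 0" using \<delta> r k by (simp add: \<delta>'_def)
    moreover have "norm (L w' - L w - H' (w' - w, 0)) \<le> \<eta> * norm (w' - w)"
      if w': "w' \<in> S" "norm (w' - w) < \<delta>'" for w'
    proof -
      define n where "n = norm (w' - w)"
      have n: "n \<ge> 0" "n < r" "n * (1 + k) < \<delta>"
        using w' k unfolding n_def \<delta>'_def by (auto simp: field_simps)
      have "dist w w' < r" using n by (simp add: n_def dist_norm norm_minus_commute)
      from sel[OF w'(1) this] obtain y' where y': "dist y y' \<le> K * dist w w'"
        "L w' = H (w', y')" "L w' \<le> H (w', y)" "L w \<le> H (w, y')" by blast
      have "norm (y' - y) \<le> K * n" using y'(1) by (simp add: n_def dist_norm norm_minus_commute)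
      also have "\<dots> \<le> k * n" using n by (intro mult_right_mono) (auto simp: k_def)
      finally have dy: "norm (y' - y) \<le> k * n" .
      have kn: "0 \<le> k * n" using k n by simp
      have b1: "norm ((w', y) - (w, y)) = n" by (simp add: n_def)
      have b2: "norm ((w', y') - (w, y)) \<le> n + k * n"
        using norm_Pair_le[of "w' - w" "y' - y"] dy by (simp add: n_def)
      have b3: "norm ((w, y') - (w, y)) \<le> k * n" using dy by simp
      have nk: "n + k * n < \<delta>" using n by (simp add: algebra_simps)
      have e1: "norm (H (w', y) - H (w, y) - H' (w' - w, 0)) \<le> \<epsilon> * n"
        using \<delta>(2)[of "(w', y)"] b1 nk kn by simp
      have e2: "norm (H (w', y') - H (w, y) - H' (w' - w, y' - y)) \<le> \<epsilon> * (n + k * n)"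
      proof -
        have "norm (H (w', y') - H (w, y) - H' ((w', y') - (w, y))) \<le> \<epsilon> * norm ((w', y') - (w, y))"
          by (rule \<delta>(2)) (use b2 nk in linarith)
        also have "\<dots> \<le> \<epsilon> * (n + k * n)" using b2 \<epsilon> by (intro mult_left_mono) auto
        finally show ?thesis by simp
      qed
      have e3: "norm (H (w, y') - H (w, y) - H' (0, y' - y)) \<le> \<epsilon> * (k * n)"
      proof -
        have "norm (H (w, y') - H (w, y) - H' ((w, y') - (w, y))) \<le> \<epsilon> * norm ((w, y') - (w, y))"
          by (rule \<delta>(2)) (use b3 nk n in linarith)
        also have "\<dots> \<le> \<epsilon> * (k * n)" using b3 \<epsilon> by (intro mult_left_mono) auto
        finally show ?thesis by simp
      qed
      have split: "H' (w' - w, y' - y) = H' (w' - w, 0) + H' (0, y' - y)"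
        using linear_add[OF lin, of "(w' - w, 0)" "(0, y' - y)"] by simp
      have tot: "\<epsilon> * n + 2 * (\<epsilon> * (k * n)) = \<eta> * n"
      proof -
        have "\<epsilon> * (1 + 2 * k) = \<eta>" using k by (simp add: \<epsilon>_def)
        then have "\<epsilon> * (1 + 2 * k) * n = \<eta> * n" by simp
        then show ?thesis by (simp add: algebra_simps)
      qed
      have "0 \<le> \<epsilon> * (k * n)" using \<epsilon> kn by simp
      then have "\<bar>L w' - L w - H' (w' - w, 0)\<bar> \<le> \<epsilon> * n + 2 * (\<epsilon> * (k * n))"
        using e1 e2 e3 split y' Lw unfolding real_norm_def distrib_left by linarith
      then show ?thesis using tot by (simp add: n_def)
    qed
    ultimately show ?thesis by blast
  qed
  ultimately show ?thesis unfolding has_derivative_within_alt by blast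
qed

text \<open>A chain rule for a path that is Lipschitz at its base point but perhaps not
  differentiable there: up to first order \<open>\<phi>\<close> along the path may be replaced by
  its linearisation, so only a linear functional of the path remains to be differentiated.\<close>

lemma lipschitz_path_has_derivative_zero:
  fixes \<phi> :: "'p::real_normed_vector \<Rightarrow> 'c::real_normed_vector" and q :: "'w::real_normed_vector \<Rightarrow> 'p"
  assumes \<phi>: "(\<phi> has_derivative \<phi>') (at (q w0))" and r: "r > 0"
    and lip: "\<And>w. w \<in> S \<Longrightarrow> dist w0 w < r \<Longrightarrow> norm (q w - q w0) \<le> C * norm (w - w0)"
  shows "((\<lambda>w. \<phi> (q w) - \<phi>' (q w)) has_derivative (\<lambda>_. 0)) (at w0 within S)"
proof -
  have lin: "linear \<phi>'" using \<phi> by (rule has_derivative_linear)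
  define k where "k = \<bar>C\<bar> + 1"
  have k: "k > 0" by (simp add: k_def)
  have "\<exists>\<delta>>0. \<forall>w\<in>S. norm (w - w0) < \<delta> \<longrightarrow>
      norm ((\<phi> (q w) - \<phi>' (q w)) - (\<phi> (q w0) - \<phi>' (q w0)) - 0) \<le> \<eta> * norm (w - w0)"
    if \<eta>: "\<eta> > 0" for \<eta>
  proof -
    have \<epsilon>: "\<eta> / k > 0" using \<eta> k by simp
    from \<phi> \<epsilon> obtain \<delta> where \<delta>: "\<delta> > 0"
      "\<And>p. norm (p - q w0) < \<delta> \<Longrightarrow> norm (\<phi> p - \<phi> (q w0) - \<phi>' (p - q w0)) \<le> \<eta> / k * norm (p - q w0)"
      unfolding has_derivative_at_alt by blast
    define \<delta>' where "\<delta>' = min r (\<delta> / k)"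
    have "norm ((\<phi> (q w) - \<phi>' (q w)) - (\<phi> (q w0) - \<phi>' (q w0)) - 0) \<le> \<eta> * norm (w - w0)"
      if w: "w \<in> S" "norm (w - w0) < \<delta>'" for w
    proof -
      have d: "dist w0 w < r" using w by (simp add: \<delta>'_def dist_norm norm_minus_commute)
      have "norm (q w - q w0) \<le> C * norm (w - w0)" using lip[OF w(1) d] .
      also have "\<dots> \<le> k * norm (w - w0)" by (intro mult_right_mono) (auto simp: k_def)
      finally have b: "norm (q w - q w0) \<le> k * norm (w - w0)" .
      have "k * norm (w - w0) < \<delta>" using w k by (simp add: \<delta>'_def field_simps)
      then have "norm (\<phi> (q w) - \<phi> (q w0) - \<phi>' (q w - q w0)) \<le> \<eta> / k * norm (q w - q w0)"
        using b by (intro \<delta>(2)) linarith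
      also have "\<dots> \<le> \<eta> / k * (k * norm (w - w0))" using b \<epsilon> by (intro mult_left_mono) auto
      also have "\<dots> = \<eta> * norm (w - w0)" using k by simp
      finally show ?thesis by (simp add: linear_diff[OF lin] algebra_simps)
    qed
    moreover have "\<delta>' > 0" using r \<delta> k by (simp add: \<delta>'_def)
    ultimately show ?thesis by blast
  qed
  then show ?thesis unfolding has_derivative_within_alt by (auto intro: bounded_linear_zero)
qed

text \<open>No inverse of \<open>M\<close> is available, so \<open>z\<close> is only controlled through the functionals
  \<open>c \<bullet> z\<close> with \<open>c\<close> in the range of \<open>M\<close>.\<close>

locale singular_sensitivity =
  fixes F :: "'w::real_normed_vector \<times> 'z::euclidean_space \<Rightarrow> 'z"
    and N :: "'w \<Rightarrow> 'z" and M :: "'z \<Rightarrow> 'z" and z :: "'w \<Rightarrow> 'z" and w0 :: 'w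
    and S :: "'w set" and r C :: real
  assumes F: "(F has_derivative (\<lambda>(d, e). N d + M e)) (at (w0, z w0))"
    and r: "r > 0"
    and zero: "\<And>w. w \<in> S \<Longrightarrow> dist w0 w < r \<Longrightarrow> F (w, z w) = 0"
    and lin_N: "linear N" and lin_M: "linear M"
    and zero0: "F (w0, z w0) = 0"
    and lip: "\<And>w. w \<in> S \<Longrightarrow> dist w0 w < r \<Longrightarrow> norm (z w - z w0) \<le> C * norm (w - w0)"
begin

text \<open>\<open>F\<close> vanishes at both ends, so the linear part equals minus the remainder,
  and the Lipschitz bound measures that remainder by \<open>w - w0\<close> alone.\<close>

lemma linearized:
  assumes \<eta>: "\<eta> > 0"
  shows "\<exists>\<delta>>0. \<forall>w\<in>S. norm (w - w0) < \<delta> \<longrightarrow>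
    norm (N (w - w0) + M (z w - z w0)) \<le> \<eta> * norm (w - w0)"
proof -
  define k where "k = \<bar>C\<bar>"
  define \<epsilon> where "\<epsilon> = \<eta> / (1 + k)"
  have k: "k \<ge> 0" by (simp add: k_def)
  have \<epsilon>: "\<epsilon> > 0" using \<eta> k by (simp add: \<epsilon>_def)
  from F \<epsilon> obtain \<delta> where \<delta>: "\<delta> > 0"
    "\<And>q. norm (q - (w0, z w0)) < \<delta> \<Longrightarrow> norm (F q - F (w0, z w0) - (\<lambda>(d, e). N d + M e) (q - (w0, z w0)))
      \<le> \<epsilon> * norm (q - (w0, z w0))"
    unfolding has_derivative_at_alt by blast
  define \<delta>' where "\<delta>' = min r (\<delta> / (1 + k))"
  have "\<delta>' > 0" using \<delta> r k by (simp add: \<delta>'_def)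
  moreover have "norm (N (w - w0) + M (z w - z w0)) \<le> \<eta> * norm (w - w0)"
    if w: "w \<in> S" "norm (w - w0) < \<delta>'" for w
  proof -
    define n where "n = norm (w - w0)"
    have n: "n \<ge> 0" "n < r" "n * (1 + k) < \<delta>"
      using w k unfolding n_def \<delta>'_def by (auto simp: field_simps)
    have d: "dist w0 w < r" using n by (simp add: n_def dist_norm norm_minus_commute)
    have "norm (z w - z w0) \<le> C * n" using lip[OF w(1) d] by (simp add: n_def)
    also have "\<dots> \<le> k * n" using n by (intro mult_right_mono) (auto simp: k_def)
    finally have b: "norm ((w, z w) - (w0, z w0)) \<le> n * (1 + k)"
      using norm_Pair_le[of "w - w0" "z w - z w0"] by (simp add: n_def algebra_simps)
    have "norm (F (w, z w) - F (w0, z w0) - (\<lambda>(d, e). N d + M e) ((w, z w) - (w0, z w0)))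
      \<le> \<epsilon> * norm ((w, z w) - (w0, z w0))" by (rule \<delta>(2)) (use b n in linarith)
    also have "\<dots> \<le> \<epsilon> * (n * (1 + k))" using b \<epsilon> by (intro mult_left_mono) auto
    also have "\<dots> = \<eta> * n" using k by (simp add: \<epsilon>_def field_simps)
    finally show ?thesis using zero[OF w(1) d] zero0
      by (simp add: n_def norm_minus_commute norm_minus_cancel[of "N (w - w0) + M (z w - z w0)", symmetric]
          del: norm_minus_cancel)
  qed
  ultimately show ?thesis by blast
qed

text \<open>Dividing the linearised system by \<open>t\<close> exhibits \<open>N d\<close> as a
  limit of \<open>M\<close> applied to negative difference quotients of \<open>z\<close>. These
  quotients need not converge, but the range of \<open>M\<close> is closed.\<close>

lemma direction_in_range:
  assumes t0: "t0 > 0" and S: "\<And>t. 0 < t \<Longrightarrow> t < t0 \<Longrightarrow> w0 + t *\<^sub>R d \<in> S"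
  shows "N d \<in> range M"
proof -
  have "closed (range M)"
    by (intro closed_subspace linear_subspace_image lin_M subspace_UNIV)
  moreover have "\<exists>y\<in>range M. dist y (N d) < \<eta>" if \<eta>: "\<eta> > 0" for \<eta>
  proof -
    define \<epsilon> where "\<epsilon> = \<eta> / (norm d + 1)"
    have nd: "norm d + 1 > 0" using norm_ge_zero[of d] by linarith
    have \<epsilon>: "\<epsilon> > 0" using \<eta> nd by (simp add: \<epsilon>_def)
    from linearized[OF \<epsilon>] obtain \<delta> where \<delta>: "\<delta> > 0"
      "\<And>w. w \<in> S \<Longrightarrow> norm (w - w0) < \<delta> \<Longrightarrow> norm (N (w - w0) + M (z w - z w0)) \<le> \<epsilon> * norm (w - w0)"
      by blast
    \<comment> \<open>Half of each bound makes the inequalities strict, and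
      \<open>norm d + 1\<close> covers the direction 0.\<close>
    define t where "t = min (t0 / 2) (\<delta> / (2 * (norm d + 1)))"
    have t: "t > 0" "t < t0" using t0 \<delta> nd by (auto simp: t_def)
    have cancel: "\<delta> / (2 * n) * n = \<delta> / 2" if "n > 0" for n :: real using that by simp
    have "t * (norm d + 1) \<le> \<delta> / (2 * (norm d + 1)) * (norm d + 1)"
      using nd by (intro mult_right_mono) (auto simp: t_def)
    also have "\<dots> = \<delta> / 2" by (rule cancel[OF nd])
    finally have "t * norm d < \<delta>" using t \<delta> by (simp add: distrib_left)
    then have "norm (N (t *\<^sub>R d) + M (z (w0 + t *\<^sub>R d) - z w0)) \<le> \<epsilon> * (t * norm d)"
      using \<delta>(2)[OF S[OF t]] t by simp
    moreover have "N (t *\<^sub>R d) + M (z (w0 + t *\<^sub>R d) - z w0)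
        = t *\<^sub>R (N d - M ((- 1 / t) *\<^sub>R (z (w0 + t *\<^sub>R d) - z w0)))"
      using t by (simp only: linear_scale[OF lin_N] linear_scale[OF lin_M]) (simp add: scaleR_add_right)
    ultimately have "t * norm (N d - M ((- 1 / t) *\<^sub>R (z (w0 + t *\<^sub>R d) - z w0))) \<le> t * (\<epsilon> * norm d)"
      using t by simp
    then have "norm (N d - M ((- 1 / t) *\<^sub>R (z (w0 + t *\<^sub>R d) - z w0))) \<le> \<epsilon> * norm d"
      using t by simp
    also have "\<dots> < \<epsilon> * (norm d + 1)" using \<epsilon> by (simp add: distrib_left)
    also have "\<dots> = \<eta>" using nd by (simp add: \<epsilon>_def)
    finally have "dist (M ((- 1 / t) *\<^sub>R (z (w0 + t *\<^sub>R d) - z w0))) (N d) < \<eta>"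
      by (simp only: dist_norm norm_minus_commute)
    then show ?thesis by blast
  qed
  ultimately show ?thesis using closed_approachable by blast
qed

text \<open>Applying the functional \<open>c \<bullet> P\<close> to the linearised system isolates
  \<open>c \<bullet> z\<close>, because \<open>c\<close> lies in the range of
  \<open>M\<close>.\<close>

lemma functional_has_derivative:
  assumes sa: "\<And>x y. M x \<bullet> y = x \<bullet> M y" and P: "linear P" and MPM: "\<And>x. M (P (M x)) = M x"
    and c: "c \<in> range M"
  shows "((\<lambda>w. c \<bullet> z w) has_derivative (\<lambda>d. - (c \<bullet> P (N d)))) (at w0 within S)"
proof -
  from c obtain k where k: "c = M k" by blast
  have blN: "bounded_linear N"
  proof -
    have l: "bounded_linear (\<lambda>(d, e). N d + M e)" using F by (rule has_derivative_bounded_linear)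
    have "bounded_linear (\<lambda>d::'w. (d, 0::'z))"
      by (intro bounded_linear_Pair bounded_linear_ident bounded_linear_zero)
    from bounded_linear_compose[OF l this] show ?thesis by (simp add: linear_0[OF lin_M])
  qed
  have blP: "bounded_linear P" using P by (simp add: linear_conv_bounded_linear)
  then obtain B where B: "B > 0" "\<And>x. norm (P x) \<le> norm x * B"
    using bounded_linear.pos_bounded by blast
  have bl: "bounded_linear (\<lambda>d. - (c \<bullet> P (N d)))"
    by (intro bounded_linear_minus bounded_linear_inner_right_comp bounded_linear_compose[OF blP blN])
  \<comment> \<open>With \<open>c = M k\<close>, self-adjointness moves \<open>M\<close> across the
    product and \<open>M P M = M\<close> removes \<open>P\<close>.\<close>
  have key: "c \<bullet> (x - y) + c \<bullet> P (N d) = c \<bullet> P (N d + M (x - y))" for x y d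
  proof -
    have "c \<bullet> P (M (x - y)) = M k \<bullet> P (M (x - y))" by (simp add: k)
    also have "\<dots> = k \<bullet> M (P (M (x - y)))" by (rule sa)
    also have "\<dots> = c \<bullet> (x - y)" by (simp add: MPM sa[symmetric] k)
    finally show ?thesis by (simp add: linear_add[OF P] inner_add_right)
  qed
  have "\<exists>\<delta>>0. \<forall>w\<in>S. norm (w - w0) < \<delta> \<longrightarrow>
      norm (c \<bullet> z w - c \<bullet> z w0 - - (c \<bullet> P (N (w - w0)))) \<le> \<eta> * norm (w - w0)" if \<eta>: "\<eta> > 0" for \<eta>
  proof -
    define \<epsilon> where "\<epsilon> = \<eta> / ((norm c + 1) * B)"
    have nc: "norm c + 1 > 0" using norm_ge_zero[of c] by linarith
    have \<epsilon>: "\<epsilon> > 0" using \<eta> nc B by (simp add: \<epsilon>_def)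
    from linearized[OF \<epsilon>] obtain \<delta> where \<delta>: "\<delta> > 0"
      "\<And>w. w \<in> S \<Longrightarrow> norm (w - w0) < \<delta> \<Longrightarrow> norm (N (w - w0) + M (z w - z w0)) \<le> \<epsilon> * norm (w - w0)"
      by blast
    have "norm (c \<bullet> z w - c \<bullet> z w0 - - (c \<bullet> P (N (w - w0)))) \<le> \<eta> * norm (w - w0)"
      if w: "w \<in> S" "norm (w - w0) < \<delta>" for w
    proof -
      let ?r = "N (w - w0) + M (z w - z w0)"
      have "norm (c \<bullet> z w - c \<bullet> z w0 - - (c \<bullet> P (N (w - w0)))) = \<bar>c \<bullet> P ?r\<bar>"
        unfolding key[symmetric] by (simp add: inner_diff_right)
      also have "\<dots> \<le> norm c * norm (P ?r)" by (rule Cauchy_Schwarz_ineq2)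
      also have "\<dots> \<le> (norm c + 1) * (norm ?r * B)" using B nc by (intro mult_mono) auto
      also have "\<dots> \<le> (norm c + 1) * ((\<epsilon> * norm (w - w0)) * B)"
        using B nc \<delta>(2)[OF w] by (intro mult_left_mono mult_right_mono) auto
      also have "\<dots> = ((norm c + 1) * B * \<epsilon>) * norm (w - w0)" by (simp only: mult_ac)
      also have "(norm c + 1) * B * \<epsilon> = \<eta>" using B nc by (simp add: \<epsilon>_def)
      finally show ?thesis .
    qed
    then show ?thesis using \<delta> by blast
  qed
  then show ?thesis unfolding has_derivative_within_alt using bl by blast
qed

end

section \<open>Multipliers under LICQ\<close>

text \<open>Coefficients are indexed by \<open>K\<close> and not by the vectors themselves, so
  repeated vectors do no harm.\<close>

lemma span_image_eq_sum:
  assumes K: "finite K" and p: "p \<in> span (a ` K)"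
  shows "\<exists>c. p = (\<Sum>k\<in>K. c k *\<^sub>R a k)"
proof -
  let ?S = "{p. \<exists>c. p = (\<Sum>k\<in>K. c k *\<^sub>R a k)}"
  have "subspace ?S"
    unfolding subspace_def
  proof (intro conjI ballI allI)
    show "0 \<in> ?S" by (auto intro!: exI[of _ "\<lambda>_. 0"])
  next
    fix x y assume "x \<in> ?S" "y \<in> ?S"
    then obtain c d where "x = (\<Sum>k\<in>K. c k *\<^sub>R a k)" "y = (\<Sum>k\<in>K. d k *\<^sub>R a k)" by blast
    then have "x + y = (\<Sum>k\<in>K. (c k + d k) *\<^sub>R a k)" by (simp add: scaleR_add_left sum.distrib)
    then show "x + y \<in> ?S" by (intro CollectI exI[of _ "\<lambda>k. c k + d k"])
  next
    fix t x assume "x \<in> ?S"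
    then obtain c where "x = (\<Sum>k\<in>K. c k *\<^sub>R a k)" by blast
    then have "t *\<^sub>R x = (\<Sum>k\<in>K. (t * c k) *\<^sub>R a k)" by (simp add: scaleR_sum_right)
    then show "t *\<^sub>R x \<in> ?S" by (intro CollectI exI[of _ "\<lambda>k. t * c k"])
  qed
  moreover have "a ` K \<subseteq> ?S"
  proof
    fix x assume "x \<in> a ` K"
    then obtain j where j: "j \<in> K" "x = a j" by blast
    have "(\<Sum>k\<in>K. (if k = j then 1 else 0) *\<^sub>R a k) = (\<Sum>k\<in>K. if k = j then a j else 0)"
      by (intro sum.cong) auto
    also have "\<dots> = x" using j K by (simp add: sum.delta)
    finally show "x \<in> ?S" by (intro CollectI exI[of _ "\<lambda>k. if k = j then 1 else 0"]) simp
  qed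
  ultimately show ?thesis using span_minimal[of "a ` K" ?S] p by blast
qed

text \<open>Independence of an indexed family: unlike for the set of its members, a repeated vector
  counts as a dependence, as LICQ demands.\<close>

definition independent_family :: "'k set \<Rightarrow> ('k \<Rightarrow> 'b::real_vector) \<Rightarrow> bool" where
  "independent_family K a \<longleftrightarrow>
    (\<forall>c. (\<Sum>k\<in>K. c k *\<^sub>R a k) = 0 \<longrightarrow> (\<forall>k\<in>K. c k = 0))"

text \<open>The component of \<open>a j\<close> orthogonal to all the other vectors is nonzero by
  independence; rescaling it gives the dual vector.\<close>

lemma dual_vector_exists:
  fixes a :: "'k \<Rightarrow> 'b::euclidean_space"
  assumes K: "finite K" and ind: "independent_family K a" and j: "j \<in> K"
  shows "\<exists>d. \<forall>k\<in>K. a k \<bullet> d = (if k = j then 1 else 0)"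
proof -
  obtain p q where p: "p \<in> span (a ` (K - {j}))"
    and q: "\<And>w. w \<in> span (a ` (K - {j})) \<Longrightarrow> orthogonal q w" and pq: "a j = p + q"
    using orthogonal_subspace_decomp_exists by blast
  have "q \<noteq> 0"
  proof
    assume "q = 0"
    then have "a j \<in> span (a ` (K - {j}))" using p pq by simp
    with span_image_eq_sum[of "K - {j}"] K
    obtain c where c: "a j = (\<Sum>k\<in>K - {j}. c k *\<^sub>R a k)" by blast
    define c' where "c' k = (if k = j then - 1 else c k)" for k
    have "(\<Sum>k\<in>K. c' k *\<^sub>R a k) = c' j *\<^sub>R a j + (\<Sum>k\<in>K - {j}. c' k *\<^sub>R a k)"
      using K j by (rule sum.remove)
    also have "(\<Sum>k\<in>K - {j}. c' k *\<^sub>R a k) = (\<Sum>k\<in>K - {j}. c k *\<^sub>R a k)"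
      by (intro sum.cong) (auto simp: c'_def)
    also have "c' j *\<^sub>R a j + \<dots> = 0" unfolding c[symmetric] by (simp add: c'_def)
    finally have "c' j = 0" using ind j unfolding independent_family_def by blast
    then show False by (simp add: c'_def)
  qed
  then have qq: "q \<bullet> q \<noteq> 0" by simp
  have "a j \<bullet> q = q \<bullet> q" using q[OF p] by (simp add: pq inner_add_left inner_add_right orthogonal_def inner_commute)
  moreover have "a k \<bullet> q = 0" if "k \<in> K" "k \<noteq> j" for k
    using q[OF span_base, of "a k"] that by (auto simp: orthogonal_def inner_commute)
  ultimately show ?thesis using qq
    by (intro exI[of _ "(1 / (q \<bullet> q)) *\<^sub>R q"]) auto
qed

text \<open>Dual vectors at \<open>y0\<close> read off each coefficient, also from a slightly
  perturbed family, with an error small enough to be absorbed. The constant is uniform near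
  \<open>y0\<close>; it yields both LICQ and a Lipschitz bound for multipliers at nearby
  points.\<close>

lemma independent_family_bounded_below:
  fixes a :: "'k \<Rightarrow> 'b::metric_space \<Rightarrow> 'c::euclidean_space"
  assumes K: "finite K" and cont: "\<And>k. k \<in> K \<Longrightarrow> isCont (a k) y0"
    and ind: "independent_family K (\<lambda>k. a k y0)"
  shows "\<exists>c>0. \<forall>\<^sub>F y in nhds y0. \<forall>\<mu>. c * (\<Sum>k\<in>K. \<bar>\<mu> k\<bar>) \<le> norm (\<Sum>k\<in>K. \<mu> k *\<^sub>R a k y)"
proof -
  have "\<forall>j\<in>K. \<exists>d. \<forall>k\<in>K. a k y0 \<bullet> d = (if k = j then 1 else 0)"
    using dual_vector_exists[OF K ind] by blast
  then obtain d where d: "\<And>j k. j \<in> K \<Longrightarrow> k \<in> K \<Longrightarrow> a k y0 \<bullet> d j = (if k = j then 1 else 0)"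
    by metis
  \<comment> \<open>\<open>R\<close> exceeds the total norm of the dual vectors, so a perturbation
    below \<open>1 / (2 * R)\<close> costs at most half of the sum of the
    \<open>\<bar>\<mu> k\<bar>\<close>.\<close>
  define R where "R = (\<Sum>j\<in>K. norm (d j)) + 1"
  have R: "R > 0" unfolding R_def by (intro add_nonneg_pos sum_nonneg) auto
  have "\<forall>\<^sub>F y in nhds y0. \<forall>k\<in>K. norm (a k y - a k y0) < 1 / (2 * R)"
  proof (intro eventually_ball_finite[OF K] ballI)
    fix k assume k: "k \<in> K"
    have "(a k \<longlongrightarrow> a k y0) (nhds y0)"
      using cont[OF k] by (simp add: continuous_at tendsto_at_iff_tendsto_nhds)
    then show "\<forall>\<^sub>F y in nhds y0. norm (a k y - a k y0) < 1 / (2 * R)"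
      using R tendstoD[of "a k" "a k y0" "nhds y0" "1 / (2 * R)"] by (simp add: dist_norm)
  qed
  then have "\<forall>\<^sub>F y in nhds y0. \<forall>\<mu>. 1 / (2 * R) * (\<Sum>k\<in>K. \<bar>\<mu> k\<bar>) \<le> norm (\<Sum>k\<in>K. \<mu> k *\<^sub>R a k y)"
  proof eventually_elim
    case (elim y)
    show ?case
    proof
      fix \<mu> :: "'k \<Rightarrow> real"
      define V where "V = (\<Sum>k\<in>K. \<mu> k *\<^sub>R a k y)"
      define T where "T = (\<Sum>k\<in>K. \<bar>\<mu> k\<bar>)"
      have T: "T \<ge> 0" unfolding T_def by (intro sum_nonneg) auto
      have each: "\<bar>\<mu> j\<bar> \<le> (norm V + T / (2 * R)) * norm (d j)" if j: "j \<in> K" for j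
      proof -
        have "(\<Sum>k\<in>K. \<mu> k *\<^sub>R a k y0) \<bullet> d j = (\<Sum>k\<in>K. if k = j then \<mu> j else 0)"
          unfolding inner_sum_left by (intro sum.cong) (auto simp: d j)
        also have "\<dots> = \<mu> j" using j K by (simp add: sum.delta)
        finally have "\<mu> j = (V - (\<Sum>k\<in>K. \<mu> k *\<^sub>R (a k y - a k y0))) \<bullet> d j"
          by (simp add: V_def scaleR_diff_right sum_subtractf)
        then have "\<bar>\<mu> j\<bar> \<le> norm (V - (\<Sum>k\<in>K. \<mu> k *\<^sub>R (a k y - a k y0))) * norm (d j)"
          using Cauchy_Schwarz_ineq2 by metis
        also have "\<dots> \<le> (norm V + T / (2 * R)) * norm (d j)"
        proof (intro mult_right_mono)
          have "norm (\<Sum>k\<in>K. \<mu> k *\<^sub>R (a k y - a k y0)) \<le> (\<Sum>k\<in>K. \<bar>\<mu> k\<bar> * (1 / (2 * R)))"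
          proof (intro sum_norm_le)
            fix k assume "k \<in> K"
            then show "norm (\<mu> k *\<^sub>R (a k y - a k y0)) \<le> \<bar>\<mu> k\<bar> * (1 / (2 * R))"
              unfolding norm_scaleR using elim by (intro mult_left_mono) (auto intro: less_imp_le)
          qed
          also have "\<dots> = T / (2 * R)" by (simp add: T_def sum_distrib_right sum_divide_distrib)
          finally show "norm (V - (\<Sum>k\<in>K. \<mu> k *\<^sub>R (a k y - a k y0))) \<le> norm V + T / (2 * R)"
            using norm_triangle_ineq4[of V "\<Sum>k\<in>K. \<mu> k *\<^sub>R (a k y - a k y0)"] by linarith
        qed simp
        finally show ?thesis .
      qed
      have "T \<le> (\<Sum>j\<in>K. (norm V + T / (2 * R)) * norm (d j))"
        unfolding T_def by (intro sum_mono) (use each in \<open>simp add: T_def\<close>)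
      also have "\<dots> = (norm V + T / (2 * R)) * (R - 1)" by (simp add: R_def sum_distrib_left)
      also have "\<dots> \<le> (norm V + T / (2 * R)) * R" using T R by (intro mult_left_mono) auto
      also have "\<dots> = norm V * R + T / 2" using R by (simp add: field_simps)
      finally have "T \<le> 2 * R * norm V" by (simp add: field_simps)
      then show "1 / (2 * R) * (\<Sum>k\<in>K. \<bar>\<mu> k\<bar>) \<le> norm (\<Sum>k\<in>K. \<mu> k *\<^sub>R a k y)"
        using R by (simp add: T_def V_def field_simps)
    qed
  qed
  then show ?thesis using R by (intro exI[of _ "1 / (2 * R)"]) auto
qed

lemma LICQ_iff_independent_family:
  "LICQ P gc Q hc y \<longleftrightarrow>
    independent_family (active_set P gc y <+> Q) (case_sum (\<lambda>i. grad (gc i) y) (\<lambda>j. grad (hc j) y))"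
  (is "?L \<longleftrightarrow> ?R")
proof
  assume L: ?L
  show ?R unfolding independent_family_def
  proof (intro allI impI)
    fix c assume "(\<Sum>k\<in>active_set P gc y <+> Q. c k *\<^sub>R case_sum (\<lambda>i. grad (gc i) y) (\<lambda>j. grad (hc j) y) k) = 0"
    then have "(\<Sum>i\<in>active_set P gc y. c (Inl i) *\<^sub>R grad (gc i) y) + (\<Sum>j\<in>Q. c (Inr j) *\<^sub>R grad (hc j) y) = 0"
      by (simp add: sum.Plus)
    from L[unfolded LICQ_def, rule_format, OF this]
    show "\<forall>k\<in>active_set P gc y <+> Q. c k = 0"
      by auto
  qed
next
  assume R: ?R
  show ?L unfolding LICQ_def
  proof (intro allI impI)
    fix a b assume "(\<Sum>i\<in>active_set P gc y. a i *\<^sub>R grad (gc i) y) + (\<Sum>j\<in>Q. b j *\<^sub>R grad (hc j) y) = 0"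
    then have "(\<Sum>k\<in>active_set P gc y <+> Q. case_sum a b k *\<^sub>R case_sum (\<lambda>i. grad (gc i) y) (\<lambda>j. grad (hc j) y) k) = 0"
      by (simp add: sum.Plus)
    from R[unfolded independent_family_def, rule_format, OF this]
    show "(\<forall>i\<in>active_set P gc y. a i = 0) \<and> (\<forall>j\<in>Q. b j = 0)" by force
  qed
qed

text \<open>First-order optimality is tested on linearised feasible directions. Since the equalities
  are affine, straight lines respect them, and LICQ supplies a direction strictly into every active
  inequality. Orthogonal projection onto the span of the constraint gradients then gives the
  multipliers, and dual vectors give their signs, in place of a separation argument.\<close>

lemma KKT_of_minimizer:
  fixes h :: "'b::euclidean_space \<Rightarrow> real" and P :: "'p::finite set" and Q :: "'q::finite set"
  assumes h: "(h has_derivative (\<lambda>d. d \<bullet> b)) (at y)"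
    and feas: "\<And>i. i \<in> P \<Longrightarrow> gc i y \<le> 0" "\<And>j. j \<in> Q \<Longrightarrow> hc j y = 0"
    and min: "\<And>y'. (\<forall>i\<in>P. gc i y' \<le> 0) \<Longrightarrow> (\<forall>j\<in>Q. hc j y' = 0) \<Longrightarrow> h y \<le> h y'"
    and gc: "\<And>i. i \<in> P \<Longrightarrow> gc i differentiable (at y)"
    and hc: "\<And>j. j \<in> Q \<Longrightarrow> \<exists>a b. \<forall>y. hc j y = a \<bullet> y + b"
    and licq: "LICQ P gc Q hc y"
  shows "\<exists>lam nu. (\<forall>i\<in>active_set P gc y. lam i \<ge> 0) \<and>
    b + (\<Sum>i\<in>active_set P gc y. lam i *\<^sub>R grad (gc i) y) + (\<Sum>j\<in>Q. nu j *\<^sub>R grad (hc j) y) = 0"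
proof -
  let ?A = "active_set P gc y"
  define K where "K = ?A <+> Q"
  define a where "a = case_sum (\<lambda>i. grad (gc i) y) (\<lambda>j. grad (hc j) y)"
  have K: "finite K" by (simp add: K_def)
  have KI: "\<And>i. i \<in> ?A \<Longrightarrow> Inl i \<in> K" "\<And>j. j \<in> Q \<Longrightarrow> Inr j \<in> K" by (auto simp: K_def)
  have ind: "independent_family K a" using licq unfolding LICQ_iff_independent_family K_def a_def .
  have hc_line: "hc j (y + t *\<^sub>R d) = t * (d \<bullet> grad (hc j) y)" if j: "j \<in> Q" for j t d
  proof -
    from hc[OF j] obtain p q where pq: "\<And>y. hc j y = p \<bullet> y + q" by blast
    have "hc j = (\<lambda>y. p \<bullet> y + q)" using pq by blast
    then have "(hc j has_derivative (\<lambda>d. d \<bullet> p)) (at y)"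
      by (auto intro!: derivative_eq_intros simp: inner_commute)
    from grad_eqI[OF this] show ?thesis using feas(2)[OF j]
      by (simp add: pq inner_add_right inner_commute)
  qed
  have line: "((\<lambda>t. F (y + t *\<^sub>R d)) has_real_derivative d \<bullet> v) (at 0)"
    if "(F has_derivative (\<lambda>d. d \<bullet> v)) (at y)" for F :: "'b \<Rightarrow> real" and v d
  proof -
    have "((\<lambda>t. F (y + t *\<^sub>R d)) has_derivative (\<lambda>t. (t *\<^sub>R d) \<bullet> v)) (at 0)"
      by (rule has_derivative_compose[where g = F]) (auto intro!: derivative_eq_intros that)
    then show ?thesis unfolding has_field_derivative_def
      by (rule has_derivative_eq_rhs) (auto simp: fun_eq_iff)
  qed
  \<comment> \<open>Such a direction is feasible for small positive steps: active constraints
    decrease strictly and inactive ones stay negative by continuity. A descent direction would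
    contradict minimality.\<close>
  have strict: "0 \<le> d \<bullet> b"
    if dA: "\<And>i. i \<in> ?A \<Longrightarrow> d \<bullet> grad (gc i) y < 0" and dQ: "\<And>j. j \<in> Q \<Longrightarrow> d \<bullet> grad (hc j) y = 0" for d
  proof (rule ccontr)
    assume "\<not> 0 \<le> d \<bullet> b"
    then have "d \<bullet> b < 0" by simp
    from DERIV_neg_dec_right[OF line[OF h] this]
    have hdec: "\<forall>\<^sub>F t in at_right 0. h (y + t *\<^sub>R d) < h y"
      by (auto simp: eventually_at_right_field)
    have "\<forall>\<^sub>F t in at_right 0. \<forall>i\<in>P. gc i (y + t *\<^sub>R d) \<le> 0"
    proof (intro eventually_ball_finite ballI)
      fix i assume i: "i \<in> P"
      note l = line[OF has_derivative_grad[OF gc[OF i]], of d]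
      show "\<forall>\<^sub>F t in at_right 0. gc i (y + t *\<^sub>R d) \<le> 0"
      proof (cases "i \<in> ?A")
        case True
        then have "gc i y = 0" by (simp add: active_set_def)
        then show ?thesis using DERIV_neg_dec_right[OF l dA[OF True]]
          by (auto simp: eventually_at_right_field intro: less_imp_le)
      next
        case False
        then have neg: "gc i y < 0" using feas(1)[OF i] i by (auto simp: active_set_def)
        have "((\<lambda>t. gc i (y + t *\<^sub>R d)) \<longlongrightarrow> gc i y) (at 0)"
          using DERIV_isCont[OF l] by (simp add: isCont_def)
        then have "((\<lambda>t. gc i (y + t *\<^sub>R d)) \<longlongrightarrow> gc i y) (at_right 0)"
          by (rule tendsto_within_subset) auto
        from order_tendstoD(2)[OF this neg] show ?thesis by eventually_elim simp
      qed
    qed simp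
    with hdec have "\<forall>\<^sub>F t in at_right (0::real). False"
    proof eventually_elim
      case (elim t)
      then show ?case using min[of "y + t *\<^sub>R d"] hc_line dQ by force
    qed
    then show False by simp
  qed
  \<comment> \<open>The negated sum of the dual vectors of the active inequalities; it points
    strictly inward and is tangent to the equalities.\<close>
  obtain d0 where d0: "\<And>i. i \<in> ?A \<Longrightarrow> grad (gc i) y \<bullet> d0 = - 1" "\<And>j. j \<in> Q \<Longrightarrow> grad (hc j) y \<bullet> d0 = 0"
  proof -
    have "\<forall>j\<in>K. \<exists>d. \<forall>k\<in>K. a k \<bullet> d = (if k = j then 1 else 0)"
      using dual_vector_exists[OF K ind] by blast
    then obtain d where d: "\<And>j k. j \<in> K \<Longrightarrow> k \<in> K \<Longrightarrow> a k \<bullet> d j = (if k = j then 1 else 0)"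
      by metis
    define d0 where "d0 = (\<Sum>i\<in>?A. - d (Inl i))"
    have "grad (gc i) y \<bullet> d0 = - 1" if i: "i \<in> ?A" for i
    proof -
      have "a (Inl i) \<bullet> d0 = (\<Sum>l\<in>?A. if l = i then - 1 else 0)"
        unfolding d0_def inner_sum_right using i by (intro sum.cong) (auto simp: d KI)
      then show ?thesis using i by (simp add: sum.delta a_def)
    qed
    moreover have "grad (hc j) y \<bullet> d0 = 0" if j: "j \<in> Q" for j
    proof -
      have "a (Inr j) \<bullet> d0 = 0"
        unfolding d0_def inner_sum_right using j by (intro sum.neutral) (auto simp: d KI)
      then show ?thesis by (simp add: a_def)
    qed
    ultimately show ?thesis by (rule that)
  qed
  \<comment> \<open>Tilting \<open>d\<close> by \<open>t *\<^sub>R d0\<close> makes it strict; then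
    \<open>t\<close> tends to 0.\<close>
  have cone: "0 \<le> d \<bullet> b"
    if dA: "\<And>i. i \<in> ?A \<Longrightarrow> d \<bullet> grad (gc i) y \<le> 0" and dQ: "\<And>j. j \<in> Q \<Longrightarrow> d \<bullet> grad (hc j) y = 0" for d
  proof -
    have "0 \<le> d \<bullet> b + t * (d0 \<bullet> b)" if t: "t > 0" for t
    proof -
      have "0 \<le> (d + t *\<^sub>R d0) \<bullet> b"
      proof (rule strict)
        fix i assume i: "i \<in> ?A"
        show "(d + t *\<^sub>R d0) \<bullet> grad (gc i) y < 0"
          using dA[OF i] d0(1)[OF i] t by (simp add: inner_add_left inner_commute[of d0])
      next
        fix j assume j: "j \<in> Q"
        show "(d + t *\<^sub>R d0) \<bullet> grad (hc j) y = 0"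
          using dQ[OF j] d0(2)[OF j] by (simp add: inner_add_left inner_commute[of d0])
      qed
      then show ?thesis by (simp add: inner_add_left)
    qed
    then have "\<forall>\<^sub>F t in at_right 0. 0 \<le> d \<bullet> b + t * (d0 \<bullet> b)"
      by (auto simp: eventually_at_right_field intro!: exI[of _ 1])
    moreover have "((\<lambda>t. d \<bullet> b + t * (d0 \<bullet> b)) \<longlongrightarrow> d \<bullet> b + 0 * (d0 \<bullet> b)) (at_right 0)"
      by (intro tendsto_intros)
    ultimately show ?thesis
      using tendsto_lowerbound[of "\<lambda>t. d \<bullet> b + t * (d0 \<bullet> b)" _ "at_right 0" 0] by simp
  qed
  obtain p q where p: "p \<in> span (a ` K)"
    and q: "\<And>w. w \<in> span (a ` K) \<Longrightarrow> orthogonal q w" and pq: "b = p + q"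
    using orthogonal_subspace_decomp_exists by blast
  have qa: "q \<bullet> a k = 0" if "k \<in> K" for k
    using q[OF span_base, of "a k"] that by (simp add: orthogonal_def)
  \<comment> \<open>\<open>q\<close> is the part of the objective gradient that no multipliers can
    represent. Being orthogonal to all constraint gradients, \<open>- q\<close> is admissible, and
    its product with \<open>b\<close> is \<open>- (q \<bullet> q)\<close>.\<close>
  have "0 \<le> (- q) \<bullet> b"
  proof (rule cone)
    fix i assume "i \<in> ?A"
    then show "(- q) \<bullet> grad (gc i) y \<le> 0" using qa[of "Inl i"] by (simp add: a_def KI)
  next
    fix j assume "j \<in> Q"
    then show "(- q) \<bullet> grad (hc j) y = 0" using qa[of "Inr j"] by (simp add: a_def KI)
  qed
  moreover have "q \<bullet> p = 0" using q[OF p] by (simp add: orthogonal_def)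
  ultimately have "q \<bullet> q \<le> 0" by (simp add: pq inner_add_right)
  then have "q = 0" using inner_ge_zero[of q] by (simp add: order_antisym)
  then have "b \<in> span (a ` K)" using p pq by simp
  with span_image_eq_sum[OF K] obtain c where c: "b = (\<Sum>k\<in>K. c k *\<^sub>R a k)" by blast
  have sign: "- c (Inl i) \<ge> 0" if i: "i \<in> ?A" for i
  proof -
    have iK: "Inl i \<in> K" using i by (auto simp: K_def)
    from dual_vector_exists[OF K ind iK] obtain d where
      d: "\<And>k. k \<in> K \<Longrightarrow> a k \<bullet> d = (if k = Inl i then 1 else 0)" by blast
    \<comment> \<open>The negated dual vector of constraint \<open>i\<close> is admissible and
      isolates the coefficient of that constraint.\<close>
    have "0 \<le> (- d) \<bullet> b"
    proof (rule cone)
      fix l assume "l \<in> ?A"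
      then show "(- d) \<bullet> grad (gc l) y \<le> 0"
        using d[of "Inl l"] by (auto simp: a_def KI inner_commute split: if_splits)
    next
      fix j assume "j \<in> Q"
      then show "(- d) \<bullet> grad (hc j) y = 0"
        using d[of "Inr j"] by (simp add: a_def KI inner_commute)
    qed
    also have "(- d) \<bullet> b = - (\<Sum>k\<in>K. if k = Inl i then c (Inl i) else 0)"
      unfolding c inner_sum_right inner_minus_left sum_negf
      by (intro arg_cong[where f = uminus] sum.cong) (auto simp: d inner_commute[of d])
    finally show ?thesis using K iK by (simp add: sum.delta)
  qed
  have "b + (\<Sum>i\<in>?A. - c (Inl i) *\<^sub>R grad (gc i) y) + (\<Sum>j\<in>Q. - c (Inr j) *\<^sub>R grad (hc j) y) = 0"
    unfolding c K_def by (simp add: sum.Plus a_def sum_negf)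
  with sign show ?thesis
    by (intro exI[of _ "\<lambda>i. - c (Inl i)"] exI[of _ "\<lambda>j. - c (Inr j)"]) simp
qed

section \<open>Stacked vectors and partial gradients\<close>

lemma linear_y_part: "linear y_part"
  by (auto intro!: linearI simp: y_part_def vec_eq_iff)

lemma bounded_linear_y_part: "bounded_linear y_part"
  using linear_y_part by (simp add: linear_conv_bounded_linear)

lemma y_part_stack [simp]: "y_part (stack lam nu y) = y"
  by (simp add: y_part_def stack_def vec_eq_iff)

lemma stack_nth [simp]:
  "stack lam nu y $ Inl i = lam $ i" "stack lam nu y $ Inr (Inl j) = nu $ j"
  by (simp_all add: stack_def)

lemma sum_UNIV_Plus:
  fixes F :: "'a::finite + 'b::finite \<Rightarrow> 'c::comm_monoid_add"
  shows "(\<Sum>k\<in>UNIV. F k) = (\<Sum>i\<in>UNIV. F (Inl i)) + (\<Sum>j\<in>UNIV. F (Inr j))"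
  using sum.Plus[of "UNIV::'a set" "UNIV::'b set" F] by (simp add: o_def)

lemma inner_stack_zero:
  fixes z :: "real^('p::finite + ('q::finite + 'n::finite))"
  shows "z \<bullet> stack 0 0 c = y_part z \<bullet> c"
  by (simp add: inner_vec_def sum_UNIV_Plus stack_def y_part_def)

lemma linear_stack_zero: "linear (stack 0 0 :: real^'n \<Rightarrow> real^('p::finite + ('q::finite + 'n::finite)))"
proof (rule linearI)
  fix a b :: "real^'n" and r :: real
  show "stack 0 0 (a + b) = stack 0 0 a + (stack 0 0 b :: real^('p + ('q + 'n)))"
    by (simp add: vec_eq_iff stack_def split: sum.split)
  show "stack 0 0 (r *\<^sub>R b) = r *\<^sub>R (stack 0 0 b :: real^('p + ('q + 'n)))"
    by (simp add: vec_eq_iff stack_def split: sum.split)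
qed

lemma bounded_linear_stack_zero:
  "bounded_linear (stack 0 0 :: real^'n \<Rightarrow> real^('p::finite + ('q::finite + 'n::finite)))"
  using linear_stack_zero by (simp add: linear_conv_bounded_linear)

lemma norm_stack_zero: "norm (stack 0 0 y :: real^('p::finite + ('q::finite + 'n::finite))) = norm y"
  using inner_stack_zero[of "stack 0 0 y :: real^('p + ('q + 'n))" y] by (simp add: norm_eq_sqrt_inner)

lemma y_part_axis [simp]: "y_part (axis (Inl i) a) = 0" "y_part (axis (Inr (Inl j)) a) = 0"
  by (simp_all add: y_part_def axis_def vec_eq_iff)

lemma zero_block_row_mult:
  "zero_block_row A *v (\<zeta> :: real^('p::finite + ('q::finite + 'ny::finite))) = A *v y_part \<zeta>"
proof -
  have "(zero_block_row A *v \<zeta>) $ a = (A *v y_part \<zeta>) $ a" for a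
    using inner_stack_zero[of \<zeta> "A $ a"]
    by (simp add: matrix_vector_mul_component zero_block_row_def inner_commute)
  then show ?thesis by (simp add: vec_eq_iff)
qed

lemma grad_Pair:
  fixes F :: "(real^'nx) \<times> (real^'ny) \<Rightarrow> real"
  assumes "F differentiable (at (u, y))"
  shows "grad_x F u y = fst (grad F (u, y))" "grad_y F u y = snd (grad F (u, y))"
    "((\<lambda>u. F (u, y)) has_derivative (\<lambda>d. d \<bullet> fst (grad F (u, y)))) (at u)"
    "((\<lambda>y. F (u, y)) has_derivative (\<lambda>d. d \<bullet> snd (grad F (u, y)))) (at y)"
proof -
  note D = has_derivative_grad[OF assms]
  have "((\<lambda>u. F (u, y)) has_derivative (\<lambda>d. (d, 0) \<bullet> grad F (u, y))) (at u)"
    by (rule has_derivative_compose[where f = "\<lambda>u. (u, y)" and g = F, OF _ D])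
      (intro derivative_intros)
  then show 1: "((\<lambda>u. F (u, y)) has_derivative (\<lambda>d. d \<bullet> fst (grad F (u, y)))) (at u)"
    by (simp add: inner_prod_def)
  then show "grad_x F u y = fst (grad F (u, y))" unfolding grad_x_def by (rule grad_eqI)
  have "((\<lambda>y. F (u, y)) has_derivative (\<lambda>d. (0, d) \<bullet> grad F (u, y))) (at y)"
    by (rule has_derivative_compose[where f = "\<lambda>y. (u, y)" and g = F, OF _ D])
      (intro derivative_intros)
  then show 2: "((\<lambda>y. F (u, y)) has_derivative (\<lambda>d. d \<bullet> snd (grad F (u, y)))) (at y)"
    by (simp add: inner_prod_def)
  then show "grad_y F u y = snd (grad F (u, y))" unfolding grad_y_def by (rule grad_eqI)
qed

lemma C2_onD:
  assumes "C2_on F S" "z \<in> S"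
  shows "F differentiable (at z)" "grad F differentiable (at z)"
    "\<forall>\<^sub>F w in nhds z. F differentiable (at w)"
    "hess F z d \<bullet> e = d \<bullet> hess F z e"
proof -
  from assms obtain V where V: "open V" "z \<in> V" "\<forall>z\<in>V. F differentiable (at z)"
    "\<forall>z\<in>V. grad F differentiable (at z)" unfolding C2_on_def by blast
  then show "F differentiable (at z)" "grad F differentiable (at z)" by auto
  show 1: "\<forall>\<^sub>F w in nhds z. F differentiable (at w)"
    using V by (auto simp: eventually_nhds)
  show "hess F z d \<bullet> e = d \<bullet> hess F z e"
    using V by (intro hess_selfadjoint[OF 1]) auto
qed

lemma differentiable_locally_lipschitz:
  fixes \<phi> :: "'a::real_normed_vector \<Rightarrow> 'b::real_normed_vector"
  assumes "\<phi> differentiable (at p)"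
  shows "\<exists>L\<ge>0. \<forall>\<^sub>F q in nhds p. norm (\<phi> q - \<phi> p) \<le> L * norm (q - p)"
proof -
  from assms obtain D where D: "(\<phi> has_derivative D) (at p)" unfolding differentiable_def by blast
  then obtain B where B: "B > 0" "\<And>x. norm (D x) \<le> norm x * B"
    using bounded_linear.pos_bounded[OF has_derivative_bounded_linear] by blast
  from D obtain \<delta> where \<delta>: "\<delta> > 0"
    "\<And>q. norm (q - p) < \<delta> \<Longrightarrow> norm (\<phi> q - \<phi> p - D (q - p)) \<le> 1 * norm (q - p)"
    unfolding has_derivative_at_alt using zero_less_one by blast
  have "norm (\<phi> q - \<phi> p) \<le> (B + 1) * norm (q - p)" if "dist q p < \<delta>" for q
  proof -
    have "norm (\<phi> q - \<phi> p) \<le> norm (\<phi> q - \<phi> p - D (q - p)) + norm (D (q - p))"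
      using norm_triangle_ineq[of "\<phi> q - \<phi> p - D (q - p)" "D (q - p)"] by simp
    also have "\<dots> \<le> 1 * norm (q - p) + norm (q - p) * B"
      using \<delta>(2)[of q] B(2)[of "q - p"] that by (intro add_mono) (auto simp: dist_norm)
    finally show ?thesis by (simp add: algebra_simps)
  qed
  then show ?thesis using B \<delta>(1) by (intro exI[of _ "B + 1"]) (auto simp: eventually_nhds_metric)
qed

section \<open>The value function\<close>

locale penalty_problem =
  fixes f g :: "(real^'nx) \<times> (real^'ny) \<Rightarrow> real"
    and X :: "(real^'nx) set" and Y :: "(real^'ny) set"
  assumes Y: "compact Y"
    and f_C2: "C2_on f (X \<times> Y)" and g_C2: "C2_on g (X \<times> Y)"
begin

abbreviation "T \<equiv> T_sol f g Y"
abbreviation "l \<equiv> l_val f g Y"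
abbreviation "W \<equiv> X \<times> {0::real..}"
abbreviation "lipschitz_T w \<equiv> locally_lipschitz_at (\<lambda>(u, s). T u s) W w"

lemma continuous_on_slice:
  assumes u: "u \<in> X"
  shows "continuous_on Y (\<lambda>y. f (u, y))" "continuous_on Y (\<lambda>y. g (u, y))"
    "continuous_on Y (\<lambda>y. h_pen f g s (u, y))"
proof -
  have *: "continuous_on Y (\<lambda>y. F (u, y))" if "C2_on F (X \<times> Y)" for F
  proof (rule continuous_at_imp_continuous_on, rule ballI)
    fix y assume "y \<in> Y"
    then have "F differentiable (at (u, y))" using C2_onD(1)[OF that] u by simp
    from has_derivative_continuous[OF grad_Pair(4)[OF this]] show "isCont (\<lambda>y. F (u, y)) y" .
  qed
  show 1: "continuous_on Y (\<lambda>y. f (u, y))" and 2: "continuous_on Y (\<lambda>y. g (u, y))"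
    using * f_C2 g_C2 by auto
  show "continuous_on Y (\<lambda>y. h_pen f g s (u, y))" unfolding h_pen_def
    by (intro continuous_intros 1 2)
qed

lemma T_iff: "y \<in> T u s \<longleftrightarrow> y \<in> Y \<and> (\<forall>y'\<in>Y. h_pen f g s (u, y) \<le> h_pen f g s (u, y'))"
  by (auto simp: T_sol_def is_arg_min_def not_less)

lemma T_nonempty: "u \<in> X \<Longrightarrow> Y \<noteq> {} \<Longrightarrow> T u s \<noteq> {}"
  using continuous_attains_inf[OF Y _ continuous_on_slice(3)] by (fastforce simp: T_iff)

lemma l_eq: "y \<in> T u s \<Longrightarrow> l u s = h_pen f g s (u, y)"
  unfolding l_val_def by (rule cInf_eq_minimum) (auto simp: T_iff)

lemma l_le: "u \<in> X \<Longrightarrow> y \<in> Y \<Longrightarrow> l u s \<le> h_pen f g s (u, y)"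
  using T_nonempty[of u s] l_eq[of _ u s] by (force simp: T_iff)

lemma compact_T:
  assumes u: "u \<in> X"
  shows "compact (T u s)"
proof (cases "Y = {}")
  case True
  then have "T u s = {}" using T_iff by blast
  then show ?thesis by simp
next
  case False
  from T_nonempty[OF u False] obtain y where y: "y \<in> T u s" by blast
  have "T u s = {y'\<in>Y. h_pen f g s (u, y') \<le> h_pen f g s (u, y)}"
    using y by (force simp: T_iff)
  moreover have "closed {y'\<in>Y. h_pen f g s (u, y') \<le> h_pen f g s (u, y)}"
    using continuous_closed_preimage[OF continuous_on_slice(3)[OF u, of s] compact_imp_closed[OF Y]
        closed_atMost[of "h_pen f g s (u, y)"]] by (simp add: vimage_def Int_def)
  ultimately show ?thesis using Y by (metis (no_types, lifting) closed_Int_compact compact_Int_closed inf.absorb_iff2 mem_Collect_eq subsetI)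
qed

text \<open>The Hausdorff distance dominates the distance from \<open>y\<close> to the solution set
  at \<open>w\<close>, and compactness of that set provides a nearest point.\<close>

lemma lipschitz_selection:
  assumes u: "u \<in> X" and lip: "lipschitz_T (u, s)" and y: "y \<in> T u s"
  shows "\<exists>r>0. \<exists>K\<ge>0. \<forall>w\<in>W. dist (u, s) w < r \<longrightarrow>
    (\<exists>y'\<in>T (fst w) (snd w). dist y y' \<le> K * dist (u, s) w)"
proof -
  from lip obtain r K where r: "r > 0" and K0: "\<forall>w'\<in>W \<inter> ball (u, s) r.
      hausdorff_distance (case (u, s) of (u, s) \<Rightarrow> T u s) (case w' of (u, s) \<Rightarrow> T u s) \<le> K * dist (u, s) w'"
    unfolding locally_lipschitz_at_def by blast
  have K: "hausdorff_distance (T u s) (T u' s') \<le> K * dist (u, s) (u', s')"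
    if "(u', s') \<in> W" "dist (u, s) (u', s') < r" for u' s'
    using K0[rule_format, of "(u', s')"] that by simp
  have "\<exists>y'\<in>T (fst w) (snd w). dist y y' \<le> \<bar>K\<bar> * dist (u, s) w"
    if w: "w \<in> W" "dist (u, s) w < r" for w
  proof -
    obtain u' s' where w': "w = (u', s')" by (cases w)
    have u': "u' \<in> X" using w w' by auto
    have ne: "T u' s' \<noteq> {}" using T_nonempty[OF u'] y by (auto simp: T_iff)
    from infdist_attains_inf[OF compact_imp_closed[OF compact_T[OF u', of s']] ne]
    obtain y' where y': "y' \<in> T u' s'" "infdist y (T u' s') = dist y y'" by blast
    \<comment> \<open>Boundedness is what makes the supremum in the Hausdorff distance dominate its
      entry at \<open>y\<close>.\<close>
    have "bdd_above ((\<lambda>a. infdist a (T u' s')) ` T u s)"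
      by (intro bounded_imp_bdd_above compact_imp_bounded compact_continuous_image
          continuous_on_infdist continuous_on_id compact_T u)
    from cSUP_upper[OF y this] have "dist y y' \<le> hausdorff_distance (T u s) (T u' s')"
      unfolding hausdorff_distance_def y'(2)[symmetric] by simp
    also have "\<dots> \<le> K * dist (u, s) w" using K[of u' s'] w w' by simp
    also have "\<dots> \<le> \<bar>K\<bar> * dist (u, s) w" by (intro mult_right_mono) auto
    finally show ?thesis using y' w' by auto
  qed
  then show ?thesis using r by (intro exI[of _ r] conjI exI[of _ "\<bar>K\<bar>"]) auto
qed

text \<open>The penalised objective with \<open>x\<close> and \<open>\<sigma>\<close> grouped into
  one parameter, the shape that the envelope lemma expects.\<close>

definition joint_h :: "((real^'nx) \<times> real) \<times> (real^'ny) \<Rightarrow> real" where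
  "joint_h p = snd (fst p) * f (fst (fst p), snd p) + g (fst (fst p), snd p)"

lemma joint_h_has_derivative:
  assumes u: "u \<in> X" and y: "y \<in> Y"
  shows "(joint_h has_derivative (\<lambda>p. s * ((fst (fst p), snd p) \<bullet> grad f (u, y)) + snd (fst p) * f (u, y)
     + (fst (fst p), snd p) \<bullet> grad g (u, y))) (at ((u, s), y))"
proof -
  have *: "((\<lambda>p. F (fst (fst p), snd p)) has_derivative (\<lambda>p. (fst (fst p), snd p) \<bullet> grad F (u, y))) (at ((u, s), y))"
    if "C2_on F (X \<times> Y)" for F
    by (rule has_derivative_compose[where g = F and f = "\<lambda>p. (fst (fst p), snd p)"])
      (auto intro!: derivative_eq_intros has_derivative_grad C2_onD(1)[OF that] simp: u y)
  show ?thesis unfolding joint_h_def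
    by (rule has_derivative_eq_rhs, rule has_derivative_add[OF has_derivative_mult[OF _ *[OF f_C2]] *[OF g_C2]])
      (auto intro!: derivative_eq_intros)
qed

text \<open>The envelope lemma applied to both parameters at once. Any minimiser \<open>y\<close>
  may be used, which is what later lets an arbitrary selection stand in for the solution
  set.\<close>

lemma value_has_derivative:
  assumes u: "u \<in> X" and lip: "lipschitz_T (u, s)" and y: "y \<in> T u s"
  shows "((\<lambda>w. l (fst w) (snd w)) has_derivative
    (\<lambda>d. fst d \<bullet> (s *\<^sub>R grad_x f u y + grad_x g u y) + snd d * f (u, y))) (at (u, s) within W)"
proof -
  have yY: "y \<in> Y" using y by (simp add: T_iff)
  from lipschitz_selection[OF u lip y] obtain r K where r: "r > 0"
    and K: "\<And>w. w \<in> W \<Longrightarrow> dist (u, s) w < r \<Longrightarrow> \<exists>y'\<in>T (fst w) (snd w). dist y y' \<le> K * dist (u, s) w"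
    by blast
  have "((\<lambda>w. l (fst w) (snd w)) has_derivative
     (\<lambda>d. (\<lambda>p. s * ((fst (fst p), snd p) \<bullet> grad f (u, y)) + snd (fst p) * f (u, y)
     + (fst (fst p), snd p) \<bullet> grad g (u, y)) (d, 0))) (at (u, s) within W)"
  proof (rule envelope_has_derivative[OF joint_h_has_derivative[OF u yY] _ r])
    show "l (fst (u, s)) (snd (u, s)) = joint_h ((u, s), y)"
      using l_eq[OF y] by (simp add: joint_h_def h_pen_def)
    fix w' assume w': "w' \<in> W" "dist (u, s) w' < r"
    from K[OF this] obtain y' where y': "y' \<in> T (fst w') (snd w')" "dist y y' \<le> K * dist (u, s) w'" by blast
    have "fst w' \<in> X" using w' by auto
    moreover have "y' \<in> Y" using y' by (simp add: T_iff)
    ultimately show "\<exists>y'. dist y y' \<le> K * dist (u, s) w' \<and> l (fst w') (snd w') = joint_h (w', y') \<and>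
        l (fst w') (snd w') \<le> joint_h (w', y) \<and> l (fst (u, s)) (snd (u, s)) \<le> joint_h ((u, s), y')"
      using y' l_eq[OF y'(1)] l_le[of "fst w'" y "snd w'"] l_le[of u y' s] u yY
      by (intro exI[of _ y']) (auto simp: joint_h_def h_pen_def)
  qed
  then show ?thesis
    using grad_Pair(1)[OF C2_onD(1)[OF f_C2]] grad_Pair(1)[OF C2_onD(1)[OF g_C2]] u yY
    by (simp add: inner_prod_def inner_add_right algebra_simps)
qed

lemma value_gradient:
  assumes u: "u \<in> X" and s: "s \<ge> 0" and lip: "lipschitz_T (u, s)" and y: "y \<in> T u s"
  shows "has_gradient_within (\<lambda>u. l u s) (s *\<^sub>R grad_x f u y + grad_x g u y) u X"
proof -
  have "((\<lambda>u. l (fst (u, s)) (snd (u, s))) has_derivative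
      (\<lambda>d. fst (d, 0::real) \<bullet> (s *\<^sub>R grad_x f u y + grad_x g u y) + snd (d, 0::real) * f (u, y))) (at u within X)"
    by (rule has_derivative_in_compose[where f = "\<lambda>u. (u, s)" and g = "\<lambda>w. l (fst w) (snd w)"])
      (intro derivative_intros, rule has_derivative_subset[OF value_has_derivative[OF u lip y]], use s in auto)
  then show ?thesis by (simp add: has_gradient_within_def)
qed

lemma value_dsigma:
  assumes u: "u \<in> X" and lip: "lipschitz_T (u, s)" and y: "y \<in> T u s"
  shows "(l u has_real_derivative f (u, y)) (at s within {0..})"
proof -
  have "((\<lambda>s. l (fst (u, s)) (snd (u, s))) has_derivative
      (\<lambda>d. fst (0::real^'nx, d) \<bullet> (s *\<^sub>R grad_x f u y + grad_x g u y) + snd (0::real^'nx, d) * f (u, y))) (at s within {0..})"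
    by (rule has_derivative_in_compose[where f = "\<lambda>s. (u, s)" and g = "\<lambda>w. l (fst w) (snd w)"])
      (intro derivative_intros, rule has_derivative_subset[OF value_has_derivative[OF u lip y]], use u in auto)
  then have "(l u has_derivative (\<lambda>d. d * f (u, y))) (at s within {0..})" by simp
  then show ?thesis unfolding has_field_derivative_def
    by (rule has_derivative_eq_rhs) (auto simp: fun_eq_iff)
qed

text \<open>A squeeze of the difference quotients at 0: from above by the point of
  \<open>T u 0\<close> with the least \<open>f\<close>, from below by minimisers at small
  \<open>s\<close>, which cluster in \<open>T u 0\<close>. A bare right derivative is the hypothesis
  because the claim on \<open>psi\<close> starts from the mixed derivatives alone.\<close>

lemma dsigma_zero_eq_psi:
  assumes u: "u \<in> X" and ne: "Y \<noteq> {}"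
    and D: "(l u has_real_derivative D) (at 0 within {0..})"
  shows "D = psi f g Y u"
proof -
  have sub: "T u 0 \<subseteq> Y" by (auto simp: T_iff)
  obtain y0 where y0: "y0 \<in> T u 0" and y0_min: "\<And>y. y \<in> T u 0 \<Longrightarrow> f (u, y0) \<le> f (u, y)"
    using continuous_attains_inf[OF compact_T[OF u] T_nonempty[OF u ne]
        continuous_on_subset[OF continuous_on_slice(1)[OF u] sub]] by blast
  have psi: "psi f g Y u = f (u, y0)"
    unfolding psi_def by (rule cInf_eq_minimum) (use y0 y0_min in auto)
  define s where "s n = 1 / real (Suc n)" for n
  have s: "s n > 0" for n by (simp add: s_def)
  have s0: "s \<longlonglongrightarrow> 0" unfolding s_def by (rule LIMSEQ_Suc[OF lim_1_over_n])
  have "filterlim s (at 0 within {0..}) sequentially"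
    unfolding filterlim_at using s0 s by (auto intro!: always_eventually less_imp_le simp: less_imp_neq[symmetric])
  with D have q: "(\<lambda>n. (l u (s n) - l u 0) / s n) \<longlonglongrightarrow> D"
    unfolding has_field_derivative_iff by (auto dest: filterlim_compose)
  have "\<forall>n. \<exists>y. y \<in> T u (s n)" using T_nonempty[OF u ne] by blast
  then obtain y where y: "\<And>n. y n \<in> T u (s n)" by metis
  have yY: "y n \<in> Y" for n using y[of n] by (simp add: T_iff)
  obtain yb r where yb: "yb \<in> Y" and r: "strict_mono r" and lim: "(y \<circ> r) \<longlonglongrightarrow> yb"
    using Y yY unfolding compact_def by meson
  have sr: "(s \<circ> r) \<longlonglongrightarrow> 0" using LIMSEQ_subseq_LIMSEQ[OF s0 r] .
  have cont: "(\<lambda>n. F (u, y (r n))) \<longlonglongrightarrow> F (u, yb)" if "continuous_on Y (\<lambda>y. F (u, y))" for F :: "_ \<Rightarrow> real"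
    using continuous_on_tendsto_compose[OF that lim yb] yY by (simp add: o_def)
  note flim = cont[OF continuous_on_slice(1)[OF u]] and glim = cont[OF continuous_on_slice(2)[OF u]]
  \<comment> \<open>The penalty term vanishes in the limit because \<open>s\<close> tends to 0 while
    \<open>f\<close> converges along the subsequence, so a limit of minimisers minimises
    \<open>g\<close>.\<close>
  have "yb \<in> T u 0"
  proof -
    have "g (u, yb) \<le> g (u, y')" if y': "y' \<in> Y" for y'
    proof (rule tendsto_le[OF sequentially_bot])
      have "(\<lambda>n. (s \<circ> r) n * f (u, y') + g (u, y')) \<longlonglongrightarrow> 0 * f (u, y') + g (u, y')"
        by (intro tendsto_intros sr)
      then show "(\<lambda>n. (s \<circ> r) n * f (u, y') + g (u, y')) \<longlonglongrightarrow> g (u, y')" by simp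
      have "(\<lambda>n. (s \<circ> r) n * f (u, y (r n)) + g (u, y (r n))) \<longlonglongrightarrow> 0 * f (u, yb) + g (u, yb)"
        by (intro tendsto_intros sr flim glim)
      then show "(\<lambda>n. (s \<circ> r) n * f (u, y (r n)) + g (u, y (r n))) \<longlonglongrightarrow> g (u, yb)" by simp
      show "\<forall>\<^sub>F n in sequentially. (s \<circ> r) n * f (u, y (r n)) + g (u, y (r n))
          \<le> (s \<circ> r) n * f (u, y') + g (u, y')"
        using y y' by (intro always_eventually) (auto simp: T_iff h_pen_def)
    qed
    then show ?thesis using yb by (simp add: T_iff h_pen_def)
  qed
  then have "psi f g Y u \<le> f (u, yb)" using y0_min psi by simp
  also have "f (u, yb) \<le> D"
  proof (rule tendsto_le[OF sequentially_bot LIMSEQ_subseq_LIMSEQ[OF q r] flim], rule always_eventually, rule allI)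
    fix n
    have "l u (s (r n)) = s (r n) * f (u, y (r n)) + g (u, y (r n))"
      using l_eq[OF y] by (simp add: h_pen_def)
    \<comment> \<open>\<open>y (r n)\<close> is optimal at \<open>s (r n)\<close> but merely a
      competitor at 0; hence the quotient is at least its value of \<open>f\<close>.\<close>
    moreover have "l u 0 \<le> g (u, y (r n))" using l_le[OF u yY, of 0] by (simp add: h_pen_def)
    ultimately show "f (u, y (r n)) \<le> ((\<lambda>n. (l u (s n) - l u 0) / s n) \<circ> r) n"
      using s[of "r n"] by (simp add: field_simps)
  qed
  finally have 1: "psi f g Y u \<le> D" .
  have "D \<le> f (u, y0)"
  proof (rule tendsto_upperbound[OF q _ sequentially_bot], rule always_eventually, rule allI)
    fix n
    have "l u (s n) \<le> s n * f (u, y0) + g (u, y0)"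
      using l_le[OF u, of y0 "s n"] y0 by (simp add: T_iff h_pen_def)
    moreover have "l u 0 = g (u, y0)" using l_eq[OF y0] by (simp add: h_pen_def)
    ultimately show "(l u (s n) - l u 0) / s n \<le> f (u, y0)"
      using s[of n] by (simp add: field_simps)
  qed
  with 1 psi show ?thesis by simp
qed

end

section \<open>The KKT system along the solution map\<close>

lemma norm_y_part_le:
  fixes z :: "real^('p::finite + ('q::finite + 'n::finite))"
  shows "norm (y_part z) \<le> norm z"
proof (cases "y_part z = 0")
  case False
  have "norm (y_part z) * norm (y_part z) = z \<bullet> stack 0 0 (y_part z)"
    by (simp add: inner_stack_zero norm_eq_sqrt_inner)
  also have "\<dots> \<le> norm z * norm (y_part z)"
    using norm_cauchy_schwarz[of z "stack 0 0 (y_part z)"] by (simp add: norm_stack_zero)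
  finally show ?thesis using False by simp
qed simp

lemma independent_family_mono:
  assumes "independent_family K a" "J \<subseteq> K" "finite K"
  shows "independent_family J a"
  unfolding independent_family_def
proof (intro allI impI)
  fix c assume c: "(\<Sum>k\<in>J. c k *\<^sub>R a k) = 0"
  define c' where "c' k = (if k \<in> J then c k else 0)" for k
  have "(\<Sum>k\<in>K. c' k *\<^sub>R a k) = (\<Sum>k\<in>J. c' k *\<^sub>R a k)"
    using assms by (intro sum.mono_neutral_right) (auto simp: c'_def)
  also have "\<dots> = (\<Sum>k\<in>J. c k *\<^sub>R a k)" by (intro sum.cong) (auto simp: c'_def)
  finally have "(\<Sum>k\<in>K. c' k *\<^sub>R a k) = 0" using c by simp
  then have "\<forall>k\<in>K. c' k = 0" using assms(1) unfolding independent_family_def by blast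
  then have "\<forall>k\<in>J. c' k = 0" using assms(2) by blast
  then show "\<forall>k\<in>J. c k = 0" by (simp add: c'_def)
qed

text \<open>Here \<open>\<rho>\<close> is a radius within which the solution map is Lipschitz at
  every point: a second derivative needs the first derivatives of \<open>l\<close> at nearby
  parameters too, and these come from the Lipschitz property there.\<close>

locale regular_solution = penalty_problem f g X Y
  for f g :: "(real^'nx) \<times> (real^'ny) \<Rightarrow> real" and X Y +
  fixes P :: "'p::finite set" and gc :: "'p \<Rightarrow> real^'ny \<Rightarrow> real"
    and Q :: "'q::finite set" and hc :: "'q \<Rightarrow> real^'ny \<Rightarrow> real"
    and x :: "real^'nx" and \<sigma> \<rho> :: real and y :: "real^'ny"
    and lam :: "real^'p" and nu :: "real^'q"
  assumes X_convex: "convex X"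
    and Y_def: "Y = {y. (\<forall>i\<in>P. gc i y \<le> 0) \<and> (\<forall>j\<in>Q. hc j y = 0)}"
    and gc_C2: "\<And>i. i \<in> P \<Longrightarrow> C2_on (gc i) UNIV"
    and hc_affine: "\<And>j. j \<in> Q \<Longrightarrow> \<exists>a b. \<forall>y. hc j y = a \<bullet> y + b"
    and x: "x \<in> X" and \<sigma>: "\<sigma> \<ge> 0" and \<rho>: "\<rho> > 0"
    and lip: "\<And>w. w \<in> W \<Longrightarrow> dist (x, \<sigma>) w < \<rho> \<Longrightarrow> lipschitz_T w"
    and yT: "y \<in> T x \<sigma>"
    and licq: "LICQ P gc Q hc y"
    and kkt: "KKT_multipliers (h_pen f g \<sigma>) P gc Q hc x y lam nu"
    and strict: "strict_complementarity P gc y lam"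
begin

abbreviation "I \<equiv> active_set P gc y"
abbreviation "z0 \<equiv> stack lam nu y"
abbreviation "L \<equiv> lagrangian (h_pen f g \<sigma>) I gc Q hc x"
abbreviation "M \<equiv> hess_lagrangian (h_pen f g \<sigma>) I gc Q hc x z0"
abbreviation "A \<equiv> hess_xy (h_pen f g \<sigma>) x y"

text \<open>Near the points of interest this is the gradient of \<open>h_pen\<close> in the lower
  variable, written through joint gradients so that it can also be differentiated in the parameters.
  It is unrelated to the function \<open>psi\<close>.\<close>

definition \<psi> :: "((real^'nx) \<times> real) \<times> (real^'ny) \<Rightarrow> real^'ny" where
  "\<psi> p = snd (fst p) *\<^sub>R snd (grad f (fst (fst p), snd p)) + snd (grad g (fst (fst p), snd p))"

text \<open>The gradient of the Lagrangian in the stacked variable, written out with the active set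
  frozen at \<open>I\<close> and the parameters left free. Coordinates outside \<open>I\<close> and
  \<open>Q\<close> carry the trivial equation.\<close>

definition residual :: "((real^'nx) \<times> real) \<times> (real^('p + ('q + 'ny))) \<Rightarrow> real^('p + ('q + 'ny))" where
  "residual p =
    (\<Sum>i\<in>I. gc i (y_part (snd p)) *\<^sub>R axis (Inl i) 1) +
    (\<Sum>j\<in>Q. hc j (y_part (snd p)) *\<^sub>R axis (Inr (Inl j)) 1) +
    stack 0 0 (\<psi> (fst p, y_part (snd p))
      + (\<Sum>i\<in>I. (snd p $ Inl i) *\<^sub>R grad (gc i) (y_part (snd p)))
      + (\<Sum>j\<in>Q. (snd p $ Inr (Inl j)) *\<^sub>R grad (hc j) (y_part (snd p))))"

lemma yY: "y \<in> Y" using yT by (simp add: T_iff)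

lemma xyXY: "(x, y) \<in> X \<times> Y" using x yY by simp

lemma I_P: "i \<in> I \<Longrightarrow> i \<in> P" by (simp add: active_set_def)

lemma gc_differentiable:
  assumes "i \<in> P"
  shows "gc i differentiable (at y')" "grad (gc i) differentiable (at y')"
  using C2_onD[OF gc_C2[OF assms]] by auto

lemma hc_differentiable:
  assumes "j \<in> Q"
  shows "hc j differentiable (at y')" "grad (hc j) differentiable (at y')"
proof -
  from hc_affine[OF assms] obtain a b where "\<forall>y. hc j y = a \<bullet> y + b" by blast
  then have eq: "hc j = (\<lambda>y. a \<bullet> y + b)" by blast
  have D: "(hc j has_derivative (\<lambda>d. d \<bullet> a)) (at y')" for y'
    unfolding eq by (auto intro!: derivative_eq_intros simp: inner_commute)
  then show "hc j differentiable (at y')" unfolding differentiable_def by blast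
  have "grad (hc j) = (\<lambda>_. a)" using grad_eqI[OF D] by blast
  then show "grad (hc j) differentiable (at y')" by simp
qed

lemma differentiable_y_part_compose:
  assumes "F differentiable (at (y_part (snd p)))"
  shows "(\<lambda>p. F (y_part (snd p))) differentiable (at p)"
  by (rule differentiable_compose[where g = "\<lambda>p. y_part (snd p)" and f = F])
    (use assms in \<open>auto intro!: bounded_linear_imp_differentiable
      bounded_linear_compose[OF bounded_linear_y_part] bounded_linear_snd\<close>)

lemma \<psi>_differentiable: "\<psi> differentiable (at ((x, \<sigma>), y))"
proof -
  have bl: "bounded_linear (\<lambda>p. (fst (fst p), snd p))"
    by (intro bounded_linear_Pair bounded_linear_compose[OF bounded_linear_fst]
        bounded_linear_fst bounded_linear_snd)
  have *: "(\<lambda>p. snd (grad F (fst (fst p), snd p))) differentiable (at ((x, \<sigma>), y))"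
    if "C2_on F (X \<times> Y)" for F
  proof -
    have "(\<lambda>p. grad F (fst (fst p), snd p)) differentiable (at ((x, \<sigma>), y))"
      by (rule differentiable_compose[where f = "grad F"])
        (use C2_onD(2)[OF that xyXY] bounded_linear_imp_differentiable[OF bl] in auto)
    from differentiable_compose[OF bounded_linear_imp_differentiable[OF bounded_linear_snd] this]
    show ?thesis .
  qed
  have "(\<lambda>p. snd (fst p)) differentiable (at ((x, \<sigma>), y))"
    by (intro bounded_linear_imp_differentiable bounded_linear_compose[OF bounded_linear_snd] bounded_linear_fst)
  then show ?thesis unfolding \<psi>_def
    by (intro differentiable_add differentiable_scaleR *[OF f_C2] *[OF g_C2])
qed

lemma residual_differentiable: "residual differentiable (at ((x, \<sigma>), z0))"
proof -
  have comp: "(\<lambda>p. snd p $ k) differentiable (at q)"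
    for k and q :: "((real^'nx) \<times> real) \<times> (real^('p + ('q + 'ny)))"
    by (intro bounded_linear_imp_differentiable bounded_linear_compose[OF bounded_linear_vec_nth] bounded_linear_snd)
  have bl: "bounded_linear (\<lambda>p::((real^'nx) \<times> real) \<times> (real^('p + ('q + 'ny))). (fst p, y_part (snd p)))"
    by (intro bounded_linear_Pair bounded_linear_compose[OF bounded_linear_y_part] bounded_linear_fst bounded_linear_snd)
  have \<psi>: "(\<lambda>p. \<psi> (fst p, y_part (snd p))) differentiable (at ((x, \<sigma>), z0))"
    by (rule differentiable_compose[where f = \<psi> and g = "\<lambda>p. (fst p, y_part (snd p))",
        OF _ bounded_linear_imp_differentiable[OF bl]]) (use \<psi>_differentiable in simp)
  have c: "(\<lambda>p. gc i (y_part (snd p))) differentiable (at q)"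
    "(\<lambda>p. grad (gc i) (y_part (snd p))) differentiable (at q)" if "i \<in> I"
    for i and q :: "((real^'nx) \<times> real) \<times> (real^('p + ('q + 'ny)))"
    by (rule differentiable_y_part_compose, rule gc_differentiable[OF I_P[OF that]])+
  have d: "(\<lambda>p. hc j (y_part (snd p))) differentiable (at q)"
    "(\<lambda>p. grad (hc j) (y_part (snd p))) differentiable (at q)" if "j \<in> Q"
    for j and q :: "((real^'nx) \<times> real) \<times> (real^('p + ('q + 'ny)))"
    by (rule differentiable_y_part_compose, rule hc_differentiable[OF that])+
  have stack: "(\<lambda>p. stack 0 0 (F p) :: real^('p + ('q + 'ny))) differentiable (at q)"
    if "F differentiable (at q)"
    for F and q :: "((real^'nx) \<times> real) \<times> (real^('p + ('q + 'ny)))"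
    by (rule differentiable_compose[where f = "stack 0 0", OF bounded_linear_imp_differentiable[OF bounded_linear_stack_zero] that])
  show ?thesis unfolding residual_def
    by (intro differentiable_add differentiable_sum differentiable_scaleR ballI stack comp \<psi> c d
        differentiable_const) auto
qed

lemma h_pen_y_derivative:
  assumes "f differentiable (at (u, v))" "g differentiable (at (u, v))"
  shows "((\<lambda>v. h_pen f g s (u, v)) has_derivative (\<lambda>d. d \<bullet> \<psi> ((u, s), v))) (at v)"
  unfolding h_pen_def \<psi>_def
  by (rule has_derivative_eq_rhs, rule has_derivative_add[OF has_derivative_mult_right])
    (auto intro: grad_Pair(4)[OF assms(1)] grad_Pair(4)[OF assms(2)] simp: inner_add_right)

lemma L_has_derivative:
  assumes "f differentiable (at (x, y_part z))" "g differentiable (at (x, y_part z))"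
  shows "(L has_derivative (\<lambda>d. d \<bullet> residual ((x, \<sigma>), z))) (at z)"
proof -
  have 1: "((\<lambda>z. F (y_part z)) has_derivative (\<lambda>d. y_part d \<bullet> v)) (at z)"
    if "(F has_derivative (\<lambda>d. d \<bullet> v)) (at (y_part z))" for F :: "real^'ny \<Rightarrow> real" and v
    by (rule has_derivative_compose[where g = F and f = y_part, OF _ that])
      (intro bounded_linear_imp_has_derivative bounded_linear_y_part)
  have 2: "((\<lambda>z. z $ k) has_derivative (\<lambda>d. d $ k)) (at z)" for k
    by (intro bounded_linear_imp_has_derivative bounded_linear_vec_nth)
  have 3: "((\<lambda>z. z $ k * F (y_part z)) has_derivative
      (\<lambda>d. z $ k * (y_part d \<bullet> grad F (y_part z)) + d $ k * F (y_part z))) (at z)"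
    if "F differentiable (at (y_part z))" for F k
    by (rule has_derivative_mult[OF 2 1[OF has_derivative_grad[OF that]]])
  have "(L has_derivative (\<lambda>d. y_part d \<bullet> \<psi> ((x, \<sigma>), y_part z)
      + (\<Sum>i\<in>I. z $ Inl i * (y_part d \<bullet> grad (gc i) (y_part z)) + d $ Inl i * gc i (y_part z))
      + (\<Sum>j\<in>Q. z $ Inr (Inl j) * (y_part d \<bullet> grad (hc j) (y_part z)) + d $ Inr (Inl j) * hc j (y_part z)))) (at z)"
    unfolding lagrangian_def
    by (intro has_derivative_add has_derivative_sum 1 3 h_pen_y_derivative assms
        gc_differentiable hc_differentiable) (auto dest: I_P)
  then show ?thesis
    by (rule has_derivative_eq_rhs)
      (simp add: fun_eq_iff residual_def inner_add_right inner_sum_right inner_stack_zero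
        inner_axis sum.distrib mult.commute)
qed

text \<open>A whole neighbourhood is needed, since this identity is differentiated once more to
  recognise the Hessian of the Lagrangian in the derivative of \<open>residual\<close>.\<close>

lemma eventually_L_gradient:
  "\<forall>\<^sub>F z in nhds z0. L differentiable (at z) \<and> grad L z = residual ((x, \<sigma>), z)"
proof -
  have "((\<lambda>z. (x, y_part z)) \<longlongrightarrow> (x, y_part z0)) (nhds z0)"
    using linear_continuous_at[OF bounded_linear_y_part, of z0]
    unfolding isCont_def tendsto_at_iff_tendsto_nhds by (intro tendsto_Pair tendsto_const)
  then have lim: "filterlim (\<lambda>z. (x, y_part z)) (nhds (x, y)) (nhds z0)" by simp
  have "\<forall>\<^sub>F z in nhds z0. f differentiable (at (x, y_part z))"
    using eventually_compose_filterlim[OF C2_onD(3)[OF f_C2 xyXY] lim] .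
  moreover have "\<forall>\<^sub>F z in nhds z0. g differentiable (at (x, y_part z))"
    using eventually_compose_filterlim[OF C2_onD(3)[OF g_C2 xyXY] lim] .
  ultimately show ?thesis
  proof eventually_elim
    case (elim z)
    from L_has_derivative[OF this] show ?case
      using grad_eqI unfolding differentiable_def by blast
  qed
qed

definition N :: "(real^'nx) \<times> real \<Rightarrow> real^('p + ('q + 'ny))" where
  "N d = stack 0 0 (snd d *\<^sub>R grad_y f x y +
    snd (\<sigma> *\<^sub>R hess f (x, y) (fst d, 0) + hess g (x, y) (fst d, 0)))"

text \<open>Differentiability of \<open>residual\<close> is known abstractly; the derivative is then
  identified on two slices. Fixing the parameters gives the Hessian of the Lagrangian, fixing
  \<open>z0\<close> gives \<open>N\<close>.\<close>

lemma residual_derivative_parts: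
  assumes R: "(residual has_derivative R) (at ((x, \<sigma>), z0))"
  shows "R (d, e) = N d + M *v e" and "linear N"
    and "grad L differentiable (at z0)"
proof -
  have lin: "linear R" using R by (rule has_derivative_linear)
  have z: "((\<lambda>z. residual ((x, \<sigma>), z)) has_derivative (\<lambda>e. R (0, e))) (at z0)"
    by (rule has_derivative_compose[where g = residual and f = "\<lambda>z. ((x, \<sigma>), z)", OF _ R])
      (intro derivative_intros)
  have D: "(grad L has_derivative (\<lambda>e. R (0, e))) (at z0)"
    by (rule has_derivative_transform_eventually[OF z])
      (use eventually_L_gradient eventually_nhds_x_imp_x[OF eventually_L_gradient]
        in \<open>auto simp: eventually_at_filter elim: eventually_mono\<close>)
  then show "grad L differentiable (at z0)" unfolding differentiable_def by blast
  have hess: "hess L z0 = (\<lambda>e. R (0, e))"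
    unfolding hess_def by (rule frechet_derivative_at[OF D, symmetric])
  have "bounded_linear (\<lambda>e. R (0, e))" using z by (rule has_derivative_bounded_linear)
  then have Me: "M *v e = R (0, e)" for e
    unfolding hess_lagrangian_def hess by simp
  have w: "((\<lambda>w. residual (w, z0)) has_derivative (\<lambda>d. R (d, 0))) (at (x, \<sigma>))"
    by (rule has_derivative_compose[where g = residual and f = "\<lambda>w. (w, z0)", OF _ R])
      (intro derivative_intros)
  have \<psi>w: "((\<lambda>w. snd w *\<^sub>R snd (grad f (fst w, y)) + snd (grad g (fst w, y))) has_derivative
      (\<lambda>d. (\<sigma> *\<^sub>R snd (hess f (x, y) (fst d, 0)) + snd d *\<^sub>R snd (grad f (x, y)))
        + snd (hess g (x, y) (fst d, 0)))) (at (x, \<sigma>))"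
  proof -
    have *: "((\<lambda>w. snd (grad F (fst w, y))) has_derivative (\<lambda>d. snd (hess F (x, y) (fst d, 0)))) (at (x, \<sigma>))"
      if "C2_on F (X \<times> Y)" for F
    proof -
      have "((\<lambda>w. grad F (fst w, y)) has_derivative (\<lambda>d. hess F (x, y) (fst d, 0))) (at (x, \<sigma>))"
        by (rule has_derivative_compose[where g = "grad F" and f = "\<lambda>w. (fst w, y)"])
          (auto intro!: derivative_eq_intros has_derivative_hess C2_onD(2)[OF that xyXY])
      then show ?thesis by (rule has_derivative_snd)
    qed
    show ?thesis
      by (rule has_derivative_eq_rhs, rule has_derivative_add[OF has_derivative_scaleR[OF _ *[OF f_C2]] *[OF g_C2]])
        (auto intro!: derivative_eq_intros)
  qed
  have "((\<lambda>w. residual (w, z0)) has_derivative N) (at (x, \<sigma>))"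
  proof -
    define c1 :: "real^('p + ('q + 'ny))" where "c1 = (\<Sum>i\<in>I. gc i y *\<^sub>R axis (Inl i) 1) + (\<Sum>j\<in>Q. hc j y *\<^sub>R axis (Inr (Inl j)) 1)"
    define c2 where "c2 = (\<Sum>i\<in>I. (lam $ i) *\<^sub>R grad (gc i) y) + (\<Sum>j\<in>Q. (nu $ j) *\<^sub>R grad (hc j) y)"
    have eq: "(\<lambda>w. residual (w, z0)) = (\<lambda>w. c1 + stack 0 0
        ((snd w *\<^sub>R snd (grad f (fst w, y)) + snd (grad g (fst w, y))) + c2))"
      by (simp add: residual_def \<psi>_def c1_def c2_def add.assoc)
    have "((\<lambda>w. c1 + stack 0 0
        ((snd w *\<^sub>R snd (grad f (fst w, y)) + snd (grad g (fst w, y))) + c2)) has_derivative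
      (\<lambda>d. stack 0 0 ((\<sigma> *\<^sub>R snd (hess f (x, y) (fst d, 0)) + snd d *\<^sub>R snd (grad f (x, y)))
        + snd (hess g (x, y) (fst d, 0))))) (at (x, \<sigma>))"
      by (rule has_derivative_eq_rhs, rule has_derivative_add[OF has_derivative_const
          bounded_linear.has_derivative[OF bounded_linear_stack_zero has_derivative_add[OF \<psi>w has_derivative_const]]]) simp
    then show ?thesis unfolding eq
      by (rule has_derivative_eq_rhs)
        (simp add: N_def fun_eq_iff grad_Pair(2)[OF C2_onD(1)[OF f_C2 xyXY]] add_ac)
  qed
  from has_derivative_linear[OF this] show "linear N" .
  from has_derivative_unique[OF \<open>((\<lambda>w. residual (w, z0)) has_derivative N) (at (x, \<sigma>))\<close> w]
  have Nd: "N d = R (d, 0)" for d by simp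
  show "R (d, e) = N d + M *v e"
    using linear_add[OF lin, of "(d, 0)" "(0, e)"] by (simp add: Nd Me)
qed

lemma residual_has_derivative:
  "(residual has_derivative (\<lambda>(d, e). N d + M *v e)) (at ((x, \<sigma>), z0))"
  and linear_N: "linear N"
  and M_selfadjoint: "(M *v a) \<bullet> b = a \<bullet> (M *v b)"
proof -
  from residual_differentiable obtain R where R: "(residual has_derivative R) (at ((x, \<sigma>), z0))"
    unfolding differentiable_def by blast
  have "R = (\<lambda>(d, e). N d + M *v e)" using residual_derivative_parts(1)[OF R] by auto
  then show "(residual has_derivative (\<lambda>(d, e). N d + M *v e)) (at ((x, \<sigma>), z0))" using R by simp
  show "linear N" by (rule residual_derivative_parts(2)[OF R])
  note dL = residual_derivative_parts(3)[OF R]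
  have ev: "\<forall>\<^sub>F z in nhds z0. L differentiable (at z)"
    using eventually_L_gradient by (rule eventually_mono) simp
  have "linear (hess L z0)" using has_derivative_hess[OF dL] by (rule has_derivative_linear)
  then have "M *v e = hess L z0 e" for e unfolding hess_lagrangian_def by simp
  then show "(M *v a) \<bullet> b = a \<bullet> (M *v b)" using hess_selfadjoint[OF ev dL] by simp
qed

lemma grad_x_h_pen:
  assumes "f differentiable (at (u, v))" "g differentiable (at (u, v))"
  shows "grad_x (h_pen f g s) u v = fst (s *\<^sub>R grad f (u, v) + grad g (u, v))"
proof -
  have "((\<lambda>u. h_pen f g s (u, v)) has_derivative (\<lambda>d. d \<bullet> fst (s *\<^sub>R grad f (u, v) + grad g (u, v)))) (at u)"
    unfolding h_pen_def
    by (rule has_derivative_eq_rhs, rule has_derivative_add[OF has_derivative_mult_right])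
      (auto intro: grad_Pair(3)[OF assms(1)] grad_Pair(3)[OF assms(2)] simp: inner_add_right)
  then show ?thesis unfolding grad_x_def by (rule grad_eqI)
qed

lemma hess_xy_mult:
  "A *v \<eta> = fst (\<sigma> *\<^sub>R hess f (x, y) (0, \<eta>) + hess g (x, y) (0, \<eta>))"
proof -
  have *: "((\<lambda>v. grad F (x, v)) has_derivative (\<lambda>d. hess F (x, y) (0, d))) (at y)"
    if "C2_on F (X \<times> Y)" for F
    by (rule has_derivative_compose[where g = "grad F" and f = "\<lambda>v. (x, v)"])
      (auto intro!: derivative_eq_intros has_derivative_hess C2_onD(2)[OF that xyXY])
  have D: "((\<lambda>v. fst (\<sigma> *\<^sub>R grad f (x, v) + grad g (x, v))) has_derivative
      (\<lambda>\<eta>. fst (\<sigma> *\<^sub>R hess f (x, y) (0, \<eta>) + hess g (x, y) (0, \<eta>)))) (at y)"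
    by (intro has_derivative_fst has_derivative_add has_derivative_scaleR_right * f_C2 g_C2)
  have lim: "filterlim (\<lambda>v. (x, v)) (nhds (x, y)) (nhds y)"
    by (intro tendsto_Pair tendsto_const filterlim_ident)
  have "\<forall>\<^sub>F v in nhds y. f differentiable (at (x, v))" "\<forall>\<^sub>F v in nhds y. g differentiable (at (x, v))"
    using eventually_compose_filterlim[OF C2_onD(3)[OF f_C2 xyXY] lim]
      eventually_compose_filterlim[OF C2_onD(3)[OF g_C2 xyXY] lim] by auto
  then have ev: "\<forall>\<^sub>F v in nhds y. fst (\<sigma> *\<^sub>R grad f (x, v) + grad g (x, v)) = grad_x (h_pen f g \<sigma>) x v"
    by eventually_elim (rule grad_x_h_pen[symmetric])
  have "((\<lambda>v. grad_x (h_pen f g \<sigma>) x v) has_derivative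
      (\<lambda>\<eta>. fst (\<sigma> *\<^sub>R hess f (x, y) (0, \<eta>) + hess g (x, y) (0, \<eta>)))) (at y)"
    by (rule has_derivative_transform_eventually[OF D])
      (use ev eventually_nhds_x_imp_x[OF ev] in \<open>auto simp: eventually_at_filter elim: eventually_mono\<close>)
  note frechet_derivative_at[OF this, symmetric] has_derivative_bounded_linear[OF this]
  then show "A *v \<eta> = fst (\<sigma> *\<^sub>R hess f (x, y) (0, \<eta>) + hess g (x, y) (0, \<eta>))"
    unfolding hess_xy_def by simp
qed

text \<open>Symmetry of the joint Hessians of \<open>f\<close> and \<open>g\<close> exchanges the
  two off-diagonal blocks.\<close>

lemma N_inner: "N (d, 0) \<bullet> \<zeta> = d \<bullet> (A *v y_part \<zeta>)"
proof -
  have *: "snd (hess F (x, y) (d, 0)) \<bullet> \<eta> = d \<bullet> fst (hess F (x, y) (0, \<eta>))"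
    if "C2_on F (X \<times> Y)" for F and \<eta> :: "real^'ny"
    using C2_onD(4)[OF that xyXY, of "(d, 0)" "(0, \<eta>)"] by (simp add: inner_prod_def)
  have "N (d, 0) \<bullet> \<zeta> = y_part \<zeta> \<bullet> snd (\<sigma> *\<^sub>R hess f (x, y) (d, 0) + hess g (x, y) (d, 0))"
    by (simp add: N_def inner_commute[of "stack 0 0 _"] inner_stack_zero)
  also have "\<dots> = d \<bullet> (A *v y_part \<zeta>)"
    unfolding hess_xy_mult using *[OF f_C2] *[OF g_C2]
    by (simp add: inner_add_right inner_commute[of "y_part \<zeta>"])
  finally show ?thesis .
qed

end

section \<open>Lipschitz selection of KKT points with a frozen active set\<close>

context regular_solution
begin

lemma active_set_subset_nearby: "\<forall>\<^sub>F y' in nhds y. active_set P gc y' \<subseteq> I"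
proof -
  have "\<forall>\<^sub>F y' in nhds y. \<forall>i\<in>P - I. gc i y' < 0"
  proof (intro eventually_ball_finite ballI)
    fix i assume i: "i \<in> P - I"
    then have "gc i y \<le> 0" "gc i y \<noteq> 0" using yY unfolding Y_def active_set_def by auto
    then have "gc i y < 0" by simp
    moreover have "(gc i \<longlongrightarrow> gc i y) (nhds y)"
      using differentiable_imp_continuous_within[OF gc_differentiable(1)[of i y]] i
      unfolding continuous_at tendsto_at_iff_tendsto_nhds by auto
    ultimately show "\<forall>\<^sub>F y' in nhds y. gc i y' < 0" by (rule order_tendstoD(2)[rotated])
  qed simp
  then show ?thesis
  proof eventually_elim
    case (elim y')
    then show ?case unfolding active_set_def by force
  qed
qed

lemma KKT_point_selection:
  "\<exists>C r. r > 0 \<and> (\<forall>w\<in>W. dist (x, \<sigma>) w < r \<longrightarrow>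
    (\<exists>z. y_part z \<in> T (fst w) (snd w) \<and> residual (w, z) = 0 \<and> norm (z - z0) \<le> C * norm (w - (x, \<sigma>))))"
proof -
  define K where "K = I <+> Q"
  define a where "a k y' = case_sum (\<lambda>i. grad (gc i) y') (\<lambda>j. grad (hc j) y') k" for k y'
  define \<mu> where "\<mu> k = case_sum (\<lambda>i. lam $ i) (\<lambda>j. nu $ j) k" for k
  have finK: "finite K" by (simp add: K_def)
  have KI: "\<And>i. i \<in> I \<Longrightarrow> Inl i \<in> K" "\<And>j. j \<in> Q \<Longrightarrow> Inr j \<in> K" by (auto simp: K_def)
  have sumK: "(\<Sum>k\<in>K. F k) = (\<Sum>i\<in>I. F (Inl i)) + (\<Sum>j\<in>Q. F (Inr j))" for F :: "'p + 'q \<Rightarrow> 'c::comm_monoid_add"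
    by (simp add: K_def sum.Plus)
  have a_diff: "a k differentiable (at y)" if k: "k \<in> K" for k
  proof (cases k)
    case (Inl i)
    then have "i \<in> P" using k I_P by (auto simp: K_def)
    then show ?thesis using gc_differentiable(2)[of i y] Inl by (simp add: a_def[abs_def])
  next
    case (Inr j)
    then have "j \<in> Q" using k by (auto simp: K_def)
    then show ?thesis using hc_differentiable(2)[of j y] Inr by (simp add: a_def[abs_def])
  qed
  have ind: "independent_family K (\<lambda>k. a k y)"
    using licq unfolding LICQ_iff_independent_family K_def a_def by simp
  obtain c where c: "c > 0" and ev_low: "\<forall>\<^sub>F y' in nhds y. \<forall>\<nu>. c * (\<Sum>k\<in>K. \<bar>\<nu> k\<bar>) \<le> norm (\<Sum>k\<in>K. \<nu> k *\<^sub>R a k y')"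
    using independent_family_bounded_below[OF finK differentiable_imp_continuous_within[OF a_diff] ind] by blast
  have "\<forall>k\<in>K. \<exists>L\<ge>0. \<forall>\<^sub>F y' in nhds y. norm (a k y' - a k y) \<le> L * norm (y' - y)"
    using differentiable_locally_lipschitz[OF a_diff] by blast
  from bchoice[OF this] obtain La where La0: "\<forall>k\<in>K. La k \<ge> 0 \<and>
    (\<forall>\<^sub>F y' in nhds y. norm (a k y' - a k y) \<le> La k * norm (y' - y))" by blast
  then have La: "\<And>k. k \<in> K \<Longrightarrow> La k \<ge> 0"
    "\<And>k. k \<in> K \<Longrightarrow> \<forall>\<^sub>F y' in nhds y. norm (a k y' - a k y) \<le> La k * norm (y' - y)" by auto
  have ev_a: "\<forall>\<^sub>F y' in nhds y. \<forall>k\<in>K. norm (a k y' - a k y) \<le> La k * norm (y' - y)"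
    using La(2) by (intro eventually_ball_finite finK) blast
  from eventually_conj[OF ev_low eventually_conj[OF ev_a active_set_subset_nearby]]
  obtain \<delta>1 where \<delta>1: "\<delta>1 > 0" and near: "\<And>y'. dist y' y < \<delta>1 \<Longrightarrow>
      (\<forall>\<nu>. c * (\<Sum>k\<in>K. \<bar>\<nu> k\<bar>) \<le> norm (\<Sum>k\<in>K. \<nu> k *\<^sub>R a k y')) \<and>
      (\<forall>k\<in>K. norm (a k y' - a k y) \<le> La k * norm (y' - y)) \<and> active_set P gc y' \<subseteq> I"
    unfolding eventually_nhds_metric by blast
  from differentiable_locally_lipschitz[OF \<psi>_differentiable]
  obtain L0 \<delta>2 where L0: "L0 \<ge> 0" and \<delta>2: "\<delta>2 > 0"
    and near2: "\<And>p. dist p ((x, \<sigma>), y) < \<delta>2 \<Longrightarrow> norm (\<psi> p - \<psi> ((x, \<sigma>), y)) \<le> L0 * norm (p - ((x, \<sigma>), y))"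
    unfolding eventually_nhds_metric by blast
  have w0: "(x, \<sigma>) \<in> W" using x \<sigma> by simp
  have "lipschitz_T (x, \<sigma>)" using lip[OF w0] \<rho> by simp
  from lipschitz_selection[OF x this yT]
  obtain r0 k where r0: "r0 > 0" and k: "k \<ge> 0" and sel: "\<And>w. w \<in> W \<Longrightarrow> dist (x, \<sigma>) w < r0 \<Longrightarrow>
      \<exists>y'\<in>T (fst w) (snd w). dist y y' \<le> k * dist (x, \<sigma>) w" by blast
  \<comment> \<open>\<open>E * n\<close> bounds the defect when the old multipliers are used at the
    new point: the first term for the objective gradient, the sum for the constraint gradients
    weighted by those multipliers.\<close>
  define E where "E = L0 * (1 + k) + (\<Sum>j\<in>K. \<bar>\<mu> j\<bar> * (La j * k))"
  have E: "E \<ge> 0" unfolding E_def using L0 k La by (intro add_nonneg_nonneg sum_nonneg mult_nonneg_nonneg) auto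
  \<comment> \<open>The smallest active multiplier, capped at 1; inserting 1 also covers an empty
    active set.\<close>
  define m where "m = Min (insert 1 ((\<lambda>i. lam $ i) ` I))"
  have m: "m > 0" using strict by (auto simp: m_def strict_complementarity_def)
  have m_le: "m \<le> lam $ i" if "i \<in> I" for i unfolding m_def using that by (intro Min_le) auto
  \<comment> \<open>The first three entries keep the selected point where the local estimates hold;
    the last forces every multiplier to move by less than \<open>m\<close>, with
    \<open>E + 1\<close> excluding a zero denominator.\<close>
  define r where "r = Min {r0, \<delta>1 / (1 + k), \<delta>2 / (1 + k), m * c / (E + 1)}"
  have r: "r > 0" "r \<le> r0" "r \<le> \<delta>1 / (1 + k)" "r \<le> \<delta>2 / (1 + k)" "r \<le> m * c / (E + 1)"
    unfolding r_def using r0 \<delta>1 \<delta>2 m c k E by auto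
  have main: "\<exists>z. y_part z \<in> T (fst w) (snd w) \<and> residual (w, z) = 0 \<and>
      norm (z - z0) \<le> (E / c + k) * norm (w - (x, \<sigma>))" if w: "w \<in> W" "dist (x, \<sigma>) w < r" for w
  proof -
    define n where "n = norm (w - (x, \<sigma>))"
    have n: "n \<ge> 0" "n < r" using w by (simp_all add: n_def dist_norm norm_minus_commute)
    define u s where "u = fst w" and "s = snd w"
    have us: "w = (u, s)" "u \<in> X" using w by (auto simp: u_def s_def)
    from sel[OF w(1)] w(2) r(2) obtain y' where y': "y' \<in> T u s" "dist y y' \<le> k * n"
      unfolding u_def s_def n_def by (auto simp: dist_norm norm_minus_commute)
    have dy: "norm (y' - y) \<le> k * n" using y'(2) by (simp add: dist_norm norm_minus_commute)
    have y'Y: "y' \<in> Y" using y'(1) by (simp add: T_iff)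
    have n1: "n * (1 + k) < \<delta>1" "n * (1 + k) < \<delta>2"
    proof -
      have "n * (1 + k) < r * (1 + k)" using n k by (intro mult_strict_right_mono) auto
      moreover have "r * (1 + k) \<le> \<delta>1" "r * (1 + k) \<le> \<delta>2" using r(3,4) k by (simp_all add: field_simps)
      ultimately show "n * (1 + k) < \<delta>1" "n * (1 + k) < \<delta>2" by linarith+
    qed
    have "dist y' y < \<delta>1" using dy n1(1) n by (simp add: dist_norm algebra_simps)
    note near' = near[OF this]
    have low: "c * (\<Sum>k\<in>K. \<bar>\<nu> k\<bar>) \<le> norm (\<Sum>k\<in>K. \<nu> k *\<^sub>R a k y')" for \<nu> using near' by blast
    have La': "norm (a j y' - a j y) \<le> La j * norm (y' - y)" if "j \<in> K" for j using near' that by blast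
    have act: "active_set P gc y' \<subseteq> I" using near' by blast
    have pn: "norm ((w, y') - ((x, \<sigma>), y)) \<le> (1 + k) * n"
      using norm_Pair_le[of "w - (x, \<sigma>)" "y' - y"] dy by (simp add: n_def algebra_simps)
    have \<psi>_lip: "norm (\<psi> (w, y') - \<psi> ((x, \<sigma>), y)) \<le> L0 * ((1 + k) * n)"
    proof -
      have "norm (\<psi> (w, y') - \<psi> ((x, \<sigma>), y)) \<le> L0 * norm ((w, y') - ((x, \<sigma>), y))"
        by (rule near2) (use pn n1(2) in \<open>simp add: dist_norm mult.commute\<close>)
      also have "\<dots> \<le> L0 * ((1 + k) * n)" using pn L0 by (rule mult_left_mono)
      finally show ?thesis .
    qed
    have "independent_family K (\<lambda>k. a k y')"
      unfolding independent_family_def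
    proof (intro allI impI)
      fix \<nu> assume "(\<Sum>k\<in>K. \<nu> k *\<^sub>R a k y') = 0"
      then have "c * (\<Sum>k\<in>K. \<bar>\<nu> k\<bar>) \<le> 0" using low[of \<nu>] by simp
      then have "(\<Sum>k\<in>K. \<bar>\<nu> k\<bar>) \<le> 0" using c by (simp add: mult_le_0_iff)
      then have "(\<Sum>k\<in>K. \<bar>\<nu> k\<bar>) = 0" by (intro order_antisym sum_nonneg) auto
      then show "\<forall>k\<in>K. \<nu> k = 0" using finK by (simp add: sum_nonneg_eq_0_iff)
    qed
    then have "independent_family (active_set P gc y' <+> Q) (\<lambda>k. a k y')"
      by (rule independent_family_mono[OF _ _ finK]) (use act in \<open>auto simp: K_def\<close>)
    then have "LICQ P gc Q hc y'" unfolding LICQ_iff_independent_family a_def by simp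
    moreover have "((\<lambda>v. h_pen f g s (u, v)) has_derivative (\<lambda>d. d \<bullet> \<psi> ((u, s), y'))) (at y')"
      using us y'Y by (intro h_pen_y_derivative C2_onD(1)[OF f_C2] C2_onD(1)[OF g_C2]) auto
    moreover have "\<forall>v\<in>Y. h_pen f g s (u, y') \<le> h_pen f g s (u, v)" using y'(1) by (simp add: T_iff)
    ultimately have "\<exists>lam nu. (\<forall>i\<in>active_set P gc y'. lam i \<ge> 0) \<and> \<psi> ((u, s), y') +
        (\<Sum>i\<in>active_set P gc y'. lam i *\<^sub>R grad (gc i) y') + (\<Sum>j\<in>Q. nu j *\<^sub>R grad (hc j) y') = 0"
      using y'Y gc_differentiable(1)
      by (intro KKT_of_minimizer[where h = "\<lambda>v. h_pen f g s (u, v)"] hc_affine)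
        (auto simp: Y_def)
    then obtain lam' nu' where K': "\<psi> (w, y') +
        (\<Sum>i\<in>active_set P gc y'. lam' i *\<^sub>R grad (gc i) y') + (\<Sum>j\<in>Q. nu' j *\<^sub>R grad (hc j) y') = 0"
      using us by blast
    \<comment> \<open>The new multipliers extended by 0 to all of \<open>I\<close>, so that both
      stationarity equations run over the same index set \<open>K\<close>.\<close>
    define \<mu>' where "\<mu>' k = case_sum (\<lambda>i. if i \<in> active_set P gc y' then lam' i else 0) nu' k" for k
    define \<delta> where "\<delta> k = \<mu>' k - \<mu> k" for k
    have "(\<Sum>i\<in>I. (if i \<in> active_set P gc y' then lam' i else 0) *\<^sub>R grad (gc i) y')
        = (\<Sum>i\<in>active_set P gc y'. (if i \<in> active_set P gc y' then lam' i else 0) *\<^sub>R grad (gc i) y')"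
      using act by (intro sum.mono_neutral_right) auto
    also have "\<dots> = (\<Sum>i\<in>active_set P gc y'. lam' i *\<^sub>R grad (gc i) y')" by (intro sum.cong) auto
    finally have stat': "\<psi> (w, y') + (\<Sum>k\<in>K. \<mu>' k *\<^sub>R a k y') = 0"
      using K' by (simp add: sumK \<mu>'_def a_def add.assoc)
    have "grad_y (h_pen f g \<sigma>) x y = \<psi> ((x, \<sigma>), y)"
      unfolding grad_y_def
      by (rule grad_eqI, rule h_pen_y_derivative[OF C2_onD(1)[OF f_C2 xyXY] C2_onD(1)[OF g_C2 xyXY]])
    then have stat: "\<psi> ((x, \<sigma>), y) + (\<Sum>k\<in>K. \<mu> k *\<^sub>R a k y) = 0"
      using kkt by (simp add: KKT_multipliers_def sumK \<mu>_def a_def add.assoc)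
    \<comment> \<open>The difference of the two equations, arranged so that the unknown change of
      the multipliers multiplies the gradients at the new point.\<close>
    have "(\<Sum>k\<in>K. \<delta> k *\<^sub>R a k y') = - (\<psi> (w, y') - \<psi> ((x, \<sigma>), y)) - (\<Sum>k\<in>K. \<mu> k *\<^sub>R (a k y' - a k y))"
      using stat stat' unfolding \<delta>_def
      by (simp add: scaleR_diff_left scaleR_diff_right sum_subtractf eq_neg_iff_add_eq_0 algebra_simps)
    also have "norm \<dots> \<le> L0 * ((1 + k) * n) + (\<Sum>j\<in>K. \<bar>\<mu> j\<bar> * (La j * (k * n)))"
    proof -
      have "norm (\<Sum>k\<in>K. \<mu> k *\<^sub>R (a k y' - a k y)) \<le> (\<Sum>j\<in>K. \<bar>\<mu> j\<bar> * (La j * (k * n)))"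
      proof (intro sum_norm_le)
        fix j assume j: "j \<in> K"
        have "norm (a j y' - a j y) \<le> La j * (k * n)"
          using La'[OF j] mult_left_mono[OF dy La(1)[OF j]] by linarith
        then show "norm (\<mu> j *\<^sub>R (a j y' - a j y)) \<le> \<bar>\<mu> j\<bar> * (La j * (k * n))"
          unfolding norm_scaleR by (intro mult_left_mono) auto
      qed
      then show ?thesis using \<psi>_lip
        norm_triangle_ineq4[of "- (\<psi> (w, y') - \<psi> ((x, \<sigma>), y))" "\<Sum>k\<in>K. \<mu> k *\<^sub>R (a k y' - a k y)"]
        unfolding norm_minus_cancel by linarith
    qed
    also have "\<dots> = E * n" unfolding E_def distrib_right sum_distrib_right by (simp add: mult.assoc distrib_right)
    finally have "c * (\<Sum>k\<in>K. \<bar>\<delta> k\<bar>) \<le> E * n" using low[of \<delta>] by linarith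
    then have \<delta>_sum: "(\<Sum>k\<in>K. \<bar>\<delta> k\<bar>) \<le> E / c * n" using c by (simp add: field_simps)
    have \<delta>_small: "\<bar>\<delta> j\<bar> < m" if j: "j \<in> K" for j
    proof -
      have "\<bar>\<delta> j\<bar> \<le> (\<Sum>k\<in>K. \<bar>\<delta> k\<bar>)" using j finK by (intro member_le_sum) auto
      then have 1: "c * \<bar>\<delta> j\<bar> \<le> E * n" using \<open>c * (\<Sum>k\<in>K. \<bar>\<delta> k\<bar>) \<le> E * n\<close> c
        by (meson less_imp_le mult_left_mono order_trans)
      have "E * n \<le> (E + 1) * n" using n by (intro mult_right_mono) auto
      also have "\<dots> < (E + 1) * r" using n E by (intro mult_strict_left_mono) auto
      also have "\<dots> \<le> (E + 1) * (m * c / (E + 1))" using r E by (intro mult_left_mono) auto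
      also have "\<dots> = c * m" using E by simp
      finally have "c * \<bar>\<delta> j\<bar> < c * m" using 1 by linarith
      then show ?thesis using c by simp
    qed
    \<comment> \<open>A released constraint would have new multiplier 0, that is, a jump of at least
      \<open>m\<close>.\<close>
    have active: "i \<in> active_set P gc y'" if i: "i \<in> I" for i
    proof (rule ccontr)
      assume "i \<notin> active_set P gc y'"
      then have "\<delta> (Inl i) = - lam $ i" by (simp add: \<delta>_def \<mu>'_def \<mu>_def)
      then show False using \<delta>_small[OF KI(1)[OF i]] m_le[OF i] by simp
    qed
    \<comment> \<open>Built as a correction of \<open>z0\<close>: entries outside \<open>I\<close>
      and \<open>Q\<close>, which the system leaves undetermined, keep their old values and do not
      spoil the norm bound.\<close>
    define z where "z = z0 + (\<Sum>i\<in>I. axis (Inl i) (\<delta> (Inl i))) + (\<Sum>j\<in>Q. axis (Inr (Inl j)) (\<delta> (Inr j)))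
        + stack 0 0 (y' - y)"
    have yz: "y_part z = y'"
      by (simp add: z_def linear_add[OF linear_y_part] linear_sum[OF linear_y_part])
    have z_lam: "z $ Inl i = \<mu>' (Inl i)" if i: "i \<in> I" for i
    proof -
      have "(\<Sum>l\<in>I. axis (Inl l) (\<delta> (Inl l)) $ (Inl i :: 'p + ('q + 'ny))) = (\<Sum>l\<in>I. if l = i then \<delta> (Inl i) else 0)"
        by (intro sum.cong) (auto simp: axis_def)
      then show ?thesis using i
        by (simp add: z_def sum_component axis_def \<delta>_def \<mu>_def)
    qed
    have z_nu: "z $ Inr (Inl j) = \<mu>' (Inr j)" if j: "j \<in> Q" for j
    proof -
      have "(\<Sum>l\<in>Q. axis (Inr (Inl l)) (\<delta> (Inr l)) $ (Inr (Inl j) :: 'p + ('q + 'ny))) = (\<Sum>l\<in>Q. if l = j then \<delta> (Inr j) else 0)"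
        by (intro sum.cong) (auto simp: axis_def)
      then show ?thesis using j
        by (simp add: z_def sum_component axis_def \<delta>_def \<mu>_def)
    qed
    have "residual (w, z) = 0"
    proof -
      have 1: "gc i y' = 0" if "i \<in> I" for i using active[OF that] by (simp add: active_set_def)
      have 2: "hc j y' = 0" if "j \<in> Q" for j using y'Y that by (simp add: Y_def)
      have "\<psi> (w, y') + (\<Sum>i\<in>I. (z $ Inl i) *\<^sub>R grad (gc i) y') + (\<Sum>j\<in>Q. (z $ Inr (Inl j)) *\<^sub>R grad (hc j) y') = 0"
        using stat' by (simp add: z_lam z_nu sumK a_def add.assoc)
      then show ?thesis by (simp add: residual_def yz 1 2 linear_0[OF linear_stack_zero])
    qed
    moreover have "norm (z - z0) \<le> (E / c + k) * n"
    proof -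
      let ?a = "(\<Sum>i\<in>I. axis (Inl i) (\<delta> (Inl i))) :: real^('p + ('q + 'ny))"
      let ?b = "(\<Sum>j\<in>Q. axis (Inr (Inl j)) (\<delta> (Inr j))) :: real^('p + ('q + 'ny))"
      have nax: "norm (axis i t :: real^('p + ('q + 'ny))) = \<bar>t\<bar>" for i t
        by (simp add: norm_eq_sqrt_inner inner_axis)
      have "norm ?a \<le> (\<Sum>i\<in>I. \<bar>\<delta> (Inl i)\<bar>)" "norm ?b \<le> (\<Sum>j\<in>Q. \<bar>\<delta> (Inr j)\<bar>)"
        by (intro sum_norm_le; simp add: nax)+
      moreover have "z - z0 = ?a + ?b + stack 0 0 (y' - y)" by (simp add: z_def)
      moreover have "norm (?a + ?b + stack 0 0 (y' - y)) \<le> norm ?a + norm ?b + norm (y' - y)"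
        using norm_triangle_ineq[of "?a + ?b" "stack 0 0 (y' - y)"] norm_triangle_ineq[of ?a ?b]
        by (simp add: norm_stack_zero)
      moreover have "(\<Sum>i\<in>I. \<bar>\<delta> (Inl i)\<bar>) + (\<Sum>j\<in>Q. \<bar>\<delta> (Inr j)\<bar>) \<le> E / c * n"
        using \<delta>_sum by (simp add: sumK)
      ultimately have "norm (z - z0) \<le> E / c * n + k * n" using dy by simp
      then show ?thesis by (simp add: distrib_right)
    qed
    ultimately show ?thesis using y'(1) yz unfolding u_def s_def n_def by blast
  qed
  then show ?thesis using r(1) by blast
qed

end

section \<open>Mixed derivatives of the value function\<close>

text \<open>A gradient relative to \<open>S\<close> is only ever tested on the differences
  \<open>u - z\<close>, so changes orthogonal to these are invisible.\<close>

lemma has_gradient_within_cong: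
  assumes F: "has_gradient_within F a z S" and eq: "\<And>u. u \<in> S \<Longrightarrow> (u - z) \<bullet> a = (u - z) \<bullet> b"
  shows "has_gradient_within F b z S"
proof -
  have "norm (F u - F z - (u - z) \<bullet> b) = norm (F u - F z - (u - z) \<bullet> a)" if "u \<in> S" for u
    using eq[OF that] by simp
  then show ?thesis using F
    unfolding has_gradient_within_def has_derivative_within_alt
    by (simp add: bounded_linear_inner_left)
qed

text \<open>The sum is the orthogonal projection of \<open>a\<close> onto \<open>S\<close>.\<close>

lemma orthonormal_basis_of_span:
  fixes S :: "'a::euclidean_space set"
  assumes "subspace S"
  obtains B where "finite B" "B \<subseteq> S" "\<And>d a. d \<in> S \<Longrightarrow> d \<bullet> (\<Sum>e\<in>B. (e \<bullet> a) *\<^sub>R e) = d \<bullet> a"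
proof -
  obtain B where B: "B \<subseteq> S" "pairwise orthogonal B" "\<And>e. e \<in> B \<Longrightarrow> norm e = 1"
    "independent B" "span B = S"
    using orthonormal_basis_subspace[OF assms] by metis
  have fin: "finite B" using B(4) by (rule independent_imp_finite)
  have "d \<bullet> (\<Sum>e\<in>B. (e \<bullet> a) *\<^sub>R e) = d \<bullet> a" if "d \<in> S" for d a
  proof -
    have "(\<Sum>e\<in>B. (d \<bullet> e) *\<^sub>R e) = d"
      using orthonormal_basis_expand[OF B(2,3) _ fin] B(5) that by simp
    then have "d \<bullet> a = (\<Sum>e\<in>B. (d \<bullet> e) *\<^sub>R e) \<bullet> a" by simp
    then show ?thesis by (simp add: inner_sum_left inner_sum_right mult.commute)
  qed
  with fin B(1) show ?thesis by (rule that)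
qed

section \<open>Both mixed derivatives at a regular solution\<close>

context regular_solution
begin

abbreviation "b \<equiv> stack 0 0 (grad_y f x y) :: real^('p + ('q + 'ny))"

definition mixed :: "real^'nx" where
  "mixed = grad_x f x y - zero_block_row A *v (pseudo_inverse M *v b)"

text \<open>The Hessian terms act on the \<open>x\<close> direction only, so a change of
  \<open>\<sigma>\<close> perturbs the system through the gradient of \<open>f\<close>
  alone.\<close>

lemma N_sigma: "N (0, t) = t *\<^sub>R b"
proof -
  have "hess F (x, y) (0, 0) = 0" if "C2_on F (X \<times> Y)" for F
    using linear_0[OF has_derivative_linear[OF has_derivative_hess[OF C2_onD(2)[OF that xyXY]]]]
    by (simp add: zero_prod_def)
  then show ?thesis using f_C2 g_C2 by (simp add: N_def linear_scale[OF linear_stack_zero])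
qed

text \<open>Tested in a direction \<open>d\<close>, the block formula becomes a pairing with
  \<open>N (d, 0)\<close>, the form in which the sensitivity argument delivers derivatives.\<close>

lemma inner_mixed: "d \<bullet> mixed = d \<bullet> grad_x f x y - N (d, 0) \<bullet> (pseudo_inverse M *v b)"
  by (simp add: mixed_def inner_diff_right zero_block_row_mult N_inner)

text \<open>Along a selection of KKT points the first derivatives of \<open>l\<close> are explicit
  functions of the point. To first order they depend on the selection only through
  \<open>b \<bullet> z\<close> or \<open>N (e, 0) \<bullet> z\<close>, and both vectors lie in the
  range of \<open>M\<close>.\<close>

lemma mixed_derivatives:
  "has_dx_dsigma l mixed X x \<sigma>" "has_dsigma_dx l mixed X x \<sigma>"
proof -
  let ?P = "pseudo_inverse M"
  obtain C r where r: "r > 0" and ex: "\<And>w. w \<in> W \<Longrightarrow> dist (x, \<sigma>) w < r \<Longrightarrow>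
    \<exists>z. y_part z \<in> T (fst w) (snd w) \<and> residual (w, z) = 0 \<and> norm (z - z0) \<le> C * norm (w - (x, \<sigma>))"
    using KKT_point_selection by blast
  define z where "z w = (SOME z. y_part z \<in> T (fst w) (snd w) \<and> residual (w, z) = 0 \<and>
      norm (z - z0) \<le> C * norm (w - (x, \<sigma>)))" for w
  have z: "y_part (z w) \<in> T (fst w) (snd w)" "residual (w, z w) = 0"
    "norm (z w - z0) \<le> C * norm (w - (x, \<sigma>))" if "w \<in> W" "dist (x, \<sigma>) w < r" for w
    using someI_ex[OF ex[OF that]] unfolding z_def by auto
  have w0: "(x, \<sigma>) \<in> W" "dist (x, \<sigma>) (x, \<sigma>) < r" using x \<sigma> r by auto
  \<comment> \<open>The Lipschitz bound at distance 0 pins the choice at the base parameter to the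
    given solution and multipliers.\<close>
  have z00: "z (x, \<sigma>) = z0" using z(3)[OF w0] by simp
  have y0: "y_part (z (x, \<sigma>)) = y" by (simp add: z00)
  interpret ss: singular_sensitivity residual N "(*v) M" z "(x, \<sigma>)" W r C
  proof (rule singular_sensitivity.intro)
    show "(residual has_derivative (\<lambda>(d, e). N d + M *v e)) (at ((x, \<sigma>), z (x, \<sigma>)))"
      unfolding z00 by (rule residual_has_derivative)
    show "residual ((x, \<sigma>), z (x, \<sigma>)) = 0" by (rule z(2)[OF w0])
    show "residual (w, z w) = 0" if "w \<in> W" "dist (x, \<sigma>) w < r" for w by (rule z(2)[OF that])
    show "norm (z w - z (x, \<sigma>)) \<le> C * norm (w - (x, \<sigma>))" if "w \<in> W" "dist (x, \<sigma>) w < r" for w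
      unfolding z00 by (rule z(3)[OF that])
  qed (rule r linear_N matrix_vector_mul_linear)+
  have y_lip: "norm (y_part (z w) - y) \<le> C * norm (w - (x, \<sigma>))"
    if "w \<in> W" "dist (x, \<sigma>) w < r" for w
    using norm_y_part_le[of "z w - z0"] z(3)[OF that] by (simp add: linear_diff[OF linear_y_part])
  \<comment> \<open>Increasing \<open>\<sigma>\<close> stays admissible even at
    \<open>\<sigma> = 0\<close>, so \<open>(0, 1)\<close> is always a feasible direction.\<close>
  have b_range: "b \<in> range ((*v) M)"
    using ss.direction_in_range[of 1 "(0, 1)"] x \<sigma> by (simp add: N_sigma)
  define S where "S = span ((\<lambda>u. u - x) ` X)"
  have N_range: "N (d, 0) \<in> range ((*v) M)" if "d \<in> S" for d
  proof -
    have l: "linear (\<lambda>d. N (d, 0))"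
      using linear_compose[OF _ linear_N, of "\<lambda>d. (d, 0)"] by (simp add: o_def linear_iff)
    have "subspace ((\<lambda>d. N (d, 0)) -` range ((*v) M))"
      by (intro linear_subspace_vimage l linear_subspace_image subspace_UNIV) simp
    moreover have "(\<lambda>u. u - x) ` X \<subseteq> (\<lambda>d. N (d, 0)) -` range ((*v) M)"
    proof (intro image_subsetI vimageI2)
      fix u assume u: "u \<in> X"
      \<comment> \<open>Convexity puts the segment from \<open>x\<close> to \<open>u\<close> into
        \<open>X\<close>; since the range is a subspace, membership then extends from
        \<open>u - x\<close> to the whole span.\<close>
      have "x + t *\<^sub>R (u - x) \<in> X" if "0 < t" "t < 1" for t
      proof -
        have "x + t *\<^sub>R (u - x) = (1 - t) *\<^sub>R x + t *\<^sub>R u" by (simp add: algebra_simps)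
        then show ?thesis using convexD_alt[OF X_convex x u, of t] that by simp
      qed
      then show "N (u - x, 0) \<in> range ((*v) M)"
        using ss.direction_in_range[of 1 "(u - x, 0)"] \<sigma> by simp
    qed
    ultimately show ?thesis using span_minimal that unfolding S_def by blast
  qed
  note functional = ss.functional_has_derivative[OF M_selfadjoint matrix_vector_mul_linear
      pseudo_inverse_selfadjoint(1)[OF M_selfadjoint]]
  note P_sym = pseudo_inverse_selfadjoint(2)[OF M_selfadjoint]

  show "has_dx_dsigma l mixed X x \<sigma>"
  proof -
    define D where "D u = f (u, y_part (z (u, \<sigma>)))" for u
    have W: "(u, \<sigma>) \<in> W" "dist (x, \<sigma>) (u, \<sigma>) = dist x u" if "u \<in> X" for u
      using that \<sigma> by (auto simp: dist_Pair_Pair)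
    have der: "(l u has_real_derivative D u) (at \<sigma> within {0..})" if "u \<in> X \<inter> ball x (min r \<rho>)" for u
      unfolding D_def using that W[of u] z(1)[of "(u, \<sigma>)"] by (intro value_dsigma lip) auto
    define q where "q u = (u, y_part (z (u, \<sigma>)))" for u
    have q0: "q x = (x, y)" by (simp add: q_def y0)
    \<comment> \<open>The selected point is only Lipschitz in \<open>u\<close>, so \<open>f\<close>
      along it is first replaced by its linear part, in which the \<open>y\<close> component is
      \<open>b \<bullet> z\<close>.\<close>
    have 1: "((\<lambda>u. f (q u) - q u \<bullet> grad f (x, y)) has_derivative (\<lambda>_. 0)) (at x within X)"
    proof (rule lipschitz_path_has_derivative_zero[where r = r and C = "1 + C"])
      show "(f has_derivative (\<lambda>p. p \<bullet> grad f (x, y))) (at (q x))"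
        unfolding q0 by (rule has_derivative_grad[OF C2_onD(1)[OF f_C2 xyXY]])
      fix u assume u: "u \<in> X" "dist x u < r"
      show "norm (q u - q x) \<le> (1 + C) * norm (u - x)"
        using norm_Pair_le[of "u - x" "y_part (z (u, \<sigma>)) - y"] y_lip[of "(u, \<sigma>)"] W[OF u(1)] u
        by (simp add: q_def y0 distrib_right)
    qed (rule r)
    have 2: "((\<lambda>u. b \<bullet> z (u, \<sigma>)) has_derivative (\<lambda>d. - (b \<bullet> (?P *v N (d, 0))))) (at x within X)"
      by (rule has_derivative_in_compose[where f = "\<lambda>u. (u, \<sigma>)" and g = "\<lambda>w. b \<bullet> z w"])
        (intro derivative_intros, rule has_derivative_subset[OF functional[OF b_range]], use \<sigma> in auto)
    have "D = (\<lambda>u. (f (q u) - q u \<bullet> grad f (x, y)) + (u \<bullet> grad_x f x y + b \<bullet> z (u, \<sigma>)))"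
      using grad_Pair(1,2)[OF C2_onD(1)[OF f_C2 xyXY]]
      by (simp add: D_def q_def fun_eq_iff inner_prod_def inner_commute[of "stack 0 0 _"] inner_stack_zero)
    moreover have "((\<lambda>u. (f (q u) - q u \<bullet> grad f (x, y)) + (u \<bullet> grad_x f x y + b \<bullet> z (u, \<sigma>)))
        has_derivative (\<lambda>d. 0 + (d \<bullet> grad_x f x y + - (b \<bullet> (?P *v N (d, 0)))))) (at x within X)"
      by (intro has_derivative_add 1 2 has_derivative_inner_left has_derivative_ident)
    moreover have "b \<bullet> (?P *v N (d, 0)) = N (d, 0) \<bullet> (?P *v b)" for d
      using P_sym[of b "N (d, 0)"] by (simp add: inner_commute)
    ultimately have "has_gradient_within D mixed x X"
      unfolding has_gradient_within_def inner_mixed by simp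
    then show ?thesis unfolding has_dx_dsigma_def
      using der r \<rho> by (intro exI[of _ D] exI[of _ "min r \<rho>"]) auto
  qed

  show "has_dsigma_dx l mixed X x \<sigma>"
  proof -
    define ys where "ys s = y_part (z (x, s))" for s
    define Gs where "Gs s = s *\<^sub>R grad_x f x (ys s) + grad_x g x (ys s)" for s
    have W: "(x, s) \<in> W" "dist (x, \<sigma>) (x, s) = \<bar>s - \<sigma>\<bar>" if "s \<ge> 0" for s
      using that x by (auto simp: dist_Pair_Pair dist_real_def)
    have ysT: "ys s \<in> T x s" if "s \<ge> 0" "\<bar>s - \<sigma>\<bar> < r" for s
      using z(1)[of "(x, s)"] W[OF that(1)] that unfolding ys_def by simp
    have grad: "has_gradient_within (\<lambda>u. l u s) (Gs s) x X" if "s \<ge> 0" "\<bar>s - \<sigma>\<bar> < min r \<rho>" for s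
      unfolding Gs_def using that W[of s] ysT[of s] by (intro value_gradient x lip) auto
    have Gs_der: "((\<lambda>s. e \<bullet> Gs s) has_real_derivative e \<bullet> mixed) (at \<sigma> within {0..})" if e: "e \<in> S" for e
    proof -
      \<comment> \<open>The \<open>e\<close> component of the gradient of \<open>h_pen\<close> in
        \<open>x\<close>, with \<open>s\<close> and the lower variable independent; the selection
        enters afterwards through the path \<open>q\<close>, and \<open>\<phi>'\<close> is the
        derivative at the base point.\<close>
      define \<phi> where "\<phi> p = e \<bullet> (fst p *\<^sub>R fst (grad f (x, snd p)) + fst (grad g (x, snd p)))" for p
      define \<phi>' where "\<phi>' p = fst p * (e \<bullet> grad_x f x y) + e \<bullet> (A *v snd p)" for p
      define q where "q s = (s, ys s)" for s
      have q0: "q \<sigma> = (\<sigma>, y)" by (simp add: q_def ys_def y0)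
      have "(\<phi> has_derivative \<phi>') (at (q \<sigma>))"
      proof -
        have *: "((\<lambda>p. fst (grad F (x, snd p))) has_derivative (\<lambda>d. fst (hess F (x, y) (0, snd d)))) (at (\<sigma>, y))"
          if "C2_on F (X \<times> Y)" for F
        proof -
          have "((\<lambda>p. grad F (x, snd p)) has_derivative (\<lambda>d. hess F (x, y) (0, snd d))) (at (\<sigma>, y))"
            by (rule has_derivative_compose[where g = "grad F" and f = "\<lambda>p. (x, snd p)"])
              (auto intro!: derivative_eq_intros has_derivative_hess C2_onD(2)[OF that xyXY])
          then show ?thesis by (rule has_derivative_fst)
        qed
        have "(\<phi> has_derivative (\<lambda>d. e \<bullet> ((\<sigma> *\<^sub>R fst (hess f (x, y) (0, snd d)) + fst d *\<^sub>R fst (grad f (x, y)))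
            + fst (hess g (x, y) (0, snd d))))) (at (\<sigma>, y))"
          unfolding \<phi>_def
          by (rule has_derivative_eq_rhs, rule has_derivative_inner_right[OF
                has_derivative_add[OF has_derivative_scaleR[OF _ *[OF f_C2]] *[OF g_C2]]])
            (auto intro!: derivative_eq_intros)
        then show ?thesis unfolding q0
          by (rule has_derivative_eq_rhs)
            (simp add: fun_eq_iff \<phi>'_def hess_xy_mult inner_add_right
              grad_Pair(1)[OF C2_onD(1)[OF f_C2 xyXY]])
      qed
      then have 1: "((\<lambda>s. \<phi> (q s) - \<phi>' (q s)) has_derivative (\<lambda>_. 0)) (at \<sigma> within {0..})"
      proof (rule lipschitz_path_has_derivative_zero[where r = r and C = "1 + C"])
        fix s assume s: "s \<in> {0..}" "dist \<sigma> s < r"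
        then have "\<bar>s - \<sigma>\<bar> < r" by (simp add: dist_real_def abs_minus_commute)
        then show "norm (q s - q \<sigma>) \<le> (1 + C) * norm (s - \<sigma>)"
          using norm_Pair_le[of "s - \<sigma>" "ys s - y"] y_lip[of "(x, s)"] W[of s] s
          by (simp add: q_def q0 ys_def y0 distrib_right)
      qed (rule r)
      have 2: "((\<lambda>s. N (e, 0) \<bullet> z (x, s)) has_derivative (\<lambda>t. - (N (e, 0) \<bullet> (?P *v N (0, t))))) (at \<sigma> within {0..})"
        by (rule has_derivative_in_compose[where f = "\<lambda>s. (x, s)" and g = "\<lambda>w. N (e, 0) \<bullet> z w"])
          (intro derivative_intros, rule has_derivative_subset[OF functional[OF N_range[OF e]]], use x in auto)
      have 3: "((\<lambda>s. (\<phi> (q s) - \<phi>' (q s)) + (s * (e \<bullet> grad_x f x y) + N (e, 0) \<bullet> z (x, s))) has_derivative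
          (\<lambda>t. 0 + (t * (e \<bullet> grad_x f x y) + - (N (e, 0) \<bullet> (?P *v N (0, t)))))) (at \<sigma> within {0..})"
        by (intro has_derivative_add 1 2 has_derivative_mult_left has_derivative_ident)
      \<comment> \<open>By \<open>N_inner\<close> the term of \<open>\<phi>'\<close> in the lower
        variable is \<open>N (e, 0) \<bullet> z\<close>, a functional whose derivative is known
        because \<open>e\<close> lies in \<open>S\<close>.\<close>
      have "\<phi> (q s) = (\<phi> (q s) - \<phi>' (q s)) + (s * (e \<bullet> grad_x f x y) + N (e, 0) \<bullet> z (x, s))" for s
        by (simp add: \<phi>'_def q_def ys_def N_inner)
      then have "((\<lambda>s. \<phi> (q s)) has_derivative (\<lambda>t. (e \<bullet> mixed) * t)) (at \<sigma> within {0..})"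
        using 3 by (simp add: inner_mixed N_sigma scalar_mult_eq_scaleR[symmetric] vector_scalar_commute)
          (simp add: scalar_mult_eq_scaleR algebra_simps)
      then have D: "((\<lambda>s. \<phi> (q s)) has_real_derivative e \<bullet> mixed) (at \<sigma> within {0..})"
        unfolding has_field_derivative_def .
      have "\<phi> (q s) = e \<bullet> Gs s" if "s \<in> {0..}" "dist s \<sigma> < r" for s
      proof -
        have "(x, ys s) \<in> X \<times> Y" using ysT[of s] that x by (auto simp: T_iff dist_real_def)
        then show ?thesis
          by (simp add: \<phi>_def q_def Gs_def grad_Pair(1)[OF C2_onD(1)[OF f_C2]] grad_Pair(1)[OF C2_onD(1)[OF g_C2]])
      qed
      then show ?thesis
        by (intro has_field_derivative_transform_within[OF D r]) (use \<sigma> in auto)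
    qed
    obtain B where B: "finite B" "B \<subseteq> S" "\<And>d a. d \<in> S \<Longrightarrow> d \<bullet> (\<Sum>e\<in>B. (e \<bullet> a) *\<^sub>R e) = d \<bullet> a"
      using orthonormal_basis_of_span[of S] unfolding S_def by auto
    \<comment> \<open>Gradients relative to \<open>X\<close> are only determined modulo the orthogonal complement of \<open>S\<close>;
      there the component of \<open>G\<close> is chosen to be linear in \<open>s\<close>.\<close>
    define G where "G s = (\<Sum>e\<in>B. (e \<bullet> Gs s) *\<^sub>R e) + (s - \<sigma>) *\<^sub>R (mixed - (\<Sum>e\<in>B. (e \<bullet> mixed) *\<^sub>R e))" for s
    have "has_gradient_within (\<lambda>u. l u s) (G s) x X" if s: "s \<ge> 0" "\<bar>s - \<sigma>\<bar> < min r \<rho>" for s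
    proof (rule has_gradient_within_cong[OF grad[OF s]])
      fix u assume "u \<in> X"
      then have "u - x \<in> S" unfolding S_def by (auto intro: span_base)
      then show "(u - x) \<bullet> Gs s = (u - x) \<bullet> G s"
        by (simp add: G_def inner_add_right inner_diff_right B(3))
    qed
    moreover have "(G has_vector_derivative mixed) (at \<sigma> within {0..})"
    proof -
      have "((\<lambda>s. (\<Sum>e\<in>B. (e \<bullet> Gs s) *\<^sub>R e)) has_vector_derivative (\<Sum>e\<in>B. (e \<bullet> mixed) *\<^sub>R e)) (at \<sigma> within {0..})"
      proof (intro has_vector_derivative_sum)
        fix e assume "e \<in> B"
        then have "((\<lambda>s. e \<bullet> Gs s) has_real_derivative e \<bullet> mixed) (at \<sigma> within {0..})"
          using Gs_der B(2) by blast
        then show "((\<lambda>s. (e \<bullet> Gs s) *\<^sub>R e) has_vector_derivative (e \<bullet> mixed) *\<^sub>R e) (at \<sigma> within {0..})"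
          using has_vector_derivative_scaleR[OF _ has_vector_derivative_const, of "\<lambda>s. e \<bullet> Gs s" "e \<bullet> mixed" \<sigma> "{0..}" e]
          by simp
      qed
      moreover have "((\<lambda>s. (s - \<sigma>) *\<^sub>R k) has_vector_derivative k) (at \<sigma> within {0..})" for k :: "real^'nx"
        by (auto intro!: derivative_eq_intros)
      ultimately have "(G has_vector_derivative (\<Sum>e\<in>B. (e \<bullet> mixed) *\<^sub>R e) + (mixed - (\<Sum>e\<in>B. (e \<bullet> mixed) *\<^sub>R e))) (at \<sigma> within {0..})"
        unfolding G_def by (rule has_vector_derivative_add)
      then show ?thesis by simp
    qed
    ultimately show ?thesis unfolding has_dsigma_dx_def
      using r \<rho> by (intro exI[of _ G] exI[of _ "min r \<rho>"]) auto
  qed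
qed

end

section \<open>The limit as the penalty parameter tends to zero from the right\<close>

lemma (in penalty_problem) limit_sigma_zero:
  assumes x: "x \<in> X" and ds: "has_dsigma_dx l v X x 0" and dx: "has_dx_dsigma l v X x 0"
  shows "has_gradient_within (psi f g Y) v x X"
    and "\<exists>G. (\<forall>\<^sub>F s in at_right 0. has_gradient_within (psi_pen f g Y s) (G s) x X) \<and> (G \<longlongrightarrow> v) (at_right 0)"
proof -
  from dx obtain D \<epsilon> where \<epsilon>: "\<epsilon> > 0"
    and D: "\<And>u. u \<in> X \<inter> ball x \<epsilon> \<Longrightarrow> (l u has_real_derivative D u) (at 0 within {0..})"
    and grad_D: "has_gradient_within D v x X" unfolding has_dx_dsigma_def by blast
  \<comment> \<open>Limits along this filter are unique, which in the case of an empty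
    \<open>Y\<close> forces the right derivatives \<open>D u\<close> to be 0.\<close>
  have nontriv: "at (0::real) within {0..} \<noteq> bot"
  proof
    assume "at (0::real) within {0..} = bot"
    moreover have "at_right (0::real) \<le> at 0 within {0..}" by (rule at_le) auto
    ultimately have "at_right (0::real) = bot" by (simp add: bot_unique)
    then show False using trivial_limit_at_right_real by blast
  qed
  show "has_gradient_within (psi f g Y) v x X"
  proof (cases "Y = {}")
    case True
    \<comment> \<open>Here \<open>l\<close> and \<open>psi\<close> are the constant \<open>Inf {}\<close>, so only their gradients can be compared.\<close>
    have l: "l u = (\<lambda>_. Inf {})" for u by (simp add: l_val_def True fun_eq_iff)
    have D0: "D u = 0" if "u \<in> X \<inter> ball x \<epsilon>" for u
    proof -
      have "((\<lambda>h. 0) \<longlongrightarrow> D u) (at (0::real) within {0..})"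
        using D[OF that] unfolding l has_field_derivative_iff by simp
      from tendsto_unique[OF nontriv this tendsto_const] show ?thesis .
    qed
    have T0: "T_sol f g Y u 0 = {}" for u using T_iff[of _ u 0] True by blast
    have psi: "psi f g Y u = Inf {}" for u by (simp add: psi_def T0)
    have "((\<lambda>u. psi f g Y u - Inf {}) has_derivative (\<lambda>d. d \<bullet> v)) (at x within X)"
      by (rule has_derivative_transform_within[OF grad_D[unfolded has_gradient_within_def] \<epsilon> x])
        (simp add: D0 psi dist_commute)
    from has_derivative_add[OF this has_derivative_const[of "Inf {}"]]
    show ?thesis unfolding has_gradient_within_def by simp
  next
    case False
    have "D u = psi f g Y u" if "u \<in> X" "dist u x < \<epsilon>" for u
      using dsigma_zero_eq_psi[OF that(1) False D] that by (simp add: dist_commute)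
    then show ?thesis unfolding has_gradient_within_def
      by (rule has_derivative_transform_within[OF grad_D[unfolded has_gradient_within_def] \<epsilon> x])
  qed
  from ds obtain G \<delta> where \<delta>: "\<delta> > 0"
    and G: "\<And>s. s \<ge> 0 \<Longrightarrow> \<bar>s\<bar> < \<delta> \<Longrightarrow> has_gradient_within (\<lambda>u. l u s) (G s) x X"
    and G': "(G has_vector_derivative v) (at 0 within {0..})" unfolding has_dsigma_dx_def by auto
  \<comment> \<open>The neighbourhood in \<open>has_dsigma_dx\<close> includes \<open>s = 0\<close>,
    so \<open>G 0\<close> is a gradient of \<open>l\<close> at 0 and \<open>H\<close> is a genuine
    difference quotient of gradients.\<close>
  define H where "H s = (1 / s) *\<^sub>R (G s - G 0)" for s
  have "has_gradient_within (psi_pen f g Y s) (H s) x X" if s: "0 < s" "s < \<delta>" for s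
  proof -
    have "((\<lambda>u. (1 / s) * (l u s - l u 0)) has_derivative (\<lambda>d. (1 / s) * (d \<bullet> G s - d \<bullet> G 0))) (at x within X)"
      using G[of s] G[of 0] s \<delta> unfolding has_gradient_within_def
      by (intro has_derivative_mult_right has_derivative_diff) auto
    then show ?thesis unfolding has_gradient_within_def psi_pen_def H_def
      by (simp add: inner_diff_right)
  qed
  then have "\<forall>\<^sub>F s in at_right 0. has_gradient_within (psi_pen f g Y s) (H s) x X"
    using \<delta> by (auto simp: eventually_at_right_field)
  moreover have "(H \<longlongrightarrow> v) (at_right 0)"
  proof (rule LIM_zero_cancel)
    have "((\<lambda>s. (1 / norm (s - 0)) *\<^sub>R (G s - (G 0 + (s - 0) *\<^sub>R v))) \<longlongrightarrow> 0) (at 0 within {0..})"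
      using G' unfolding has_vector_derivative_def has_derivative_within by blast
    then have "((\<lambda>s. (1 / norm (s - 0)) *\<^sub>R (G s - (G 0 + (s - 0) *\<^sub>R v))) \<longlongrightarrow> 0) (at_right 0)"
      by (rule tendsto_within_subset) auto
    moreover have "\<forall>\<^sub>F s in at_right 0. (1 / norm (s - 0)) *\<^sub>R (G s - (G 0 + (s - 0) *\<^sub>R v)) = H s - v"
      unfolding eventually_at_right_field
      by (intro exI[of _ 1]) (auto simp: H_def scaleR_diff_right scaleR_add_right)
    ultimately show "((\<lambda>s. H s - v) \<longlongrightarrow> 0) (at_right 0)" by (rule Lim_transform_eventually)
  qed
  ultimately show "\<exists>G. (\<forall>\<^sub>F s in at_right 0. has_gradient_within (psi_pen f g Y s) (G s) x X) \<and> (G \<longlongrightarrow> v) (at_right 0)"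
    by blast
qed

theorem theorem3p1:
  fixes f g :: "(real^'nx) \<times> (real^'ny) \<Rightarrow> real"
    and X :: "(real^'nx) set" and Y :: "(real^'ny) set"
    and P :: "'p::finite set" and gc :: "'p \<Rightarrow> real^'ny \<Rightarrow> real"
    and Q :: "'q::finite set" and hc :: "'q \<Rightarrow> real^'ny \<Rightarrow> real"
    and lf0 lf1 lg1 :: real
    and x :: "real^'nx"
  assumes X: "closed X" "convex X"
    and Y: "closed Y" "convex Y" "bounded Y"
    and f_C2: "C2_on f (X \<times> Y)" and g_C2: "C2_on g (X \<times> Y)"
    and hess_f: "\<And>z. z \<in> X \<times> Y \<Longrightarrow> onorm (hess f z) \<le> lf1"
    and hess_g: "\<And>z. z \<in> X \<times> Y \<Longrightarrow> onorm (hess g z) \<le> lg1"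
    and f_below: "\<And>u. u \<in> X \<Longrightarrow> bdd_below ((\<lambda>y. f (u, y)) ` Y)"
    and g_below: "\<And>u. u \<in> X \<Longrightarrow> bdd_below ((\<lambda>y. g (u, y)) ` Y)"
    and f_coercive: "\<And>u. u \<in> X \<Longrightarrow>
          filterlim (\<lambda>y. f (u, y)) at_top (inf at_infinity (principal Y))"
    and g_coercive: "\<And>u. u \<in> X \<Longrightarrow>
          filterlim (\<lambda>y. g (u, y)) at_top (inf at_infinity (principal Y))"
    and grad_f: "\<And>u y. u \<in> X \<Longrightarrow> y \<in> Y \<Longrightarrow> norm (grad_y f u y) \<le> lf0"
    and f_bounded: "bounded (f ` (X \<times> Y))"
    and Y_def: "Y = {y. (\<forall>i\<in>P. gc i y \<le> 0) \<and> (\<forall>j\<in>Q. hc j y = 0)}"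
    and gc: "\<And>i. i \<in> P \<Longrightarrow> convex_on UNIV (gc i)" "\<And>i. i \<in> P \<Longrightarrow> C2_on (gc i) UNIV"
    and hc: "\<And>j. j \<in> Q \<Longrightarrow> \<exists>a b. \<forall>y. hc j y = a \<bullet> y + b"
    and x: "x \<in> X"
  shows
    "(\<forall>\<sigma>\<ge>0.
       (\<exists>\<rho>>0. \<forall>w\<in>(X \<times> {0..}) \<inter> ball (x, \<sigma>) \<rho>.
          locally_lipschitz_at (\<lambda>(u, s). T_sol f g Y u s) (X \<times> {0..}) w) \<longrightarrow>
       (\<forall>y lam nu.
          y \<in> T_sol f g Y x \<sigma> \<and>
          LICQ P gc Q hc y \<and>
          KKT_multipliers (h_pen f g \<sigma>) P gc Q hc x y lam nu \<and>
          strict_complementarity P gc y lam \<and>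
          isCont (hess_lagrangian (h_pen f g \<sigma>) (active_set P gc y) gc Q hc x) (stack lam nu y)
          \<longrightarrow>
          (let v = grad_x f x y -
                 zero_block_row (hess_xy (h_pen f g \<sigma>) x y) *v
                   (pseudo_inverse
                      (hess_lagrangian (h_pen f g \<sigma>) (active_set P gc y) gc Q hc x (stack lam nu y))
                    *v stack 0 0 (grad_y f x y))
           in has_dx_dsigma (l_val f g Y) v X x \<sigma> \<and> has_dsigma_dx (l_val f g Y) v X x \<sigma>)))
     \<and>
     (\<forall>v. has_dsigma_dx (l_val f g Y) v X x 0 \<and> has_dx_dsigma (l_val f g Y) v X x 0 \<longrightarrow>
        has_gradient_within (psi f g Y) v x X \<and>
        (\<exists>G. (\<forall>\<^sub>F s in at_right 0. has_gradient_within (psi_pen f g Y s) (G s) x X) \<and>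
             (G \<longlongrightarrow> v) (at_right 0)))"
proof (intro conjI allI impI)
  have compY: "compact Y" using Y by (simp add: compact_eq_bounded_closed)
  interpret pp: penalty_problem f g X Y
    by unfold_locales (rule compY f_C2 g_C2)+
  {
    fix v assume "has_dsigma_dx (l_val f g Y) v X x 0 \<and> has_dx_dsigma (l_val f g Y) v X x 0"
    then show "has_gradient_within (psi f g Y) v x X"
      and "\<exists>G. (\<forall>\<^sub>F s in at_right 0. has_gradient_within (psi_pen f g Y s) (G s) x X) \<and> (G \<longlongrightarrow> v) (at_right 0)"
      using pp.limit_sigma_zero[OF x] by blast+
  next
    fix \<sigma> :: real and y lam nu
    assume \<sigma>: "\<sigma> \<ge> 0"
      and lip: "\<exists>\<rho>>0. \<forall>w\<in>(X \<times> {0..}) \<inter> ball (x, \<sigma>) \<rho>.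
          locally_lipschitz_at (\<lambda>(u, s). T_sol f g Y u s) (X \<times> {0..}) w"
      and sol: "y \<in> T_sol f g Y x \<sigma> \<and> LICQ P gc Q hc y \<and>
          KKT_multipliers (h_pen f g \<sigma>) P gc Q hc x y lam nu \<and>
          strict_complementarity P gc y lam \<and>
          isCont (hess_lagrangian (h_pen f g \<sigma>) (active_set P gc y) gc Q hc x) (stack lam nu y)"
    from lip obtain \<rho> where \<rho>: "\<rho> > 0" "\<And>w. w \<in> X \<times> {0..} \<Longrightarrow> dist (x, \<sigma>) w < \<rho> \<Longrightarrow>
        locally_lipschitz_at (\<lambda>(u, s). T_sol f g Y u s) (X \<times> {0..}) w"
      by (meson IntI mem_ball)
    interpret rs: regular_solution f g X Y P gc Q hc x \<sigma> \<rho> y lam nu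
      by (intro regular_solution.intro regular_solution_axioms.intro pp.penalty_problem_axioms)
        (use X Y_def gc(2) hc x \<sigma> \<rho> sol in blast)+
    show "let v = grad_x f x y -
                 zero_block_row (hess_xy (h_pen f g \<sigma>) x y) *v
                   (pseudo_inverse
                      (hess_lagrangian (h_pen f g \<sigma>) (active_set P gc y) gc Q hc x (stack lam nu y))
                    *v stack 0 0 (grad_y f x y))
           in has_dx_dsigma (l_val f g Y) v X x \<sigma> \<and> has_dsigma_dx (l_val f g Y) v X x \<sigma>"
      using rs.mixed_derivatives unfolding rs.mixed_def Let_def by blast
  }
qed

end
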